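(* Consider the game, with agents $i\in\mathcal I=\{1,\dots,N\}$, described in the context, and suppose that: (1) for each $i\in\mathcal I$, $\Omega_i\subseteq\mathbb R^{n_i}$ is closed and convex; $g_i:\mathbb R^{n_i}\to\mathbb R^m$ is componentwise convex and twice continuously differentiable; the set $\mathcal X=\Omega\cap\{x\in\mathbb R^n\mid g(x)\le \mathbf 0_m\}$ satisfies Slater's constraint qualification; $J_i$ is continuously differentiable and $J_i(\cdot,x_{-i})$ is convex for every $x_{-i}$; (2) the pseudo-gradient $F$ is $\mu$-strongly monotone for some $\mu>0$ and $\theta_0$-Lipschitz continuous for some $\theta_0>0$; (3) the communication graph $\mathcal G(\mathcal I,\mathcal E)$ is undirected and connected. Let $\gamma_i>0$ for all $i\in\mathcal I$, and consider the projected dynamical system in the variables $\mathrm{col}(\boldsymbol x,\boldsymbol k,\boldsymbol z,\boldsymbol\lambda)\in\mathbb R^{Nn}\times\mathbb R^N\times\mathbb R^{Nm}\times\mathbb R^{Nm}$: $$\begin{aligned} \dot{\boldsymbol x}&=\Pi_{\boldsymbol\Omega}\big(\boldsymbol x,\,-\mathcal R^\top(\boldsymbol F(\boldsymbol x)+\mathbb G(\mathcal R\boldsymbol x)^\top\boldsymbol\lambda)-\boldsymbol L_nK\boldsymbol\rho\big),\\ \dot{\boldsymbol k}&=D(\boldsymbol\rho)^\top(\Gamma\otimes I_n)\boldsymbol\rho,\qquad \boldsymbol\rho=\boldsymbol L_n\boldsymbol x,\\ \dot{\boldsymbol z}&=\boldsymbol L_m\boldsymbol\lambda,\\ \dot{\boldsymbol\lambda}&=\Pi_{\mathbb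 R^{Nm}_{\ge0}}\big(\boldsymbol\lambda,\,\boldsymbol g(\mathcal R\boldsymbol x)-\boldsymbol z-\boldsymbol L_m\boldsymbol\lambda\big). \end{aligned}$$ Then, for any initial condition in $S=\boldsymbol\Omega\times\mathbb R^N\times\boldsymbol E_m^\perp\times\mathbb R^{mN}_{\ge0}$, the system has a unique Carathéodory solution (on $[0,\infty)$), which belongs to $S$ for all $t\ge0$. The solution converges to an equilibrium $\mathrm{col}(\bar{\boldsymbol x},\bar{\boldsymbol k},\bar{\boldsymbol z},\bar{\boldsymbol\lambda})$ with $\bar{\boldsymbol x}=\mathbf 1_N\otimes x^*$, $\bar{\boldsymbol\lambda}=\mathbf 1_N\otimes\lambda^*$, where $(x^*,\lambda^* )\in\mathbb R^n\times\mathbb R^m$ satisfies the KKT conditions $$\mathbf 0_n\in F(x^* )+\tfrac{\partial}{\partial x}g(x^* )^\top\lambda^*+\mathrm N_\Omega(x^* ),\qquad \mathbf 0_m\in -g(x^* )+\mathrm N_{\mathbb R^m_{\ge0}}(\lambda^* );$$ hence $x^*$ is the variational generalized Nash equilibrium (v-GNE) of the game.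
   Context: Game. Agent $i$ chooses $x_i\in\Omega_i\subseteq\mathbb R^{n_i}$; $n=\sum_i n_i$, $x=\mathrm{col}((x_i)_{i\in\mathcal I})$ (stacking), $x_{-i}=\mathrm{col}((x_j)_{j\ne i})$, $\Omega=\times_i\Omega_i\subseteq\mathbb R^n$. Agent $i$ has cost $J_i(x_i,x_{-i})\in\mathbb R$. The coupling constraints are $g(x):=\sum_{i}g_i(x_i)\le\mathbf 0_m$, with $g_i:\mathbb R^{n_i}\to\mathbb R^m$, and $\mathcal X=\Omega\cap\{x\mid g(x)\le\mathbf 0_m\}$. A generalized Nash equilibrium (GNE) is $x^*$ such that, for all $i$, $x_i^*\in\operatorname{argmin}_{y_i}J_i(y_i,x_{-i}^* )$ subject to $(y_i,x_{-i}^* )\in\mathcal X$. A v-GNE is a GNE whose individual KKT systems hold with equal dual variables for all agents, i.e. $x^*$ for which there is $\lambda^*$ such that $(x^*,\lambda^* )$ satisfies the KKT conditions displayed in the claim. Pseudo-gradient: $F(x):=\mathrm{col}((\nabla_{x_i}J_i(x_i,x_{-i}))_{i\in\mathcal I})$. $F$ is $\mu$-strongly monotone if $(F(x)-F(y))^\top(x-y)\ge\mu\|x-y\|^2$ for all $x,y$. Graph: $W$ is the symmetric adjacency matrix of $\mathcal G$ ($[W]_{i,j}=1$ if $(i,j)\in\mathcal E$, $0$ otherwise) and $L$ its symmetric Laplacian; $\boldsymbol L_q:=L\otimes I_q$. Stacked variables: each agent $i$ holds $\boldsymbol x^i=\mathrm{col}((\boldsymbol x^i_j)_{j\in\mathcal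 I})\in\mathbb R^n$ with $\boldsymbol x^i_i=x_i$ and, for $j\neq i$, $\boldsymbol x^i_j\in\mathbb R^{n_j}$ an estimate of $x_j$; $\boldsymbol x^i_{-i}=\mathrm{col}((\boldsymbol x^i_j)_{j\neq i})$; $\boldsymbol x=\mathrm{col}((\boldsymbol x^i)_i)\in\mathbb R^{Nn}$; $\boldsymbol k=\mathrm{col}((k_i)_i)\in\mathbb R^N$; $\boldsymbol z=\mathrm{col}((z_i)_i)$, $\boldsymbol\lambda=\mathrm{col}((\lambda_i)_i)\in\mathbb R^{Nm}$. $\mathcal R:=\mathrm{diag}((\mathcal R_i)_i)$ (block diagonal), where $\mathcal R_i\in\mathbb R^{n_i\times n}$ selects the $i$-th block, so $\mathcal R_i\boldsymbol x^i=x_i$ and $\mathcal R\boldsymbol x=x$. $\boldsymbol\Omega:=\{\boldsymbol x\in\mathbb R^{Nn}\mid\mathcal R\boldsymbol x\in\Omega\}$. $\boldsymbol F(\boldsymbol x):=\mathrm{col}((\nabla_{x_i}J_i(x_i,\boldsymbol x^i_{-i}))_i)$. $\boldsymbol g(x):=\mathrm{col}((g_i(x_i))_i)$, $\mathbb G(x):=\frac{\partial}{\partial x}\boldsymbol g(x)=\mathrm{diag}((\frac{\partial}{\partial x_i}g_i(x_i))_i)$. $\boldsymbol\rho=\mathrm{col}((\rho^i)_i)$ with $\rho^i\in\mathbb R^n$; $K:=\mathrm{diag}((k_iI_n)_i)$, $D(\boldsymbol\rho):=\mathrm{diag}((\rho^i)_i)\in\mathbb R^{Nn\times N}$ (block diagonal),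 $\Gamma:=\mathrm{diag}((\gamma_i)_i)$ (so $\dot k_i=\gamma_i\|\rho^i\|^2$). $\boldsymbol E_q:=\{\mathbf 1_N\otimes y\mid y\in\mathbb R^q\}$, $\boldsymbol E_q^\perp:=\{\boldsymbol y\in\mathbb R^{Nq}\mid(\mathbf 1_N^\top\otimes I_q)\boldsymbol y=\mathbf 0_q\}$. Convex analysis: for closed convex $S$, $\mathrm N_S(x)=\{v\mid\sup_{z\in S}v^\top(z-x)\le0\}$ is the normal cone, $\mathrm T_S(x)=\mathrm{cl}(\bigcup_{\delta>0}\frac1\delta(S-x))$ the tangent cone, and $\Pi_S(x,v):=\mathrm{proj}_{\mathrm T_S(x)}(v)$ (Euclidean projection). A Carathéodory solution is an absolutely continuous function with the given initial value satisfying the differential equation for almost all $t\ge0$. An equilibrium is a point where the right-hand side vanishes. *)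

theory Defs
  imports "HOL-Analysis.Analysis"
begin

(* Agents form a finite type 'a (so N = CARD('a)). The coordinates of R^n are indexed by a
   finite type 'n, and own c is the agent that controls the coordinate c; hence
   n_i = card {c. own c = i} may vary with i. The factor R^{n_i} is identified with the
   coordinate subspace  block_space own i  of real^'n.  A stacked vector in R^{Nq} is an
   element y of real^'q^'a, whose i-th block is y $ i; the inner product and norm of this
   type are the Euclidean ones of R^{Nq}. *)

section \<open>Smoothness, convex analysis, absolute continuity\<close>

definition C1 :: "('v::real_normed_vector \<Rightarrow> 'w::real_normed_vector) \<Rightarrow> bool" where
  "C1 f \<longleftrightarrow> (\<exists>f' :: 'v \<Rightarrow> ('v \<Rightarrow>\<^sub>L 'w).
     (\<forall>x. (f has_derivative blinfun_apply (f' x)) (at x)) \<and> continuous_on UNIV f')"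

definition C2 :: "('v::real_normed_vector \<Rightarrow> 'w::real_normed_vector) \<Rightarrow> bool" where
  "C2 f \<longleftrightarrow> (\<exists>f' :: 'v \<Rightarrow> ('v \<Rightarrow>\<^sub>L 'w).
     (\<forall>x. (f has_derivative blinfun_apply (f' x)) (at x)) \<and> C1 f')"

definition grad :: "('v::real_inner \<Rightarrow> real) \<Rightarrow> 'v \<Rightarrow> 'v" where
  "grad f x = (THE D. GDERIV f x :> D)"

(* As usual for the set-valued map defined on S, the normal cone is empty at points outside S. *)
definition normal_cone :: "'v::real_inner set \<Rightarrow> 'v \<Rightarrow> 'v set" where
  "normal_cone S x = {v. x \<in> S \<and> (\<forall>z\<in>S. v \<bullet> (z - x) \<le> 0)}"

definition tangent_cone :: "'v::real_normed_vector set \<Rightarrow> 'v \<Rightarrow> 'v set" where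
  "tangent_cone S x = closure (\<Union>\<delta>\<in>{0<..}. (\<lambda>z. (1 / \<delta>) *\<^sub>R (z - x)) ` S)"

definition proj_tangent :: "'v::euclidean_space set \<Rightarrow> 'v \<Rightarrow> 'v \<Rightarrow> 'v" where
  "proj_tangent S x v = closest_point (tangent_cone S x) v"

definition strongly_monotone :: "real \<Rightarrow> ('v::real_inner \<Rightarrow> 'v) \<Rightarrow> bool" where
  "strongly_monotone \<mu> F \<longleftrightarrow> (\<forall>x y. (F x - F y) \<bullet> (x - y) \<ge> \<mu> * (norm (x - y))\<^sup>2)"

(* D is a finite family of intervals, each given by its pair of end points. *)
definition abs_continuous_on :: "real \<Rightarrow> real \<Rightarrow> (real \<Rightarrow> 'v::real_normed_vector) \<Rightarrow> bool" where
  "abs_continuous_on a b w \<longleftrightarrow> (\<forall>\<epsilon>>0. \<exists>\<delta>>0. \<forall>D :: (real \<times> real) set.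
     finite D \<and> (\<forall>(s, t)\<in>D. a \<le> s \<and> s \<le> t \<and> t \<le> b) \<and>
     pairwise (\<lambda>p q. {fst p<..<snd p} \<inter> {fst q<..<snd q} = {}) D \<and>
     (\<Sum>(s, t)\<in>D. t - s) < \<delta>
     \<longrightarrow> (\<Sum>(s, t)\<in>D. norm (w t - w s)) < \<epsilon>)"

(* Absolute continuity on [0,\<infinity>) is understood on every compact subinterval. *)
definition caratheodory_solution ::
  "('v::real_normed_vector \<Rightarrow> 'v) \<Rightarrow> 'v \<Rightarrow> (real \<Rightarrow> 'v) \<Rightarrow> bool" where
  "caratheodory_solution f w0 w \<longleftrightarrow>
     w 0 = w0 \<and> (\<forall>T\<ge>0. abs_continuous_on 0 T w) \<and>
     (AE t in lebesgue. 0 \<le> t \<longrightarrow> (w has_vector_derivative f (w t)) (at t within {0..}))"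


section \<open>The game\<close>

definition block_space :: "('n \<Rightarrow> 'a) \<Rightarrow> 'a \<Rightarrow> (real^'n) set" where
  "block_space own i = {y. \<forall>c. own c \<noteq> i \<longrightarrow> y $ c = 0}"

(* The block x_i of x, as an element of block_space own i. *)
definition blk :: "('n \<Rightarrow> 'a) \<Rightarrow> 'a \<Rightarrow> real^'n \<Rightarrow> real^'n" where
  "blk own i x = (\<chi> c. if own c = i then x $ c else 0)"

(* The vector (y_i, x_{-i}). *)
definition repl :: "('n \<Rightarrow> 'a) \<Rightarrow> 'a \<Rightarrow> real^'n \<Rightarrow> real^'n \<Rightarrow> real^'n" where
  "repl own i y x = (\<chi> c. if own c = i then y $ c else x $ c)"

definition prod_set :: "('n \<Rightarrow> 'a) \<Rightarrow> ('a \<Rightarrow> (real^'n) set) \<Rightarrow> (real^'n) set" where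
  "prod_set own \<Omega> = {x. \<forall>i. blk own i x \<in> \<Omega> i}"

definition coupling ::
  "('n \<Rightarrow> 'a::finite) \<Rightarrow> ('a \<Rightarrow> real^'n \<Rightarrow> real^'m) \<Rightarrow> real^'n \<Rightarrow> real^'m" where
  "coupling own g x = (\<Sum>i\<in>UNIV. g i (blk own i x))"

definition feasible ::
  "('n \<Rightarrow> 'a::finite) \<Rightarrow> ('a \<Rightarrow> (real^'n) set) \<Rightarrow> ('a \<Rightarrow> real^'n \<Rightarrow> real^'m) \<Rightarrow> (real^'n) set" where
  "feasible own \<Omega> g = prod_set own \<Omega> \<inter> {x. coupling own g x \<le> 0}"

(* The strict order on vectors of the library is not the componentwise one. *)
definition slater ::
  "('n \<Rightarrow> 'a::finite) \<Rightarrow> ('a \<Rightarrow> (real^'n) set) \<Rightarrow> ('a \<Rightarrow> real^'n \<Rightarrow> real^'m) \<Rightarrow> bool" where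
  "slater own \<Omega> g \<longleftrightarrow> (\<exists>x\<in>prod_set own \<Omega>. \<forall>j. coupling own g x $ j < 0)"

(* The gradient of J_i with respect to x_i. The function differentiated depends only on the
   block y_i of y, so its gradient lies in block_space own i. *)
definition partial_grad ::
  "('n::finite \<Rightarrow> 'a) \<Rightarrow> ('a \<Rightarrow> real^'n \<Rightarrow> real) \<Rightarrow> 'a \<Rightarrow> real^'n \<Rightarrow> real^'n" where
  "partial_grad own J i x = grad (\<lambda>y. J i (repl own i y x)) x"

definition pseudo_gradient ::
  "('n::finite \<Rightarrow> 'a) \<Rightarrow> ('a \<Rightarrow> real^'n \<Rightarrow> real) \<Rightarrow> real^'n \<Rightarrow> real^'n" where
  "pseudo_gradient own J x = (\<chi> c. partial_grad own J (own c) x $ c)"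

definition gne ::
  "('n \<Rightarrow> 'a::finite) \<Rightarrow> ('a \<Rightarrow> (real^'n) set) \<Rightarrow> ('a \<Rightarrow> real^'n \<Rightarrow> real^'m) \<Rightarrow>
   ('a \<Rightarrow> real^'n \<Rightarrow> real) \<Rightarrow> real^'n \<Rightarrow> bool" where
  "gne own \<Omega> g J x \<longleftrightarrow>
     (\<forall>i. is_arg_min (\<lambda>y. J i (repl own i y x))
            (\<lambda>y. y \<in> block_space own i \<and> repl own i y x \<in> feasible own \<Omega> g)
            (blk own i x))"

(* The adjoint of the derivative of g is the transposed Jacobian. *)
definition kkt ::
  "('n::finite \<Rightarrow> 'a::finite) \<Rightarrow> ('a \<Rightarrow> (real^'n) set) \<Rightarrow> ('a \<Rightarrow> real^'n \<Rightarrow> real^'m::finite) \<Rightarrow>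
   ('a \<Rightarrow> real^'n \<Rightarrow> real) \<Rightarrow> real^'n \<Rightarrow> real^'m \<Rightarrow> bool" where
  "kkt own \<Omega> g J x l \<longleftrightarrow>
     0 \<in> (\<lambda>v. pseudo_gradient own J x
               + adjoint (frechet_derivative (coupling own g) (at x)) l + v)
          ` normal_cone (prod_set own \<Omega>) x \<and>
     0 \<in> (\<lambda>v. - coupling own g x + v) ` normal_cone {l. 0 \<le> l} l"

definition v_gne ::
  "('n::finite \<Rightarrow> 'a::finite) \<Rightarrow> ('a \<Rightarrow> (real^'n) set) \<Rightarrow> ('a \<Rightarrow> real^'n \<Rightarrow> real^'m::finite) \<Rightarrow>
   ('a \<Rightarrow> real^'n \<Rightarrow> real) \<Rightarrow> real^'n \<Rightarrow> bool" where
  "v_gne own \<Omega> g J x \<longleftrightarrow> gne own \<Omega> g J x \<and> (\<exists>l. kkt own \<Omega> g J x l)"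


section \<open>Graph and Kronecker products\<close>

definition adjacency :: "('a \<times> 'a) set \<Rightarrow> real^'a^'a" where
  "adjacency E = (\<chi> i j. if (i, j) \<in> E then 1 else 0)"

definition diag :: "real^'a \<Rightarrow> real^'a^'a" where
  "diag d = (\<chi> i j. if i = j then d $ i else 0)"

definition laplacian :: "('a \<times> 'a) set \<Rightarrow> real^'a^'a::finite" where
  "laplacian E = diag (\<chi> i. \<Sum>j\<in>UNIV. adjacency E $ i $ j) - adjacency E"

(* The action of the Kronecker product of A with the identity matrix I_q on a stacked vector.
   In particular kron_id (diag k) is multiplication by diag((k_i I_q)_i). *)
definition kron_id :: "real^'a^'a::finite \<Rightarrow> real^'q^'a \<Rightarrow> real^'q^'a" where
  "kron_id A y = (\<chi> i. \<Sum>j\<in>UNIV. A $ i $ j *\<^sub>R y $ j)"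

(* The Kronecker product of the all-ones vector with y. *)
definition kron_ones :: "real^'q \<Rightarrow> real^'q^'a" where
  "kron_ones y = (\<chi> i. y)"

(* The orthogonal complement E_q^\<bottom> of the consensus subspace: the kernel of (1_N^T \<otimes> I_q). *)
definition consensus_perp :: "(real^'q^'a::finite) set" where
  "consensus_perp = {y. (\<Sum>i\<in>UNIV. y $ i) = 0}"


section \<open>Stacked operators and the closed-loop dynamics\<close>

(* The linear map R: the coordinate c of R x is the one held by its owner. *)
definition select :: "('n \<Rightarrow> 'a) \<Rightarrow> real^'n^'a \<Rightarrow> real^'n" where
  "select own X = (\<chi> c. X $ own c $ c)"

definition ext_set :: "('n \<Rightarrow> 'a) \<Rightarrow> ('a \<Rightarrow> (real^'n) set) \<Rightarrow> (real^'n^'a) set" where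
  "ext_set own \<Omega> = {X. select own X \<in> prod_set own \<Omega>}"

(* (x_i, x^i_{-i}) is the whole estimate vector X $ i of agent i. *)
definition ext_pseudo_gradient ::
  "('n::finite \<Rightarrow> 'a) \<Rightarrow> ('a \<Rightarrow> real^'n \<Rightarrow> real) \<Rightarrow> real^'n^'a \<Rightarrow> real^'n" where
  "ext_pseudo_gradient own J X = (\<chi> c. partial_grad own J (own c) (X $ own c) $ c)"

definition stacked_g ::
  "('n \<Rightarrow> 'a) \<Rightarrow> ('a \<Rightarrow> real^'n \<Rightarrow> real^'m) \<Rightarrow> real^'n \<Rightarrow> real^'m^'a" where
  "stacked_g own g x = (\<chi> i. g i (blk own i x))"

(* The block-diagonal matrix D(\<rho>) as a linear map. *)
definition block_diag :: "real^'n^'a \<Rightarrow> real^'a \<Rightarrow> real^'n^'a" where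
  "block_diag \<rho> k = (\<chi> i. k $ i *\<^sub>R \<rho> $ i)"

type_synonym ('n, 'm, 'a) state =
  "(real^'n^'a) \<times> (real^'a) \<times> (real^'m^'a) \<times> (real^'m^'a)"

(* Transposed matrices are adjoints of the corresponding linear maps. *)
definition closed_loop ::
  "('n::finite \<Rightarrow> 'a::finite) \<Rightarrow> ('a \<Rightarrow> (real^'n) set) \<Rightarrow> ('a \<Rightarrow> real^'n \<Rightarrow> real^'m::finite) \<Rightarrow>
   ('a \<Rightarrow> real^'n \<Rightarrow> real) \<Rightarrow> ('a \<times> 'a) set \<Rightarrow> real^'a \<Rightarrow>
   ('n, 'm, 'a) state \<Rightarrow> ('n, 'm, 'a) state" where
  "closed_loop own \<Omega> g J E \<gamma> = (\<lambda>(X, k, Z, \<Lambda>).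
     let L = laplacian E; \<rho> = kron_id L X in
     (proj_tangent (ext_set own \<Omega>) X
        (- adjoint (select own)
             (ext_pseudo_gradient own J X
              + adjoint (frechet_derivative (stacked_g own g) (at (select own X))) \<Lambda>)
         - kron_id L (kron_id (diag k) \<rho>)),
      adjoint (block_diag \<rho>) (kron_id (diag \<gamma>) \<rho>),
      kron_id L \<Lambda>,
      proj_tangent {l. 0 \<le> l} \<Lambda> (stacked_g own g (select own X) - Z - kron_id L \<Lambda>)))"

definition state_set ::
  "('n \<Rightarrow> 'a::finite) \<Rightarrow> ('a \<Rightarrow> (real^'n) set) \<Rightarrow> ('n, 'm::finite, 'a) state set" where
  "state_set own \<Omega> = ext_set own \<Omega> \<times> UNIV \<times> consensus_perp \<times> {l. 0 \<le> l}"

end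

theory Submission
  imports Defs "HOL-Complex_Analysis.Great_Picard"
begin

text \<open>On the closed convex set \<open>state_set\<close> the closed loop is the projected dynamical system of a
  locally Lipschitz field. Such a system is solved by projected Euler steps: nonexpansiveness of the
  projection makes each step a near contraction, the limit of the Euler polygons satisfies an evolution
  variational inequality, and every limit of its difference quotients is a velocity of minimal norm,
  hence equal to the projected velocity outside a countable set of times.

  Strong monotonicity of the pseudo-gradient alone does not control the disagreement of the estimates,
  but the gains \<open>k\<close> only grow with the disagreement, so a distance to an equilibrium with a large
  fictitious gain is a Lyapunov function. Along a trajectory the dissipation vanishes asymptotically;
  a limit point is then itself an equilibrium, and the Lyapunov function centred there forces
  convergence of the whole trajectory.\<close>

section \<open>Tangent cones and projections\<close>

text \<open>The extended pseudo-gradient evaluates each partial gradient at its owner's own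
  estimate, so monotonicity of \<open>F\<close> does not pass to it; what survives is strong
  monotonicity up to \<kappa> times the squared norm of \<open>L X\<close>. In the Lyapunov
  derivative the contributions of \<open>x\<close> and \<open>k\<close> combine so that every actual
  gain is replaced by this \<kappa>; hence no initial gain has to be large. The projected field is
  discontinuous, so the velocity of a limit curve cannot be read off by continuity of the field; its
  characterisation by least norm takes that place. Nor is an invariance principle invoked: a limit
  point violating an equilibrium condition is refuted by following the trajectory for a finite time
  and contradicting boundedness or convergence. A Caratheodory solution is not assumed to stay in
  \<open>S\<close>. Its invariance is derived before uniqueness, from tangent cones taken at points
  that may lie outside the set. Integration along solutions is replaced by one fact: an absolutely
  continuous function with almost everywhere nonpositive derivative does not increase. Growth rates
  follow by subtracting a linear function of time.\<close>

lemma inner_self_le_0D: "x \<bullet> x \<le> 0 \<Longrightarrow> x = (0::'v::real_inner)"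
  by (metis inner_eq_zero_iff inner_ge_zero order_antisym)

lemma scaled_diff_mem_tangent_cone:
  assumes "z \<in> S" "0 < c"
  shows "c *\<^sub>R (z - x) \<in> tangent_cone S x"
proof -
  have "c *\<^sub>R (z - x) \<in> (\<Union>\<delta>\<in>{0<..}. (\<lambda>z. (1 / \<delta>) *\<^sub>R (z - x)) ` S)"
    using assms by (intro UN_I[of "1/c"]) auto
  then show ?thesis
    unfolding tangent_cone_def by (rule subsetD[OF closure_subset])
qed

lemma diff_mem_tangent_cone: "z \<in> S \<Longrightarrow> z - x \<in> tangent_cone S x"
  using scaled_diff_mem_tangent_cone[of z S 1 x] by simp

lemma closed_tangent_cone: "closed (tangent_cone S x)"
  by (simp add: tangent_cone_def)

lemma convex_tangent_cone:
  assumes "convex S"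
  shows "convex (tangent_cone S x)"
  unfolding tangent_cone_def
proof (rule convex_closure, rule convexI)
  fix p q :: 'a and u v :: real
  assume p: "p \<in> (\<Union>\<delta>\<in>{0<..}. (\<lambda>z. (1 / \<delta>) *\<^sub>R (z - x)) ` S)"
    and q: "q \<in> (\<Union>\<delta>\<in>{0<..}. (\<lambda>z. (1 / \<delta>) *\<^sub>R (z - x)) ` S)"
    and uv: "0 \<le> u" "0 \<le> v" "u + v = 1"
  obtain d y where d: "d > 0" "y \<in> S" "p = (1/d) *\<^sub>R (y - x)" using p by auto
  obtain e z where e: "e > 0" "z \<in> S" "q = (1/e) *\<^sub>R (z - x)" using q by auto
  \<comment> \<open>The total weight of \<open>y\<close> and \<open>z\<close>: dividing by it turns
    the combination into one scaled difference \<open>s *\<^sub>R (z' - x)\<close> with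
    \<open>z'\<close> in \<open>S\<close>.\<close>
  define s where "s = u / d + v / e"
  have s: "s > 0"
    unfolding s_def using uv d e
    by (cases "u = 0") (auto intro: add_pos_nonneg)
  define z' where "z' = (u / d / s) *\<^sub>R y + (v / e / s) *\<^sub>R z"
  have "z' \<in> S"
    unfolding z'_def
  proof (rule convexD[OF assms d(2) e(2)])
    show "u / d / s + v / e / s = 1"
      unfolding add_divide_distrib[symmetric] s_def[symmetric] using s by simp
  qed (use uv d e s in auto)
  moreover have "u *\<^sub>R p + v *\<^sub>R q = (1 / (1/s)) *\<^sub>R (z' - x)"
  proof -
    have "s *\<^sub>R (z' - x) = (u / d) *\<^sub>R y + (v / e) *\<^sub>R z - s *\<^sub>R x"
      using s by (simp add: z'_def algebra_simps)
    also have "\<dots> = u *\<^sub>R p + v *\<^sub>R q"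
      by (simp add: s_def d e algebra_simps)
    finally show ?thesis by simp
  qed
  ultimately show "u *\<^sub>R p + v *\<^sub>R q \<in> (\<Union>\<delta>\<in>{0<..}. (\<lambda>z. (1 / \<delta>) *\<^sub>R (z - x)) ` S)"
    using s by (intro UN_I[of "1/s"]) auto
qed

lemma tangent_cone_scaleR:
  assumes "v \<in> tangent_cone S x" "0 < c"
  shows "c *\<^sub>R v \<in> tangent_cone S x"
proof -
  let ?U = "\<Union>\<delta>\<in>{0<..}. (\<lambda>z. (1 / \<delta>) *\<^sub>R (z - x)) ` S"
  have "(*\<^sub>R) c ` ?U \<subseteq> ?U"
  proof clarify
    fix d :: real and z assume "d > 0" "z \<in> S"
    then show "c *\<^sub>R (1 / d) *\<^sub>R (z - x) \<in> ?U"
      using assms by (intro UN_I[of "d/c"]) auto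
  qed
  then have "(*\<^sub>R) c ` closure ?U \<subseteq> closure ?U"
    by (metis closure_mono closure_scaleR)
  then show ?thesis
    using assms unfolding tangent_cone_def by (meson imageI subsetD)
qed

lemma zero_mem_tangent_cone: "x \<in> S \<Longrightarrow> 0 \<in> tangent_cone S x"
  using diff_mem_tangent_cone[of x S x] by simp

text \<open>The half-space is closed and contains all scaled differences. The inequality is stated
  without \<open>normal_cone\<close>, which is empty off \<open>S\<close>, because invariance of
  \<open>S\<close> uses it at points that may lie outside.\<close>

lemma inner_tangent_cone_le:
  assumes "v \<in> tangent_cone S x" "\<And>z. z \<in> S \<Longrightarrow> n \<bullet> (z - x) \<le> 0"
  shows "n \<bullet> v \<le> 0"
proof -
  have "tangent_cone S x \<subseteq> {v. n \<bullet> v \<le> 0}"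
    unfolding tangent_cone_def
    by (rule closure_minimal)
      (use assms(2) in \<open>auto simp: inner_scaleR_right closed_halfspace_le intro!: divide_nonpos_pos\<close>)
  then show ?thesis using assms(1) by blast
qed

context
  fixes S :: "'v::euclidean_space set" and x :: 'v
  assumes S: "convex S" and x: "x \<in> S"
begin

lemma proj_tangent_mem: "proj_tangent S x f \<in> tangent_cone S x"
  unfolding proj_tangent_def
  by (rule closest_point_in_set[OF closed_tangent_cone]) (use x zero_mem_tangent_cone in blast)

lemma proj_tangent_inner_le:
  assumes "v \<in> tangent_cone S x"
  shows "(f - proj_tangent S x f) \<bullet> (v - proj_tangent S x f) \<le> 0"
  unfolding proj_tangent_def
  by (rule closest_point_dot[OF convex_tangent_cone[OF S] closed_tangent_cone assms])

text \<open>Both 0 and twice the projection lie in the cone; testing the projection inequality with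
  them gives opposite signs. This is the orthogonality in Moreau's decomposition.\<close>

lemma proj_tangent_orthogonal: "(f - proj_tangent S x f) \<bullet> proj_tangent S x f = 0"
  using proj_tangent_inner_le[OF zero_mem_tangent_cone[OF x], of f]
    proj_tangent_inner_le[OF tangent_cone_scaleR[OF proj_tangent_mem, of 2 f], of f]
  by (simp add: algebra_simps scaleR_2)

lemma proj_tangent_normal: "f - proj_tangent S x f \<in> normal_cone S x"
  unfolding normal_cone_def
  using proj_tangent_inner_le[OF diff_mem_tangent_cone, of _ f] proj_tangent_orthogonal[of f] x
  by (auto simp: inner_diff_right)

text \<open>Polarity of the two cones. For the converse, the residual
  \<open>v - proj_tangent S x v\<close> is itself normal and its product with \<open>v\<close> is
  its own squared norm, so it vanishes.\<close>

lemma tangent_cone_iff: "v \<in> tangent_cone S x \<longleftrightarrow> (\<forall>n\<in>normal_cone S x. n \<bullet> v \<le> 0)"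
proof
  assume "v \<in> tangent_cone S x"
  then show "\<forall>n\<in>normal_cone S x. n \<bullet> v \<le> 0"
    using inner_tangent_cone_le[of v S x] by (auto simp: normal_cone_def)
next
  assume *: "\<forall>n\<in>normal_cone S x. n \<bullet> v \<le> 0"
  have "(v - proj_tangent S x v) \<bullet> (v - proj_tangent S x v) \<le> 0"
    using * proj_tangent_normal[of v] proj_tangent_orthogonal[of v]
    by (simp add: inner_diff_right)
  then have "v - proj_tangent S x v = 0"
    by (rule inner_self_le_0D)
  then show "v \<in> tangent_cone S x"
    using proj_tangent_mem[of v] by simp
qed

text \<open>The projected velocity is the only element of least norm in \<open>f\<close> minus the
  normal cone. A limit of difference quotients can be identified this way without first placing it
  in the tangent cone.\<close>

lemma proj_tangent_least_norm:
  assumes "f - q \<in> normal_cone S x" "norm q \<le> norm (proj_tangent S x f)"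
  shows "q = proj_tangent S x f"
proof -
  let ?v = "proj_tangent S x f"
  have "(f - q) \<bullet> ?v \<le> 0"
    using assms(1) proj_tangent_mem[of f] by (simp add: tangent_cone_iff)
  then have "?v \<bullet> ?v \<le> q \<bullet> ?v"
    using proj_tangent_orthogonal[of f] by (simp add: inner_diff_left)
  moreover have "q \<bullet> q \<le> ?v \<bullet> ?v"
    using assms(2) by (simp add: norm_le)
  ultimately have "(q - ?v) \<bullet> (q - ?v) \<le> 0"
    by (simp add: algebra_simps inner_commute)
  then have "q - ?v = 0"
    by (rule inner_self_le_0D)
  then show ?thesis by simp
qed

lemma norm_proj_tangent_least:
  assumes "f - q \<in> normal_cone S x"
  shows "norm (proj_tangent S x f) \<le> norm q"
proof -
  let ?v = "proj_tangent S x f"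
  have "(f - q) \<bullet> ?v \<le> 0"
    using assms proj_tangent_mem[of f] by (simp add: tangent_cone_iff)
  then have "norm ?v * norm ?v \<le> q \<bullet> ?v"
    using proj_tangent_orthogonal[of f] dot_square_norm[of ?v]
    by (simp add: inner_diff_left power2_eq_square)
  also have "\<dots> \<le> norm q * norm ?v"
    by (rule norm_cauchy_schwarz)
  finally show ?thesis
    by (cases "?v = 0") auto
qed

text \<open>The hypotheses are a Moreau decomposition of \<open>f\<close>; its uniqueness reduces to
  that of the element of least norm.\<close>

lemma proj_tangent_eqI:
  assumes "v \<in> tangent_cone S x" "f - v \<in> normal_cone S x" "(f - v) \<bullet> v = 0"
  shows "proj_tangent S x f = v"
proof -
  have "norm v \<le> norm (proj_tangent S x f)"
  proof -
  let ?v = "proj_tangent S x f"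
  have "(f - ?v) \<bullet> v \<le> 0"
    using proj_tangent_normal[of f] assms(1) by (simp add: tangent_cone_iff)
  then have "v \<bullet> v \<le> ?v \<bullet> v"
    using assms(3) by (simp add: inner_diff_left)
  also have "\<dots> \<le> norm ?v * norm v"
    by (rule norm_cauchy_schwarz)
  finally have "norm v * norm v \<le> norm ?v * norm v"
    by (simp only: dot_square_norm power2_eq_square)
  then show ?thesis
    by (cases "v = 0") auto
  qed
  from proj_tangent_least_norm[OF assms(2) this] show ?thesis ..
qed

lemma proj_tangent_eq_0_iff: "proj_tangent S x f = 0 \<longleftrightarrow> f \<in> normal_cone S x"
proof
  show "proj_tangent S x f = 0 \<Longrightarrow> f \<in> normal_cone S x"
    using proj_tangent_normal[of f] by simp
  show "f \<in> normal_cone S x \<Longrightarrow> proj_tangent S x f = 0"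
    by (rule proj_tangent_eqI) (simp_all add: zero_mem_tangent_cone[OF x])
qed

end

lemma normal_cone_Times:
  "normal_cone (S \<times> T) (x, y) = normal_cone S x \<times> normal_cone T y"
proof (rule set_eqI)
  fix n :: "'a \<times> 'b"
  show "n \<in> normal_cone (S \<times> T) (x, y) \<longleftrightarrow> n \<in> normal_cone S x \<times> normal_cone T y"
    (is "?l \<longleftrightarrow> ?r")
  proof
    assume ?l
    then have x: "x \<in> S" and y: "y \<in> T"
      and n: "\<And>a b. a \<in> S \<Longrightarrow> b \<in> T \<Longrightarrow> fst n \<bullet> (a - x) + snd n \<bullet> (b - y) \<le> 0"
      by (auto simp: normal_cone_def inner_prod_def)
    have "fst n \<bullet> (a - x) \<le> 0" if "a \<in> S" for a
      using n[OF that y] by simp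
    moreover have "snd n \<bullet> (b - y) \<le> 0" if "b \<in> T" for b
      using n[OF x that] by simp
    ultimately show ?r
      using x y by (simp add: normal_cone_def mem_Times_iff)
  next
    assume r: ?r
    then have "fst n \<bullet> (a - x) + snd n \<bullet> (b - y) \<le> 0" if "a \<in> S" "b \<in> T" for a b
      using that by (intro add_nonpos_nonpos) (auto simp: normal_cone_def)
    then show ?l
      using r by (auto simp: normal_cone_def inner_prod_def)
  qed
qed

text \<open>Lets the separate projections in the closed loop be read as one projection onto the
  product \<open>state_set\<close>.\<close>

lemma proj_tangent_Times:
  fixes S :: "'v::euclidean_space set" and T :: "'w::euclidean_space set"
  assumes "convex S" "convex T" "x \<in> S" "y \<in> T"
  shows "proj_tangent (S \<times> T) (x, y) (f, h) = (proj_tangent S x f, proj_tangent T y h)"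
proof (rule proj_tangent_eqI)
  note [simp] = assms convex_Times
  show "convex (S \<times> T)" "(x, y) \<in> S \<times> T" by simp_all
  have "n \<bullet> proj_tangent S x f + m \<bullet> proj_tangent T y h \<le> 0"
    if "n \<in> normal_cone S x" "m \<in> normal_cone T y" for n m
    using proj_tangent_mem[of S x f] proj_tangent_mem[of T y h] that
    by (intro add_nonpos_nonpos) (simp_all add: tangent_cone_iff)
  then show "(proj_tangent S x f, proj_tangent T y h) \<in> tangent_cone (S \<times> T) (x, y)"
    by (auto simp: tangent_cone_iff normal_cone_Times)
qed (simp_all add: assms normal_cone_Times proj_tangent_normal proj_tangent_orthogonal)

lemma proj_tangent_UNIV: "proj_tangent UNIV x f = f"
proof (rule proj_tangent_eqI)
  show "f \<in> tangent_cone UNIV x"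
    using diff_mem_tangent_cone[of "f + x" UNIV x] by simp
qed (auto simp: normal_cone_def)

section \<open>Absolutely continuous functions\<close>

definition interval_family :: "real \<Rightarrow> real \<Rightarrow> (real \<times> real) set \<Rightarrow> bool" where
  "interval_family a b D \<longleftrightarrow> finite D \<and> (\<forall>(s, t)\<in>D. a \<le> s \<and> s \<le> t \<and> t \<le> b) \<and>
     pairwise (\<lambda>p q. {fst p<..<snd p} \<inter> {fst q<..<snd q} = {}) D"

lemma interval_family_mono: "interval_family a' b' D \<Longrightarrow> a \<le> a' \<Longrightarrow> b' \<le> b \<Longrightarrow> interval_family a b D"
  unfolding interval_family_def by force

lemma abs_continuous_on_iff:
  "abs_continuous_on a b w \<longleftrightarrow> (\<forall>\<epsilon>>0. \<exists>\<delta>>0. \<forall>D. interval_family a b D \<and>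
     (\<Sum>(s, t)\<in>D. t - s) < \<delta> \<longrightarrow> (\<Sum>(s, t)\<in>D. norm (w t - w s)) < \<epsilon>)"
  by (simp only: abs_continuous_on_def interval_family_def conj_assoc)

lemma abs_continuous_onE:
  assumes "abs_continuous_on a b w" "\<epsilon> > 0"
  obtains \<delta> where "\<delta> > 0" "\<And>D. interval_family a b D \<Longrightarrow>
     (\<Sum>(s, t)\<in>D. t - s) < \<delta> \<Longrightarrow> (\<Sum>(s, t)\<in>D. norm (w t - w s)) < \<epsilon>"
  using assms unfolding abs_continuous_on_iff by meson

lemma abs_continuous_on_mono:
  assumes "abs_continuous_on a b w" "a \<le> a'" "b' \<le> b"
  shows "abs_continuous_on a' b' w"
  using assms unfolding abs_continuous_on_iff by (meson interval_family_mono)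

text \<open>The two terms of the bound serve two uses: with constant \<open>w\<close> it covers
  functions Lipschitz in time, and with the increment of \<open>w\<close> it covers locally
  Lipschitz functions of an absolutely continuous curve.\<close>

lemma abs_continuous_on_dominated:
  assumes w: "abs_continuous_on a b w" and K: "K \<ge> 0"
    and le: "\<And>s t. a \<le> s \<Longrightarrow> s \<le> t \<Longrightarrow> t \<le> b \<Longrightarrow> norm (u t - u s) \<le> K * (norm (w t - w s) + (t - s))"
  shows "abs_continuous_on a b u"
  unfolding abs_continuous_on_iff
proof (intro allI impI)
  fix \<epsilon> :: real assume "\<epsilon> > 0"
  \<comment> \<open>The 2 shares \<epsilon> between the two sums; \<open>K + 1\<close> keeps the
    denominator positive for \<open>K = 0\<close> and makes the final estimate strict.\<close>
  define e where "e = \<epsilon> / (2 * (K + 1))"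
  have e: "e > 0" using K \<open>\<epsilon> > 0\<close> by (simp add: e_def)
  have e2: "2 * (K + 1) * e = \<epsilon>"
    unfolding e_def using K by simp
  obtain \<delta> where "\<delta> > 0" and \<delta>: "\<And>D. interval_family a b D \<Longrightarrow>
     (\<Sum>(s, t)\<in>D. t - s) < \<delta> \<Longrightarrow> (\<Sum>(s, t)\<in>D. norm (w t - w s)) < e"
    using abs_continuous_onE[OF w e] by blast
  show "\<exists>\<delta>>0. \<forall>D. interval_family a b D \<and>
     (\<Sum>(s, t)\<in>D. t - s) < \<delta> \<longrightarrow> (\<Sum>(s, t)\<in>D. norm (u t - u s)) < \<epsilon>"
  proof (intro exI[of _ "min \<delta> e"] conjI allI impI)
    fix D :: "(real \<times> real) set"
    assume D: "interval_family a b D \<and> (\<Sum>(s, t)\<in>D. t - s) < min \<delta> e"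
    have "(\<Sum>(s, t)\<in>D. norm (u t - u s)) \<le> (\<Sum>(s, t)\<in>D. K * (norm (w t - w s) + (t - s)))"
      using D le by (intro sum_mono) (auto simp: interval_family_def)
    also have "\<dots> = K * ((\<Sum>(s, t)\<in>D. norm (w t - w s)) + (\<Sum>(s, t)\<in>D. t - s))"
      by (simp add: case_prod_unfold sum_distrib_left flip: sum.distrib)
    also have "\<dots> \<le> K * (e + e)"
      using D \<delta>[of D] K by (intro mult_left_mono) auto
    also have "\<dots> < (K + 1) * (e + e)"
      using e by (intro mult_strict_right_mono) auto
    also have "\<dots> = \<epsilon>"
      using e2 by (simp add: algebra_simps)
    finally show "(\<Sum>(s, t)\<in>D. norm (u t - u s)) < \<epsilon>" .
  qed (use \<open>\<delta> > 0\<close> e in auto)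
qed

lemma abs_continuous_on_const: "abs_continuous_on a b (\<lambda>t. c)"
  unfolding abs_continuous_on_def by (auto intro: exI[of _ 1])

lemma abs_continuous_on_lipschitz:
  assumes "K \<ge> 0" "\<And>s t. a \<le> s \<Longrightarrow> s \<le> t \<Longrightarrow> t \<le> b \<Longrightarrow> norm (u t - u s) \<le> K * (t - s)"
  shows "abs_continuous_on a b u"
  by (rule abs_continuous_on_dominated[OF abs_continuous_on_const[of a b "0::real"] assms(1)])
    (use assms in simp)

lemma abs_continuous_on_imp_continuous_on:
  fixes w :: "real \<Rightarrow> 'v::real_normed_vector"
  assumes "abs_continuous_on a b w"
  shows "continuous_on {a..b} w"
  unfolding continuous_on_iff
proof (intro ballI allI impI)
  fix x \<epsilon> :: real assume x: "x \<in> {a..b}" and "\<epsilon> > 0"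
  obtain \<delta> where "\<delta> > 0" and \<delta>: "\<And>D. interval_family a b D \<Longrightarrow>
     (\<Sum>(s, t)\<in>D. t - s) < \<delta> \<Longrightarrow> (\<Sum>(s, t)\<in>D. norm (w t - w s)) < \<epsilon>"
    using abs_continuous_onE[OF assms \<open>\<epsilon> > 0\<close>] by blast
  have "dist (w y) (w x) < \<epsilon>" if "y \<in> {a..b}" "dist y x < \<delta>" for y
    using \<delta>[of "{(min x y, max x y)}"] that x
    by (cases "x \<le> y") (auto simp: interval_family_def dist_norm dist_real_def norm_minus_commute min_def max_def)
  then show "\<exists>d>0. \<forall>y\<in>{a..b}. dist y x < d \<longrightarrow> dist (w y) (w x) < \<epsilon>"
    using \<open>\<delta> > 0\<close> by blast
qed

text \<open>The straddle inequality: increments to the left and to the right of the tag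
  \<open>t\<close> are estimated separately and added, as in a tagged interval with the tag
  inside.\<close>

lemma has_real_derivative_straddle:
  fixes u :: "real \<Rightarrow> real"
  assumes "(u has_real_derivative d) (at t within {a..b})" "d \<le> 0" "e > 0"
  obtains r where "r > 0"
    "\<And>p q. p \<in> {a..b} \<Longrightarrow> q \<in> {a..b} \<Longrightarrow> p \<le> t \<Longrightarrow> t \<le> q \<Longrightarrow> t - p < r \<Longrightarrow> q - t < r \<Longrightarrow> u q - u p \<le> e * (q - p)"
proof -
  obtain r where "r > 0" and r: "\<And>y. y \<in> {a..b} \<Longrightarrow> norm (y - t) < r \<Longrightarrow>
      norm (u y - u t - d * (y - t)) \<le> e * norm (y - t)"
    using assms unfolding has_field_derivative_def has_derivative_within_alt by meson
  show thesis
  proof (rule that[OF \<open>r > 0\<close>])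
    fix p q assume pq: "p \<in> {a..b}" "q \<in> {a..b}" "p \<le> t" "t \<le> q" "t - p < r" "q - t < r"
    have "u q - u t \<le> d * (q - t) + e * (q - t)"
      using r[of q] pq by (simp add: abs_le_iff)
    moreover have "u t - u p \<le> d * (t - p) + e * (t - p)"
      using r[of p] pq by (simp add: abs_le_iff algebra_simps)
    moreover have "d * (q - t) \<le> 0" "d * (t - p) \<le> 0"
      using pq assms(2) by (simp_all add: mult_nonpos_nonneg)
    ultimately show "u q - u p \<le> e * (q - p)"
      by (simp add: algebra_simps)
  qed
qed

text \<open>A gauge fine on the exceptional null set forces the intervals tagged there into an open set of
  small measure, where absolute continuity controls the increments; all other intervals of a fine
  division have increments bounded through the straddle inequality.\<close>

lemma abs_continuous_on_nonincreasing:
  fixes u :: "real \<Rightarrow> real"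
  assumes ac: "abs_continuous_on a b u" and "a \<le> b" and N: "negligible N"
    and der: "\<And>t. t \<in> {a..b} - N \<Longrightarrow> \<exists>d\<le>0. (u has_real_derivative d) (at t within {a..b})"
  shows "u b \<le> u a"
proof (rule field_le_epsilon)
  fix \<epsilon> :: real assume "\<epsilon> > 0"
  \<comment> \<open>The budget is \<open>e * (b - a)\<close> for the regular tags plus
    \<open>e\<close> for the tags in \<open>N\<close>.\<close>
  define e where "e = \<epsilon> / (b - a + 1)"
  have e: "e > 0" using \<open>\<epsilon> > 0\<close> \<open>a \<le> b\<close> by (simp add: e_def)
  obtain \<delta> where "\<delta> > 0" and \<delta>: "\<And>D. interval_family a b D \<Longrightarrow>
     (\<Sum>(s, t)\<in>D. t - s) < \<delta> \<Longrightarrow> (\<Sum>(s, t)\<in>D. norm (u t - u s)) < e"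
    using abs_continuous_onE[OF ac e] by blast
  have Nn: "N \<in> null_sets lebesgue" using N by (simp add: negligible_iff_null_sets)
  then obtain U where U: "open U" "N \<subseteq> U" "U - N \<in> lmeasurable" "emeasure lebesgue (U - N) < ennreal \<delta>"
    using sets_lebesgue_outer_open[of N \<delta>] \<open>\<delta> > 0\<close> by auto
  have Ul: "U = (U - N) \<union> N" using U(2) by blast
  have Um: "U \<in> lmeasurable"
    using U(3) N Ul by (metis fmeasurable.Un negligible_imp_measurable)
  have "measure lebesgue U = measure lebesgue (U - N)"
    using Ul measure_Un_null_set[OF _ Nn, of "U - N"] U(3) by (metis fmeasurableD)
  also have "\<dots> < \<delta>"
    using U(3,4) \<open>\<delta> > 0\<close> by (simp add: emeasure_eq_measure2 ennreal_less_iff)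
  finally have mU: "measure lebesgue U < \<delta>" .
  have "\<exists>r>0. if t \<in> N then ball t r \<subseteq> U else t \<in> {a..b} \<longrightarrow> (\<forall>p\<in>{a..b}. \<forall>q\<in>{a..b}. p \<le> t \<longrightarrow>
      t \<le> q \<longrightarrow> t - p < r \<longrightarrow> q - t < r \<longrightarrow> u q - u p \<le> e * (q - p))" for t
  proof (cases "t \<in> N")
    case True
    then show ?thesis using U(1,2) open_contains_ball by auto
  next
    case False
    show ?thesis
    proof (cases "t \<in> {a..b}")
      case True
      then obtain d where "d \<le> 0" "(u has_real_derivative d) (at t within {a..b})"
        using der[of t] False by blast
      then show ?thesis
        using has_real_derivative_straddle[of u d t a b e] e False by (smt (verit, best))
    qed (use False in \<open>auto intro: exI[of _ 1]\<close>)
  qed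
  then obtain r where r: "\<And>t. r t > 0" "\<And>t. t \<in> N \<Longrightarrow> ball t (r t) \<subseteq> U"
    "\<And>t p q. t \<notin> N \<Longrightarrow> t \<in> {a..b} \<Longrightarrow> p \<in> {a..b} \<Longrightarrow> q \<in> {a..b} \<Longrightarrow> p \<le> t \<Longrightarrow> t \<le> q \<Longrightarrow> t - p < r t
      \<Longrightarrow> q - t < r t \<Longrightarrow> u q - u p \<le> e * (q - p)"
    by metis
  have "gauge (\<lambda>t. ball t (r t))"
    using r(1) by (simp add: gauge_def)
  then obtain p where p: "p tagged_division_of {a..b}" "(\<lambda>t. ball t (r t)) fine p"
    using fine_division_exists_real by blast
  have fin: "finite p" using p(1) by (rule tagged_division_of_finite)
  have mem: "\<exists>c d. K = {c..d} \<and> c \<le> d \<and> c \<in> {a..b} \<and> d \<in> {a..b} \<and> x \<in> {c..d} \<and> {c..d} \<subseteq> ball x (r x)"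
    if xK: "(x, K) \<in> p" for x K
  proof -
    obtain c d where "K = cbox c d" using tagged_division_ofD(4)[OF p(1) xK] by blast
    then have "K = {c..d}" by simp
    moreover have "x \<in> K" "K \<subseteq> {a..b}" using tagged_division_ofD(2,3)[OF p(1) xK] .
    moreover have "K \<subseteq> ball x (r x)" using p(2) xK by (auto simp: fine_def)
    ultimately show ?thesis by auto
  qed
  \<comment> \<open>Degenerate intervals contribute nothing to the increments and are left out, so
    that members of \<open>B\<close> have nonempty interior and are determined by their end
    points.\<close>
  define B where "B = {(x, K) \<in> p. x \<in> N \<and> Inf K < Sup K}"
  define f where "f = (\<lambda>(x::real, K::real set). u (Sup K) - u (Inf K))"
  define l where "l = (\<lambda>(x::real, K::real set). Sup K - Inf K)"
  have Bp: "B \<subseteq> p" by (auto simp: B_def)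
  have "(\<Sum>P\<in>p - B. f P) \<le> (\<Sum>P\<in>p - B. e * l P)"
  proof (rule sum_mono)
    fix P assume P: "P \<in> p - B"
    obtain x K where xK: "P = (x, K)" by force
    obtain c d where cd: "K = {c..d}" "c \<le> d" "c \<in> {a..b}" "d \<in> {a..b}" "x \<in> {c..d}" "{c..d} \<subseteq> ball x (r x)"
      using mem P xK by blast
    show "f P \<le> e * l P"
    proof (cases "x \<in> N")
      case True
      then show ?thesis using P cd by (auto simp: xK B_def f_def l_def)
    next
      case False
      have "c \<in> ball x (r x)" "d \<in> ball x (r x)"
        by (rule subsetD[OF cd(6)], use cd(2) in simp)+
      then show ?thesis
        using r(3)[of x c d] False cd by (auto simp: xK f_def l_def dist_real_def)
    qed
  qed
  also have "\<dots> = e * (\<Sum>P\<in>p - B. l P)"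
    by (simp add: sum_distrib_left)
  also have "\<dots> \<le> e * (\<Sum>P\<in>p. l P)"
    using e fin mem by (intro mult_left_mono sum_mono2) (fastforce simp: l_def)+
  also have "(\<Sum>P\<in>p. l P) = b - a"
    using additive_tagged_division_1[OF \<open>a \<le> b\<close> p(1), of "\<lambda>x. x"] by (simp add: l_def)
  finally have good: "(\<Sum>P\<in>p - B. f P) \<le> e * (b - a)" .

  define h where "h = (\<lambda>(x::real, K::real set). (Inf K, Sup K))"
  have B: "B tagged_partial_division_of {a..b}"
    using tagged_partial_division_subset[OF _ Bp] p(1) by (simp add: tagged_division_of_def)
  have disj: "interior K1 \<inter> interior K2 = {}" if "(x1, K1) \<in> B" "(x2, K2) \<in> B" "(x1, K1) \<noteq> (x2, K2)" for x1 K1 x2 K2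
    using tagged_partial_division_ofD(5)[OF B that] .
  have memB: "\<exists>c d. K = {c..d} \<and> c < d \<and> c \<in> {a..b} \<and> d \<in> {a..b} \<and> {c..d} \<subseteq> U" if "(x, K) \<in> B" for x K
  proof -
    have "(x, K) \<in> p" "x \<in> N" "Inf K < Sup K" using that by (auto simp: B_def)
    then show ?thesis using mem[of x K] r(2)[of x] by (auto 4 4)
  qed
  have inj: "inj_on h B"
  proof (rule inj_onI, clarify)
    fix x1 K1 x2 K2 assume *: "(x1, K1) \<in> B" "(x2, K2) \<in> B" "h (x1, K1) = h (x2, K2)"
    obtain c d where "K1 = {c..d}" "c < d" using memB *(1) by blast
    moreover obtain c' d' where "K2 = {c'..d'}" "c' < d'" using memB *(2) by blast
    ultimately have "K1 = K2" "interior K1 \<inter> interior K2 \<noteq> {}"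
      using *(3) by (auto simp: h_def)
    then show "x1 = x2 \<and> K1 = K2" using disj *(1,2) by blast
  qed
  have "(\<Sum>(s, t)\<in>h ` B. norm (u t - u s)) < e"
  proof (rule \<delta>)
    show "interval_family a b (h ` B)"
      unfolding interval_family_def
    proof (intro conjI)
      show "finite (h ` B)" using fin Bp finite_subset by blast
      show "\<forall>(s, t)\<in>h ` B. a \<le> s \<and> s \<le> t \<and> t \<le> b"
        using memB by (fastforce simp: h_def)
      show "pairwise (\<lambda>p q. {fst p<..<snd p} \<inter> {fst q<..<snd q} = {}) (h ` B)"
      proof (rule pairwiseI)
        fix P Q assume PQ: "P \<in> h ` B" "Q \<in> h ` B" "P \<noteq> Q"
        obtain x1 K1 x2 K2 where *: "(x1, K1) \<in> B" "(x2, K2) \<in> B" "P = h (x1, K1)" "Q = h (x2, K2)"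
          using PQ(1,2) by auto
        obtain c d where 1: "K1 = {c..d}" "c < d" using memB *(1) by blast
        obtain c' d' where 2: "K2 = {c'..d'}" "c' < d'" using memB *(2) by blast
        have "interior K1 \<inter> interior K2 = {}" using disj[OF *(1,2)] *(3,4) PQ(3) by auto
        then show "{fst P<..<snd P} \<inter> {fst Q<..<snd Q} = {}"
          using 1 2 by (simp add: h_def *(3,4))
      qed
    qed
    have div: "snd ` B division_of \<Union>(snd ` B)"
      by (rule division_of_tagged_division[OF tagged_partial_division_of_Union_self[OF B]])
    have "(\<Sum>(s, t)\<in>h ` B. t - s) = (\<Sum>P\<in>B. measure lebesgue (snd P))"
      unfolding sum.reindex[OF inj] comp_def
      by (rule sum.cong) (use memB in \<open>fastforce simp: h_def\<close>)+
    also have "\<dots> = (\<Sum>K\<in>snd ` B. measure lebesgue K)"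
    proof -
      have "inj_on snd B"
        using inj by (auto simp: inj_on_def h_def split_beta)
      then show ?thesis by (simp add: sum.reindex)
    qed
    also have "\<dots> = measure lebesgue (\<Union>(snd ` B))"
      by (rule content_division[OF div])
    also have "\<dots> \<le> measure lebesgue U"
    proof (rule measure_mono_fmeasurable[OF _ _ Um])
      show "\<Union>(snd ` B) \<subseteq> U" using memB by fastforce
      show "\<Union>(snd ` B) \<in> sets lebesgue"
        using lmeasurable_division[OF div] by blast
    qed
    finally show "(\<Sum>(s, t)\<in>h ` B. t - s) < \<delta>" using mU by linarith
  qed
  moreover have "(\<Sum>P\<in>B. f P) \<le> (\<Sum>(s, t)\<in>h ` B. norm (u t - u s))"
    unfolding sum.reindex[OF inj] comp_def by (rule sum_mono) (auto simp: f_def h_def)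
  ultimately have bad: "(\<Sum>P\<in>B. f P) \<le> e" by linarith
  have "u b - u a = (\<Sum>P\<in>p. f P)"
    using additive_tagged_division_1[OF \<open>a \<le> b\<close> p(1), of u] by (simp add: f_def)
  also have "\<dots> = (\<Sum>P\<in>p - B. f P) + (\<Sum>P\<in>B. f P)"
    using fin Bp by (rule sum.subset_diff[rotated])
  also have "\<dots> \<le> e * (b - a) + e"
    using good bad by linarith
  also have "\<dots> = e * (b - a + 1)"
    by (simp add: algebra_simps)
  also have "\<dots> = \<epsilon>"
    using \<open>a \<le> b\<close> by (simp add: e_def)
  finally show "u b \<le> u a + \<epsilon>" by linarith
qed

section \<open>Existence for projected dynamics with a bounded Lipschitz field\<close>

text \<open>By compactness, a bounded function with a single possible sequential limit converges to
  it. Differentiability thus reduces to identifying the limits of difference quotients.\<close>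

lemma tendsto_at_within_limit_points:
  fixes g :: "'x::first_countable_topology \<Rightarrow> 'v::{real_normed_vector,heine_borel}"
  assumes bdd: "\<And>y. y \<in> A \<Longrightarrow> y \<noteq> x \<Longrightarrow> norm (g y) \<le> M"
    and lim: "\<And>X q. (\<And>n. X n \<in> A) \<Longrightarrow> (\<And>n. X n \<noteq> x) \<Longrightarrow> X \<longlonglongrightarrow> x \<Longrightarrow> (\<lambda>n. g (X n)) \<longlonglongrightarrow> q \<Longrightarrow> q = v"
  shows "(g \<longlongrightarrow> v) (at x within A)"
  unfolding tendsto_at_iff_sequentially
proof (intro allI impI)
  fix X assume X: "\<forall>i. X i \<in> A - {x}" "X \<longlonglongrightarrow> x"
  show "(g \<circ> X) \<longlonglongrightarrow> v"
  proof (rule ccontr)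
    assume "\<not> (g \<circ> X) \<longlonglongrightarrow> v"
    then obtain e where e: "e > 0" "\<not> (\<forall>\<^sub>F n in sequentially. dist ((g \<circ> X) n) v < e)"
      unfolding tendsto_iff by blast
    obtain r where r: "strict_mono (r::nat\<Rightarrow>nat)" "\<And>n. \<not> dist ((g \<circ> X) (r n)) v < e"
      using not_eventually_sequentiallyD[OF e(2)] by blast
    have "bounded (range (\<lambda>n. g (X (r n))))"
      using X bdd by (auto simp: bounded_iff)
    then obtain l s where s: "strict_mono (s::nat\<Rightarrow>nat)" "((\<lambda>n. g (X (r n))) \<circ> s) \<longlonglongrightarrow> l"
      using bounded_imp_convergent_subsequence by blast
    have "(X \<circ> (r \<circ> s)) \<longlonglongrightarrow> x"
      using X(2) r(1) s(1) by (intro LIMSEQ_subseq_LIMSEQ strict_mono_o)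
    then have "l = v"
      using X(1) s(2) by (intro lim[of "X \<circ> (r \<circ> s)"]) (auto simp: o_def)
    then have "\<forall>\<^sub>F n in sequentially. dist (g (X (r (s n)))) v < e"
      using s(2) e(1) by (auto simp: tendsto_iff o_def)
    then show False
      using r(2) by (auto simp: eventually_sequentially)
  qed
qed

lemma LIMSEQ_mono:
  fixes x y :: real
  assumes "X \<longlonglongrightarrow> x" "Y \<longlonglongrightarrow> y" "\<And>n. X n \<le> Y n"
  shows "x \<le> y"
  using assms by (blast intro: LIMSEQ_le)

lemma norm_quotient_le: "c \<noteq> 0 \<Longrightarrow> norm x \<le> \<bar>c\<bar> * M \<Longrightarrow> norm (x /\<^sub>R c) \<le> M"
  by (simp add: field_simps)

lemma inner_quotient_le: "0 < c \<Longrightarrow> x \<bullet> y \<le> c * M \<Longrightarrow> (x /\<^sub>R c) \<bullet> y \<le> M"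
  by (simp add: field_simps)

section \<open>Projected Euler polygons and their estimates\<close>

primrec proj_euler :: "'v::euclidean_space set \<Rightarrow> ('v \<Rightarrow> 'v) \<Rightarrow> 'v \<Rightarrow> real \<Rightarrow> nat \<Rightarrow> 'v" where
  "proj_euler C f x h 0 = x"
| "proj_euler C f x h (Suc k) = closest_point C (proj_euler C f x h k + h *\<^sub>R f (proj_euler C f x h k))"

text \<open>Boundedness and the global Lipschitz constant will come from composing the closed-loop
  field with the projection onto a ball.\<close>

locale projected_field =
  fixes C :: "'v::euclidean_space set" and f :: "'v \<Rightarrow> 'v" and \<omega> B :: real and x0 :: 'v
  assumes closed: "closed C" and convex: "convex C" and x0: "x0 \<in> C"
    and \<omega>: "\<omega> \<ge> 0"
    and lipschitz: "\<And>x y. x \<in> C \<Longrightarrow> y \<in> C \<Longrightarrow> norm (f x - f y) \<le> \<omega> * norm (x - y)"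
    and bound: "\<And>x. x \<in> C \<Longrightarrow> norm (f x) \<le> B"
begin

abbreviation e :: "real \<Rightarrow> nat \<Rightarrow> 'v" where "e \<equiv> proj_euler C f x0"
abbreviation P :: "'v \<Rightarrow> 'v" where "P \<equiv> closest_point C"

lemma B_nonneg: "B \<ge> 0"
  using bound[OF x0] norm_ge_zero order_trans by blast

lemma P_mem: "P x \<in> C"
  using closest_point_in_set[OF closed] x0 by blast

lemma P_nonexpansive: "norm (P x - P y) \<le> norm (x - y)"
  using closest_point_lipschitz[OF convex closed] x0 by (auto simp: dist_norm)

lemma e_mem: "e h k \<in> C"
  by (cases k) (simp_all add: x0 P_mem)

lemma e_step: "h \<ge> 0 \<Longrightarrow> norm (e h (Suc k) - e h k) \<le> h * B"
proof -
  assume "h \<ge> 0"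
  have "norm (e h (Suc k) - e h k) = norm (P (e h k + h *\<^sub>R f (e h k)) - P (e h k))"
    by (simp add: closest_point_self[OF e_mem])
  also have "\<dots> \<le> norm (h *\<^sub>R f (e h k))"
    using P_nonexpansive[of "e h k + h *\<^sub>R f (e h k)" "e h k"] by simp
  also have "\<dots> \<le> h * B"
    using \<open>h \<ge> 0\<close> bound[OF e_mem] by (simp add: mult_left_mono)
  finally show ?thesis .
qed

lemma e_diff: "h \<ge> 0 \<Longrightarrow> norm (e h (k + j) - e h k) \<le> real j * h * B"
proof (induction j)
  case (Suc j)
  have "norm (e h (k + Suc j) - e h k) \<le> norm (e h (Suc (k + j)) - e h (k + j)) + norm (e h (k + j) - e h k)"
    using norm_triangle_ineq[of "e h (Suc (k + j)) - e h (k + j)" "e h (k + j) - e h k"] by simp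
  also have "\<dots> \<le> h * B + real j * h * B"
    using Suc e_step by (intro add_mono) auto
  finally show ?case by (simp add: algebra_simps)
qed simp

lemma e_diff':
  assumes "h \<ge> 0"
  shows "norm (e h k - e h j) \<le> \<bar>real k * h - real j * h\<bar> * B"
proof (cases "j \<le> k")
  case True
  then have "norm (e h k - e h j) \<le> (real k * h - real j * h) * B"
    using e_diff[OF assms, of j "k - j"] by (simp add: of_nat_diff left_diff_distrib)
  then show ?thesis
    using mult_right_mono[OF abs_ge_self B_nonneg] order_trans by blast
next
  case False
  then have "norm (e h k - e h j) \<le> - (real k * h - real j * h) * B"
    using e_diff[OF assms, of k "j - k"] by (simp add: of_nat_diff left_diff_distrib norm_minus_commute)
  then show ?thesis
    using mult_right_mono[OF abs_ge_minus_self B_nonneg] order_trans by blast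
qed

lemma step_contraction:
  assumes "x \<in> C" "y \<in> C" "h \<ge> 0"
  shows "norm (P (x + h *\<^sub>R f x) - P (y + h *\<^sub>R f y)) \<le> (1 + \<omega> * h) * norm (x - y)"
proof -
  have "norm (P (x + h *\<^sub>R f x) - P (y + h *\<^sub>R f y)) \<le> norm ((x - y) + h *\<^sub>R (f x - f y))"
    using P_nonexpansive[of "x + h *\<^sub>R f x" "y + h *\<^sub>R f y"] by (simp add: algebra_simps)
  also have "\<dots> \<le> norm (x - y) + h * norm (f x - f y)"
    using assms(3) norm_triangle_ineq[of "x - y" "h *\<^sub>R (f x - f y)"] by simp
  also have "\<dots> \<le> norm (x - y) + h * (\<omega> * norm (x - y))"
    using assms lipschitz by (intro add_left_mono mult_left_mono) auto
  finally show ?thesis by (simp add: algebra_simps)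
qed

text \<open>The scheme is autonomous, so the run shifted by \<open>j\<close> steps is another run of
  the same scheme, and each step expands the distance by at most \<open>1 + \<omega> * h\<close>. In
  the limit this controls how fast the speed can grow.\<close>

lemma e_contraction:
  assumes "h \<ge> 0"
  shows "norm (e h (k + n + j) - e h (k + n)) \<le> (1 + \<omega> * h) ^ n * norm (e h (k + j) - e h k)"
proof (induction n)
  case (Suc n)
  have "norm (e h (k + Suc n + j) - e h (k + Suc n)) \<le> (1 + \<omega> * h) * norm (e h (k + n + j) - e h (k + n))"
    using step_contraction[OF e_mem e_mem assms] by simp
  also have "\<dots> \<le> (1 + \<omega> * h) * ((1 + \<omega> * h) ^ n * norm (e h (k + j) - e h k))"
    using Suc assms \<omega> by (intro mult_left_mono) auto
  finally show ?case by (simp add: mult_ac)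
qed simp

lemma power_le_exp: "h \<ge> 0 \<Longrightarrow> (1 + \<omega> * h) ^ n \<le> exp (\<omega> * (real n * h))"
proof -
  assume "h \<ge> 0"
  then have "(1 + \<omega> * h) ^ n \<le> exp (\<omega> * h) ^ n"
    using \<omega> by (intro power_mono) auto
  also have "\<dots> = exp (\<omega> * (real n * h))"
    by (simp add: exp_of_nat_mult[symmetric] mult_ac)
  finally show ?thesis .
qed

text \<open>A step with field value \<open>f p\<close> minus its projected velocity would leave
  \<open>p\<close> fixed. Comparing with this constant run costs \<open>h * V\<close> per step,
  which replaces the crude speed \<open>B\<close> by the norm of the projected velocity.\<close>

lemma e_dist_point:
  assumes "h \<ge> 0" "p \<in> C" and V: "V = norm (proj_tangent C p (f p))"
  shows "norm (e h (k + n) - p) \<le> (1 + \<omega> * h) ^ n * (norm (e h k - p) + real n * h * V)"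
proof (induction n)
  case (Suc n)
  let ?v = "proj_tangent C p (f p)" and ?x = "e h (k + n)"
  \<comment> \<open>A multiple of the normal part of \<open>f p\<close>; the inequality below says
    that \<open>p\<close> is the nearest point of \<open>C\<close> to \<open>p + q\<close>.\<close>
  define q where "q = h *\<^sub>R (f p - ?v)"
  have "norm q \<le> norm (q - (z - p))" if "z \<in> C" for z
  proof -
    have "q \<bullet> (z - p) \<le> 0"
      using proj_tangent_normal[OF convex assms(2), of "f p"] that assms(1)
      by (auto simp: normal_cone_def q_def mult_nonneg_nonpos)
    moreover have "(q - (z - p)) \<bullet> (q - (z - p)) = q \<bullet> q - 2 * (q \<bullet> (z - p)) + (z - p) \<bullet> (z - p)"
      by (simp add: inner_diff_left inner_diff_right inner_commute)
    moreover have "(z - p) \<bullet> (z - p) \<ge> 0" by simp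
    ultimately show ?thesis unfolding norm_le by linarith
  qed
  then have "dist (p + q) p \<le> dist (p + q) z" if "z \<in> C" for z
    using that by (simp add: dist_norm algebra_simps)
  then have p: "P (p + h *\<^sub>R (f p - ?v)) = p"
    by (intro closest_point_unique[OF convex closed assms(2), symmetric]) (auto simp: q_def)
  have "norm (e h (Suc (k + n)) - p) = norm (P (?x + h *\<^sub>R f ?x) - P (p + h *\<^sub>R (f p - ?v)))"
    by (simp add: p)
  also have "\<dots> \<le> norm ((?x - p) + h *\<^sub>R (f ?x - f p) + h *\<^sub>R ?v)"
    using P_nonexpansive[of "?x + h *\<^sub>R f ?x" "p + h *\<^sub>R (f p - ?v)"] by (simp add: algebra_simps)
  also have "\<dots> \<le> norm (?x - p) + h * norm (f ?x - f p) + h * V"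
    using norm_triangle_ineq[of "(?x - p) + h *\<^sub>R (f ?x - f p)" "h *\<^sub>R ?v"]
      norm_triangle_ineq[of "?x - p" "h *\<^sub>R (f ?x - f p)"] assms(1) by (simp add: V)
  also have "\<dots> \<le> norm (?x - p) + h * (\<omega> * norm (?x - p)) + h * V"
    using assms(1,2) lipschitz[OF e_mem] by (intro add_mono mult_left_mono) auto
  also have "\<dots> = (1 + \<omega> * h) * norm (?x - p) + h * V"
    by (simp add: algebra_simps)
  also have "\<dots> \<le> (1 + \<omega> * h) * ((1 + \<omega> * h) ^ n * (norm (e h k - p) + real n * h * V)) + (1 + \<omega> * h) ^ Suc n * (h * V)"
  proof (intro add_mono mult_left_mono)
    have "1 \<le> (1 + \<omega> * h) ^ Suc n" using assms(1) \<omega> by (intro one_le_power) auto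
    then show "h * V \<le> (1 + \<omega> * h) ^ Suc n * (h * V)"
      using assms(1) mult_right_mono[of 1 "(1 + \<omega> * h) ^ Suc n" "h * V"] by (simp add: V)
  qed (use Suc assms(1) \<omega> in auto)
  also have "\<dots> = (1 + \<omega> * h) ^ Suc n * (norm (e h k - p) + real (Suc n) * h * V)"
    by (simp add: algebra_simps)
  finally show ?case by simp
qed simp

text \<open>The obtuse-angle property of the projection with test point \<open>y\<close>, after
  expanding the squares and dropping the square of the step itself.\<close>

lemma e_variational_step:
  assumes "h \<ge> 0" "y \<in> C"
  shows "(norm (e h (Suc k) - y))\<^sup>2 - (norm (e h k - y))\<^sup>2 \<le> 2 * h * (f (e h k) \<bullet> (e h (Suc k) - y))"
proof -
  define a b where "a = e h k" and "b = e h (Suc k)"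
  have "(a + h *\<^sub>R f a - b) \<bullet> (y - b) \<le> 0"
    using closest_point_dot[OF convex closed assms(2)] by (simp add: a_def b_def)
  then have "(b - a) \<bullet> (b - y) \<le> h * (f a \<bullet> (b - y))"
    by (simp add: algebra_simps)
  moreover have "(norm (b - y))\<^sup>2 - (norm (a - y))\<^sup>2 = 2 * ((b - a) \<bullet> (b - y)) - (norm (b - a))\<^sup>2"
    by (simp add: power2_norm_eq_inner algebra_simps inner_commute)
  moreover have "(norm (b - a))\<^sup>2 \<ge> 0" by simp
  ultimately show ?thesis
    unfolding a_def[symmetric] b_def[symmetric] mult.assoc by linarith
qed

text \<open>The one-step inequalities are summed with the field frozen at the starting point
  \<open>p\<close>. The extra terms of \<open>G\<close> are the change of \<open>f\<close> over time
  \<open>d\<close> and the displacement of the second argument, which is one step ahead, hence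
  \<open>d + h\<close>.\<close>

lemma e_variational:
  fixes k n :: nat
  assumes h: "h \<ge> 0" and y: "y \<in> C" and d: "real n * h \<le> d"
  defines "p \<equiv> e h k"
  defines "G \<equiv> f p \<bullet> (p - y) + \<omega> * (d * B) * (norm (p - y) + (d + h) * B) + B * ((d + h) * B)"
  shows "(norm (e h (k + n) - y))\<^sup>2 - (norm (p - y))\<^sup>2 \<le> 2 * (real n * h) * G"
  using d
proof (induction n)
  case (Suc n)
  let ?a = "e h (k + n)" and ?b = "e h (Suc (k + n))"
  have dn: "real n * h \<le> d" "real (Suc n) * h \<le> d + h"
    using Suc.prems h by (auto simp: algebra_simps)
  have d0: "d \<ge> 0" using dn(1) h by (meson mult_nonneg_nonneg of_nat_0_le_iff order_trans)
  have 1: "norm (?a - p) \<le> d * B"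
    using e_diff[OF h, of k n] dn B_nonneg by (auto simp: p_def intro: order_trans mult_right_mono)
  have 2: "norm (?b - p) \<le> (d + h) * B"
    using e_diff[OF h, of k "Suc n"] mult_right_mono[OF dn(2) B_nonneg] by (simp add: p_def)
  have 3: "norm (?b - y) \<le> norm (p - y) + (d + h) * B"
    using norm_triangle_ineq[of "?b - p" "p - y"] 2 by simp
  have pC: "p \<in> C" by (simp add: p_def e_mem)
  have "f ?a \<bullet> (?b - y) = f p \<bullet> (p - y) + (f ?a - f p) \<bullet> (?b - y) + f p \<bullet> (?b - p)"
    by (simp add: algebra_simps)
  also have "\<dots> \<le> f p \<bullet> (p - y) + norm (f ?a - f p) * norm (?b - y) + norm (f p) * norm (?b - p)"
    by (intro add_mono norm_cauchy_schwarz order_refl)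
  also have "norm (f ?a - f p) \<le> \<omega> * (d * B)"
    using lipschitz[OF e_mem pC, of h "k + n"] mult_left_mono[OF 1 \<omega>] by linarith
  then have "f p \<bullet> (p - y) + norm (f ?a - f p) * norm (?b - y) + norm (f p) * norm (?b - p) \<le> G"
    unfolding G_def using 2 3 bound[OF pC] d0 h B_nonneg \<omega>
    by (intro add_mono mult_mono) auto
  finally have G: "f ?a \<bullet> (?b - y) \<le> G" .
  have "(norm (?b - y))\<^sup>2 - (norm (?a - y))\<^sup>2 \<le> 2 * h * G"
    using e_variational_step[OF h y, of "k + n"] mult_left_mono[OF G, of "2 * h"] h by simp
  then show ?case
    using Suc.IH dn(1) by (simp add: algebra_simps)
qed (simp add: p_def)

text \<open>Time \<open>t\<close> is represented by the last grid point not after it, so the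
  approximations are step functions in time.\<close>

definition idx :: "real \<Rightarrow> real \<Rightarrow> nat" where "idx h t = nat \<lfloor>t / h\<rfloor>"

lemma idx_bounds:
  assumes "h > 0" "t \<ge> 0"
  shows "real (idx h t) * h \<le> t" "t \<le> real (idx h t) * h + h"
proof -
  have "real (idx h t) = of_int \<lfloor>t / h\<rfloor>"
    using assms by (simp add: idx_def)
  then have "real (idx h t) \<le> t / h" "t / h \<le> real (idx h t) + 1"
    by linarith+
  then show "real (idx h t) * h \<le> t" "t \<le> real (idx h t) * h + h"
    using assms by (simp_all add: field_simps)
qed

abbreviation h :: "nat \<Rightarrow> real" where "h n \<equiv> inverse (real (Suc n))"

text \<open>An Arzela-Ascoli argument for step functions: they are equicontinuous up to the mesh
  size, so a diagonal subsequence converging at all nonnegative rational times converges at all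
  nonnegative times.\<close>

lemma limit_exists:
  obtains r w where "strict_mono r" "\<And>t. t \<ge> 0 \<Longrightarrow> (\<lambda>n. e (h (r n)) (idx (h (r n)) t)) \<longlonglongrightarrow> w t"
proof -
  define u where "u = (\<lambda>n t. e (h n) (idx (h n) t))"
  have u_diff: "norm (u n t - u n s) \<le> (\<bar>t - s\<bar> + h n) * B" if "t \<ge> 0" "s \<ge> 0" for n s t
  proof -
    have "\<bar>real (idx (h n) t) * h n - real (idx (h n) s) * h n\<bar> \<le> \<bar>t - s\<bar> + h n"
      using idx_bounds[of "h n" t] idx_bounds[of "h n" s] that by auto
    then show ?thesis
      unfolding u_def using e_diff'[of "h n" "idx (h n) t" "idx (h n) s"] B_nonneg
      by (meson inverse_nonnegative_iff_nonnegative mult_right_mono of_nat_0_le_iff order_trans)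
  qed
  \<comment> \<open>The runs grow at most linearly in time; dividing by \<open>1 + t\<close> gives
    the uniform bound that the diagonal selection requires.\<close>
  have u_norm: "norm (u n t /\<^sub>R (1 + t)) \<le> norm x0 + B" if "t \<ge> 0" for n t
  proof -
    have "norm (u n t - x0) \<le> real (idx (h n) t) * h n * B"
      using e_diff[of "h n" 0 "idx (h n) t"] by (simp add: u_def)
    also have "\<dots> \<le> t * B"
      using idx_bounds[of "h n" t] that B_nonneg by (intro mult_right_mono) auto
    finally have "norm (u n t) \<le> norm x0 + t * B"
      using norm_triangle_ineq[of "u n t - x0" x0] by simp
    also have "\<dots> \<le> (1 + t) * (norm x0 + B)"
      using that B_nonneg by (simp add: algebra_simps)
    finally show ?thesis
      using that by (simp add: field_simps)
  qed
  have "countable (\<rat> \<inter> {0::real..})"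
    by (simp add: countable_rat)
  then obtain r where r: "strict_mono (r::nat \<Rightarrow> nat)"
    and lim: "\<And>s. s \<in> \<rat> \<inter> {0..} \<Longrightarrow> \<exists>l. (\<lambda>n. u (r n) s /\<^sub>R (1 + s)) \<longlonglongrightarrow> l"
    by (rule function_convergent_subsequence[where f = "\<lambda>n t. u n t /\<^sub>R (1 + t)" and M = "norm x0 + B"])
      (use u_norm in auto)
  have Cau: "Cauchy (\<lambda>n. u (r n) s)" if "s \<in> \<rat>" "s \<ge> 0" for s
  proof -
    obtain l where "(\<lambda>n. u (r n) s /\<^sub>R (1 + s)) \<longlonglongrightarrow> l"
      using lim \<open>s \<in> \<rat>\<close> \<open>s \<ge> 0\<close> by auto
    then have "(\<lambda>n. (1 + s) *\<^sub>R (u (r n) s /\<^sub>R (1 + s))) \<longlonglongrightarrow> (1 + s) *\<^sub>R l"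
      by (intro tendsto_intros)
    moreover have "(\<lambda>n. (1 + s) *\<^sub>R (u (r n) s /\<^sub>R (1 + s))) = (\<lambda>n. u (r n) s)"
      using that by auto
    ultimately show ?thesis
      using LIMSEQ_imp_Cauchy by metis
  qed
  have "convergent (\<lambda>n. u (r n) t)" if "t \<ge> 0" for t
  proof (rule Cauchy_convergent, rule CauchyI)
    fix \<epsilon> :: real assume "\<epsilon> > 0"
    \<comment> \<open>Distance to the rational time and mesh size each cost at most
      \<open>d * B\<close>, so moving to \<open>s\<close> costs at most a quarter of \<epsilon>;
      \<open>B + 1\<close> covers \<open>B = 0\<close>.\<close>
    define d where "d = \<epsilon> / (8 * (B + 1))"
    have d: "d > 0" "d * B \<le> \<epsilon> / 8"
      using \<open>\<epsilon> > 0\<close> B_nonneg by (auto simp: d_def field_simps)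
    obtain s where s: "s \<in> \<rat>" "t < s" "s < t + d"
      using Rats_dense_in_real[of t "t + d"] d by auto
    then have s0: "s \<ge> 0" using that by linarith
    obtain N1 where N1: "\<And>m n. m \<ge> N1 \<Longrightarrow> n \<ge> N1 \<Longrightarrow> norm (u (r m) s - u (r n) s) < \<epsilon> / 4"
      using CauchyD[OF Cau[OF s(1) s0], of "\<epsilon> / 4"] \<open>\<epsilon> > 0\<close> by auto
    have "(\<lambda>n. h (r n)) \<longlonglongrightarrow> 0"
      using LIMSEQ_subseq_LIMSEQ[OF LIMSEQ_inverse_real_of_nat r] by (simp add: o_def)
    then have "\<forall>\<^sub>F n in sequentially. h (r n) < d"
      using d(1) by (rule order_tendstoD)
    then obtain N2 where N2: "\<And>n. n \<ge> N2 \<Longrightarrow> h (r n) < d"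
      by (auto simp: eventually_sequentially)
    have close: "norm (u (r n) t - u (r n) s) \<le> \<epsilon> / 4" if "n \<ge> N2" for n
    proof -
      have "norm (u (r n) t - u (r n) s) \<le> (\<bar>t - s\<bar> + h (r n)) * B"
        using u_diff \<open>t \<ge> 0\<close> s0 by blast
      also have "\<dots> \<le> (d + d) * B"
        using N2[OF that] s B_nonneg by (intro mult_right_mono) auto
      finally show ?thesis using d(2) by (simp add: algebra_simps)
    qed
    have "norm (u (r m) t - u (r n) t) < \<epsilon>" if "m \<ge> max N1 N2" "n \<ge> max N1 N2" for m n
      using close[of m] close[of n] N1[of m n] that
        norm_triangle_ineq[of "u (r m) t - u (r m) s" "u (r m) s - u (r n) t"]
        norm_triangle_ineq[of "u (r m) s - u (r n) s" "u (r n) s - u (r n) t"]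
        norm_minus_commute[of "u (r n) s" "u (r n) t"] \<open>\<epsilon> > 0\<close> by simp
    then show "\<exists>M. \<forall>m\<ge>M. \<forall>n\<ge>M. norm (u (r m) t - u (r n) t) < \<epsilon>" by blast
  qed
  then have "(\<lambda>n. u (r n) t) \<longlonglongrightarrow> lim (\<lambda>n. u (r n) t)" if "t \<ge> 0" for t
    using that convergent_LIMSEQ_iff by blast
  then show thesis
    unfolding u_def by (rule that[OF r])
qed

abbreviation vel :: "(real \<Rightarrow> 'v) \<Rightarrow> real \<Rightarrow> 'v" where
  "vel w t \<equiv> proj_tangent C (w t) (f (w t))"

section \<open>The limit curve and its velocity\<close>

context
  fixes r :: "nat \<Rightarrow> nat" and w :: "real \<Rightarrow> 'v"
  assumes r: "strict_mono r"
    and w: "\<And>t. t \<ge> 0 \<Longrightarrow> (\<lambda>n. e (h (r n)) (idx (h (r n)) t)) \<longlonglongrightarrow> w t"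
begin

abbreviation H :: "nat \<Rightarrow> real" where "H n \<equiv> h (r n)"
abbreviation ix :: "nat \<Rightarrow> real \<Rightarrow> nat" where "ix n t \<equiv> idx (H n) t"

lemma H_pos: "H n > 0" by simp

lemma H_tendsto: "H \<longlonglongrightarrow> 0"
  using LIMSEQ_subseq_LIMSEQ[OF LIMSEQ_inverse_real_of_nat r] by (simp add: o_def)

lemma ix_tendsto: "t \<ge> 0 \<Longrightarrow> (\<lambda>n. real (ix n t) * H n) \<longlonglongrightarrow> t"
proof (rule tendsto_sandwich)
  assume t: "t \<ge> 0"
  show "\<forall>\<^sub>F n in sequentially. t - H n \<le> real (ix n t) * H n"
    using idx_bounds[OF H_pos t] by (simp add: algebra_simps)
  show "\<forall>\<^sub>F n in sequentially. real (ix n t) * H n \<le> t"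
    using idx_bounds[OF H_pos t] by simp
  show "(\<lambda>n. t - H n) \<longlonglongrightarrow> t"
    using tendsto_diff[OF tendsto_const H_tendsto, of t] by simp
qed simp

text \<open>Step counts with the same limiting time give the same limit because the runs have
  bounded speed. This admits \<open>ix n s + ix n d\<close>, which may differ from
  \<open>ix n (s + d)\<close>.\<close>

lemma e_tendsto:
  assumes "t \<ge> 0" "(\<lambda>n. real (k n) * H n) \<longlonglongrightarrow> t"
  shows "(\<lambda>n. e (H n) (k n)) \<longlonglongrightarrow> w t"
proof (rule Lim_transform2[OF w[OF assms(1)]])
  have "(\<lambda>n. \<bar>real (ix n t) * H n - real (k n) * H n\<bar> * B) \<longlonglongrightarrow> \<bar>t - t\<bar> * B"
    by (intro tendsto_intros ix_tendsto assms)
  then have "(\<lambda>n. \<bar>real (ix n t) * H n - real (k n) * H n\<bar> * B) \<longlonglongrightarrow> 0" by simp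
  then show "(\<lambda>n. e (H n) (ix n t) - e (H n) (k n)) \<longlonglongrightarrow> 0"
    by (rule Lim_null_comparison[rotated]) (intro always_eventually allI e_diff' less_imp_le H_pos)
qed

lemma w_mem: "t \<ge> 0 \<Longrightarrow> w t \<in> C"
  using closed_sequentially[OF closed _ w] e_mem by blast

lemma w_initial: "w 0 = x0"
proof -
  have "(\<lambda>n. e (H n) 0) \<longlonglongrightarrow> w 0"
    by (rule e_tendsto) simp_all
  then show ?thesis by (simp add: LIMSEQ_const_iff)
qed

lemma w_lipschitz:
  assumes "s \<ge> 0" "t \<ge> 0"
  shows "norm (w t - w s) \<le> \<bar>t - s\<bar> * B"
proof (rule LIMSEQ_mono)
  show "(\<lambda>n. norm (e (H n) (ix n t) - e (H n) (ix n s))) \<longlonglongrightarrow> norm (w t - w s)"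
    by (intro tendsto_intros w assms)
  show "(\<lambda>n. \<bar>real (ix n t) * H n - real (ix n s) * H n\<bar> * B) \<longlonglongrightarrow> \<bar>t - s\<bar> * B"
    by (intro tendsto_intros ix_tendsto assms)
qed (rule e_diff'[OF less_imp_le[OF H_pos]])

lemma f_tendsto:
  assumes "X \<longlonglongrightarrow> x" "\<And>n. X n \<in> C" "x \<in> C"
  shows "(\<lambda>n. f (X n)) \<longlonglongrightarrow> f x"
proof (rule LIM_zero_cancel)
  have "(\<lambda>n. \<omega> * norm (X n - x)) \<longlonglongrightarrow> \<omega> * norm (x - x)"
    by (intro tendsto_intros assms)
  then have "(\<lambda>n. \<omega> * norm (X n - x)) \<longlonglongrightarrow> 0" by simp
  then show "(\<lambda>n. f (X n) - f x) \<longlonglongrightarrow> 0"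
    by (rule Lim_null_comparison[rotated]) (use lipschitz assms in auto)
qed

lemma w_contraction:
  assumes "s \<ge> 0" "p \<ge> 0" "d \<ge> 0"
  shows "norm (w (s + p + d) - w (s + p)) \<le> exp (\<omega> * p) * norm (w (s + d) - w s)"
proof (rule LIMSEQ_mono)
  have k2: "(\<lambda>n. real (ix n s + ix n p) * H n) \<longlonglongrightarrow> s + p"
    unfolding of_nat_add distrib_right by (intro tendsto_intros ix_tendsto assms)
  have k3: "(\<lambda>n. real (ix n s + ix n p + ix n d) * H n) \<longlonglongrightarrow> s + p + d"
    unfolding of_nat_add distrib_right by (intro tendsto_intros ix_tendsto assms)
  have k4: "(\<lambda>n. real (ix n s + ix n d) * H n) \<longlonglongrightarrow> s + d"
    unfolding of_nat_add distrib_right by (intro tendsto_intros ix_tendsto assms)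
  show "(\<lambda>n. norm (e (H n) (ix n s + ix n p + ix n d) - e (H n) (ix n s + ix n p)))
     \<longlonglongrightarrow> norm (w (s + p + d) - w (s + p))"
    by (intro tendsto_intros e_tendsto k2 k3) (use assms in auto)
  show "(\<lambda>n. exp (\<omega> * (real (ix n p) * H n)) * norm (e (H n) (ix n s + ix n d) - e (H n) (ix n s)))
     \<longlonglongrightarrow> exp (\<omega> * p) * norm (w (s + d) - w s)"
    by (intro tendsto_intros e_tendsto k4 ix_tendsto) (use assms in auto)
  show "norm (e (H n) (ix n s + ix n p + ix n d) - e (H n) (ix n s + ix n p))
    \<le> exp (\<omega> * (real (ix n p) * H n)) * norm (e (H n) (ix n s + ix n d) - e (H n) (ix n s))" for n
    by (rule order_trans[OF e_contraction]) (intro mult_right_mono power_le_exp less_imp_le H_pos norm_ge_zero)+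
qed

lemma w_speed:
  assumes "s \<ge> 0" "d \<ge> 0"
  shows "norm (w (s + d) - w s) \<le> exp (\<omega> * d) * (d * norm (vel w s))"
proof -
  have k: "(\<lambda>n. real (ix n s + ix n d) * H n) \<longlonglongrightarrow> s + d"
    unfolding of_nat_add distrib_right by (intro tendsto_intros ix_tendsto assms)
  have "norm (w (s + d) - w s) \<le> exp (\<omega> * d) * (norm (w s - w s) + d * norm (vel w s))"
  proof (rule LIMSEQ_mono)
    show "(\<lambda>n. norm (e (H n) (ix n s + ix n d) - w s)) \<longlonglongrightarrow> norm (w (s + d) - w s)"
      by (intro tendsto_intros e_tendsto k) (use assms in auto)
    show "(\<lambda>n. exp (\<omega> * (real (ix n d) * H n)) * (norm (e (H n) (ix n s) - w s) + real (ix n d) * H n * norm (vel w s)))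
      \<longlonglongrightarrow> exp (\<omega> * d) * (norm (w s - w s) + d * norm (vel w s))"
      by (intro tendsto_intros w ix_tendsto) (use assms in auto)
    show "norm (e (H n) (ix n s + ix n d) - w s) \<le>
      exp (\<omega> * (real (ix n d) * H n)) * (norm (e (H n) (ix n s) - w s) + real (ix n d) * H n * norm (vel w s))" for n
      by (rule order_trans[OF e_dist_point[OF less_imp_le[OF H_pos] w_mem[OF assms(1)] refl]])
        (rule mult_right_mono, rule power_le_exp, auto)
  qed
  then show ?thesis by simp
qed

text \<open>Evolution variational inequality in increment form: the terms containing
  \<open>B\<close> are of second order in \<open>d\<close> and disappear when the increment is
  divided by \<open>d\<close>.\<close>

lemma w_variational:
  assumes "s \<ge> 0" "d \<ge> 0" "y \<in> C"
  shows "(norm (w (s + d) - y))\<^sup>2 - (norm (w s - y))\<^sup>2 \<le>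
    2 * d * (f (w s) \<bullet> (w s - y) + \<omega> * (d * B) * (norm (w s - y) + d * B) + B * (d * B))"
proof -
  have k: "(\<lambda>n. real (ix n s + ix n d) * H n) \<longlonglongrightarrow> s + d"
    unfolding of_nat_add distrib_right by (intro tendsto_intros ix_tendsto assms)
  have fs: "(\<lambda>n. f (e (H n) (ix n s))) \<longlonglongrightarrow> f (w s)"
    by (intro f_tendsto w w_mem assms e_mem)
  have "(norm (w (s + d) - y))\<^sup>2 - (norm (w s - y))\<^sup>2 \<le>
    2 * d * (f (w s) \<bullet> (w s - y) + \<omega> * (d * B) * (norm (w s - y) + (d + 0) * B) + B * ((d + 0) * B))"
  proof (rule LIMSEQ_mono)
    show "(\<lambda>n. (norm (e (H n) (ix n s + ix n d) - y))\<^sup>2 - (norm (e (H n) (ix n s) - y))\<^sup>2)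
      \<longlonglongrightarrow> (norm (w (s + d) - y))\<^sup>2 - (norm (w s - y))\<^sup>2"
      by (intro tendsto_intros e_tendsto k w) (use assms in auto)
    show "(\<lambda>n. 2 * (real (ix n d) * H n) * (f (e (H n) (ix n s)) \<bullet> (e (H n) (ix n s) - y) +
        \<omega> * (d * B) * (norm (e (H n) (ix n s) - y) + (d + H n) * B) + B * ((d + H n) * B)))
      \<longlonglongrightarrow> 2 * d * (f (w s) \<bullet> (w s - y) + \<omega> * (d * B) * (norm (w s - y) + (d + 0) * B) + B * ((d + 0) * B))"
      by (intro tendsto_intros fs w ix_tendsto H_tendsto) (use assms in auto)
    show "(norm (e (H n) (ix n s + ix n d) - y))\<^sup>2 - (norm (e (H n) (ix n s) - y))\<^sup>2 \<le>
      2 * (real (ix n d) * H n) * (f (e (H n) (ix n s)) \<bullet> (e (H n) (ix n s) - y) +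
        \<omega> * (d * B) * (norm (e (H n) (ix n s) - y) + (d + H n) * B) + B * ((d + H n) * B))" for n
      by (rule e_variational[OF less_imp_le[OF H_pos] assms(3) idx_bounds(1)[OF H_pos assms(2)]])
  qed
  then show ?thesis by simp
qed

lemma w_tendsto:
  assumes "X \<longlonglongrightarrow> t" "\<And>n. X n \<ge> 0" "t \<ge> 0"
  shows "(\<lambda>n. w (X n)) \<longlonglongrightarrow> w t"
proof (rule LIM_zero_cancel)
  have "(\<lambda>n. \<bar>X n - t\<bar> * B) \<longlonglongrightarrow> \<bar>t - t\<bar> * B"
    by (intro tendsto_intros assms)
  then have "(\<lambda>n. \<bar>X n - t\<bar> * B) \<longlonglongrightarrow> 0" by simp
  then show "(\<lambda>n. w (X n) - w t) \<longlonglongrightarrow> 0"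
    by (rule Lim_null_comparison[rotated]) (use w_lipschitz assms in auto)
qed

text \<open>Dividing \<open>w_variational\<close> by the length of the time interval and shrinking
  it leaves exactly the normal cone inequality for \<open>f (w t) - q\<close>.\<close>

lemma quotient_limit_normal:
  assumes t: "t \<ge> 0" and X: "\<And>n. X n \<ge> 0" "\<And>n. X n \<noteq> t" "X \<longlonglongrightarrow> t"
    and q: "(\<lambda>n. (w (X n) - w t) /\<^sub>R (X n - t)) \<longlonglongrightarrow> q"
  shows "f (w t) - q \<in> normal_cone C (w t)"
proof -
  \<comment> \<open>Ordering the two times treats left and right quotients together; when
    \<open>X n\<close> is on the left, both signs flip and the quotient is unchanged.\<close>
  define a b where "a = (\<lambda>n. min (X n) t)" and "b = (\<lambda>n. max (X n) t)"
  define d where "d = (\<lambda>n. b n - a n)"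
  have d: "d n > 0" "a n \<ge> 0" "b n = a n + d n" for n
    using X(1,2)[of n] t by (auto simp: d_def a_def b_def min_def max_def)
  have a: "a \<longlonglongrightarrow> t" and b: "b \<longlonglongrightarrow> t"
    using tendsto_min[OF X(3) tendsto_const, of t] tendsto_max[OF X(3) tendsto_const, of t]
    by (simp_all add: a_def b_def)
  have dlim: "d \<longlonglongrightarrow> 0"
    using tendsto_diff[OF b a] by (simp add: d_def)
  have wa: "(\<lambda>n. w (a n)) \<longlonglongrightarrow> w t"
    by (rule w_tendsto[OF a]) (use d t in auto)
  have wb: "(\<lambda>n. w (b n)) \<longlonglongrightarrow> w t"
    by (rule w_tendsto[OF b]) (simp_all add: d(3) t add_nonneg_nonneg[OF d(2) less_imp_le[OF d(1)]])
  have g: "(w (X n) - w t) /\<^sub>R (X n - t) = (w (b n) - w (a n)) /\<^sub>R d n" for n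
  proof (cases "X n \<le> t")
    case True
    then have "(w (b n) - w (a n)) /\<^sub>R d n = (w t - w (X n)) /\<^sub>R (- (X n - t))"
      by (simp add: d_def a_def b_def)
    also have "\<dots> = (w (X n) - w t) /\<^sub>R (X n - t)"
      by (simp only: inverse_minus_eq scaleR_minus_left) (simp flip: scaleR_minus_right)
    finally show ?thesis by simp
  qed (simp add: d_def a_def b_def)
  have "(f (w t) - q) \<bullet> (y - w t) \<le> 0" if y: "y \<in> C" for y
  proof -
    have "q \<bullet> (w t + w t - 2 *\<^sub>R y) \<le>
      2 * (f (w t) \<bullet> (w t - y) + \<omega> * (0 * B) * (norm (w t - y) + 0 * B) + B * (0 * B))"
    proof (rule LIMSEQ_mono)
      show "(\<lambda>n. ((w (b n) - w (a n)) /\<^sub>R d n) \<bullet> (w (b n) + w (a n) - 2 *\<^sub>R y)) \<longlonglongrightarrow> q \<bullet> (w t + w t - 2 *\<^sub>R y)"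
        using q unfolding g by (intro tendsto_intros wa wb)
      have "(\<lambda>n. f (w (a n))) \<longlonglongrightarrow> f (w t)"
        by (intro f_tendsto[OF wa] w_mem d t)
      then show "(\<lambda>n. 2 * (f (w (a n)) \<bullet> (w (a n) - y) + \<omega> * (d n * B) * (norm (w (a n) - y) + d n * B) + B * (d n * B)))
        \<longlonglongrightarrow> 2 * (f (w t) \<bullet> (w t - y) + \<omega> * (0 * B) * (norm (w t - y) + 0 * B) + B * (0 * B))"
        by (intro tendsto_intros wa dlim)
      show "((w (b n) - w (a n)) /\<^sub>R d n) \<bullet> (w (b n) + w (a n) - 2 *\<^sub>R y) \<le>
          2 * (f (w (a n)) \<bullet> (w (a n) - y) + \<omega> * (d n * B) * (norm (w (a n) - y) + d n * B) + B * (d n * B))"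
        (is "_ \<le> 2 * ?G") for n
      proof -
        \<comment> \<open>The difference of squared distances to \<open>y\<close> factors, so
          dividing by \<open>d n\<close> exposes the difference quotient.\<close>
        have "(w (b n) - w (a n)) \<bullet> (w (b n) + w (a n) - 2 *\<^sub>R y)
            = (norm (w (b n) - y))\<^sup>2 - (norm (w (a n) - y))\<^sup>2"
          by (simp add: power2_norm_eq_inner algebra_simps inner_commute)
        also have "\<dots> \<le> d n * (2 * ?G)"
          using w_variational[OF d(2) less_imp_le[OF d(1)] y, of n n] by (simp add: d(3) mult_ac)
        finally show ?thesis
          by (rule inner_quotient_le[OF d(1)])
      qed
    qed
    then show ?thesis by (simp add: algebra_simps)
  qed
  then show ?thesis
    using w_mem[OF t] by (simp add: normal_cone_def)
qed

text \<open>Right quotients at \<open>s + p\<close> are bounded through those at \<open>s\<close>.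
  Any limit \<open>q\<close> of them differs from the field by a normal vector, so its norm
  dominates that of the projected velocity.\<close>

lemma v_growth:
  assumes s: "s \<ge> 0" and p: "p \<ge> 0"
  shows "norm (vel w (s + p)) \<le> exp (\<omega> * p) * norm (vel w s)"
proof -
  define g where "g = (\<lambda>n. (w (s + p + h n) - w (s + p)) /\<^sub>R h n)"
  have g: "norm (g n) \<le> exp (\<omega> * p) * (exp (\<omega> * h n) * norm (vel w s))" for n
  proof -
    have "norm (w (s + p + h n) - w (s + p)) \<le> exp (\<omega> * p) * norm (w (s + h n) - w s)"
      using w_contraction[OF s p] by simp
    also have "\<dots> \<le> exp (\<omega> * p) * (exp (\<omega> * h n) * (h n * norm (vel w s)))"
      using w_speed[OF s, of "h n"] by (intro mult_left_mono) auto
    finally have "norm (w (s + p + h n) - w (s + p)) \<le> h n * (exp (\<omega> * p) * (exp (\<omega> * h n) * norm (vel w s)))"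
      by (simp add: mult_ac)
    then show ?thesis
      unfolding g_def by (intro norm_quotient_le) auto
  qed
  have "h n \<le> 1" for n
    by (simp add: field_simps)
  then have "norm (g n) \<le> exp (\<omega> * p) * (exp \<omega> * norm (vel w s))" for n
    using \<omega> by (intro order_trans[OF g] mult_left_mono mult_right_mono) (auto simp: mult_left_le)
  then have "bounded (range g)"
    by (auto simp: bounded_iff)
  then obtain q k where k: "strict_mono (k :: nat \<Rightarrow> nat)" and q: "(g \<circ> k) \<longlonglongrightarrow> q"
    using bounded_imp_convergent_subsequence by blast
  have hk: "(\<lambda>n. h (k n)) \<longlonglongrightarrow> 0"
    using LIMSEQ_subseq_LIMSEQ[OF LIMSEQ_inverse_real_of_nat k] by (simp add: o_def)
  have "norm q \<le> exp (\<omega> * p) * (exp (\<omega> * 0) * norm (vel w s))"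
  proof (rule LIMSEQ_mono)
    show "(\<lambda>n. norm ((g \<circ> k) n)) \<longlonglongrightarrow> norm q"
      by (intro tendsto_intros q)
    show "(\<lambda>n. exp (\<omega> * p) * (exp (\<omega> * h (k n)) * norm (vel w s))) \<longlonglongrightarrow> exp (\<omega> * p) * (exp (\<omega> * 0) * norm (vel w s))"
      by (intro tendsto_intros hk)
    show "norm ((g \<circ> k) n) \<le> exp (\<omega> * p) * (exp (\<omega> * h (k n)) * norm (vel w s))" for n
      unfolding comp_apply by (rule g)
  qed
  moreover have "f (w (s + p)) - q \<in> normal_cone C (w (s + p))"
  proof (rule quotient_limit_normal[of _ "\<lambda>n. s + p + h (k n)"])
    show "(\<lambda>n. s + p + h (k n)) \<longlonglongrightarrow> s + p"
      using tendsto_add[OF tendsto_const hk, of "s + p"] by simp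
    show "(\<lambda>n. (w (s + p + h (k n)) - w (s + p)) /\<^sub>R (s + p + h (k n) - (s + p))) \<longlonglongrightarrow> q"
      using q by (simp add: g_def o_def)
  qed (use s p in auto)
  then have "norm (vel w (s + p)) \<le> norm q"
    using norm_proj_tangent_least[OF convex w_mem] s p by simp
  ultimately show ?thesis by simp
qed

text \<open>At a continuity point of the weighted speed every limit \<open>q\<close> of quotients
  has norm at most that of the projected velocity; together with
  \<open>quotient_limit_normal\<close> the least norm property forces equality.\<close>

lemma has_derivative_at_continuity_points:
  assumes t: "t > 0" and c: "isCont (\<lambda>t. - (exp (- (\<omega> * t)) * norm (vel w t))) t"
  shows "(w has_vector_derivative vel w t) (at t within {0..})"
proof -
  let ?g = "\<lambda>y. (w y - w t) /\<^sub>R (y - t)"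
  have g: "(?g \<longlongrightarrow> vel w t) (at t within {0..})"
  proof (rule tendsto_at_within_limit_points)
    fix y assume "y \<in> {0..}" "y \<noteq> t"
    then have "norm (w y - w t) \<le> \<bar>y - t\<bar> * B"
      using w_lipschitz t by auto
    then show "norm (?g y) \<le> B"
      using \<open>y \<noteq> t\<close> by (intro norm_quotient_le) auto
  next
    fix X q assume X: "\<And>n. X n \<in> {0..}" "\<And>n. X n \<noteq> t" "X \<longlonglongrightarrow> t" and q: "(\<lambda>n. ?g (X n)) \<longlonglongrightarrow> q"
    define a b where "a = (\<lambda>n. min (X n) t)" and "b = (\<lambda>n. max (X n) t)"
    have a: "a \<longlonglongrightarrow> t" and b: "b \<longlonglongrightarrow> t"
      using tendsto_min[OF X(3) tendsto_const, of t] tendsto_max[OF X(3) tendsto_const, of t]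
      by (simp_all add: a_def b_def)
    have "(\<lambda>n. - (exp (- (\<omega> * a n)) * norm (vel w (a n)))) \<longlonglongrightarrow> - (exp (- (\<omega> * t)) * norm (vel w t))"
      using isCont_tendsto_compose[OF c a] .
    from tendsto_mult[OF tendsto_exp[OF tendsto_mult[OF tendsto_const a]] tendsto_minus[OF this], of \<omega>]
    have "(\<lambda>n. exp (\<omega> * a n) * - (- (exp (- (\<omega> * a n)) * norm (vel w (a n)))))
        \<longlonglongrightarrow> exp (\<omega> * t) * - (- (exp (- (\<omega> * t)) * norm (vel w t)))" .
    then have va: "(\<lambda>n. norm (vel w (a n))) \<longlonglongrightarrow> norm (vel w t)"
      by (simp add: exp_minus mult.assoc[symmetric])
    \<comment> \<open>The speed at the left end \<open>a n\<close> bounds the quotient. For left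
      quotients this end is not \<open>t\<close>, which is why continuity of the speed at
      \<open>t\<close> is used.\<close>
    have "norm q \<le> exp (\<omega> * (t - t)) * norm (vel w t)"
    proof (rule LIMSEQ_mono)
      show "(\<lambda>n. norm (?g (X n))) \<longlonglongrightarrow> norm q"
        by (intro tendsto_intros q)
      show "(\<lambda>n. exp (\<omega> * (b n - a n)) * norm (vel w (a n))) \<longlonglongrightarrow> exp (\<omega> * (t - t)) * norm (vel w t)"
        by (intro tendsto_intros a b va)
      show "norm (?g (X n)) \<le> exp (\<omega> * (b n - a n)) * norm (vel w (a n))" for n
      proof -
        have ab: "a n \<ge> 0" "b n - a n \<ge> 0" "\<bar>X n - t\<bar> = b n - a n" "b n - a n \<noteq> 0"
          using X(1,2)[of n] t by (auto simp: a_def b_def min_def max_def)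
        have "norm (w (X n) - w t) = norm (w (b n) - w (a n))"
          by (cases "X n \<le> t") (simp_all add: a_def b_def norm_minus_commute)
        also have "\<dots> \<le> exp (\<omega> * (b n - a n)) * ((b n - a n) * norm (vel w (a n)))"
          using w_speed[OF ab(1,2)] by simp
        finally show ?thesis
          using ab by (intro norm_quotient_le) (auto simp: mult_ac)
      qed
    qed
    then have "norm q \<le> norm (vel w t)" by simp
    moreover have "f (w t) - q \<in> normal_cone C (w t)"
      by (rule quotient_limit_normal[OF _ _ X(2,3) q]) (use X(1) t in auto)
    ultimately show "q = vel w t"
      using proj_tangent_least_norm[OF convex w_mem] t by simp
  qed
  have "((\<lambda>y. norm (?g y - vel w t)) \<longlongrightarrow> 0) (at t within {0..})"
    using tendsto_norm_zero[OF LIM_zero[OF g]] .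
  then have "((\<lambda>y. (1 / norm (y - t)) *\<^sub>R (w y - (w t + (y - t) *\<^sub>R vel w t))) \<longlongrightarrow> 0) (at t within {0..})"
  proof (rule Lim_null_comparison[rotated])
    have "norm ((1 / norm (y - t)) *\<^sub>R (w y - (w t + (y - t) *\<^sub>R vel w t))) = norm (?g y - vel w t)" if "y \<noteq> t" for y
    proof -
      have "?g y - vel w t = (w y - (w t + (y - t) *\<^sub>R vel w t)) /\<^sub>R (y - t)"
        using that by (simp add: scaleR_diff_right scaleR_add_right)
      then show ?thesis by (simp add: divide_inverse)
    qed
    then show "\<forall>\<^sub>F y in at t within {0..}. norm ((1 / norm (y - t)) *\<^sub>R (w y - (w t + (y - t) *\<^sub>R vel w t))) \<le> norm (?g y - vel w t)"
      by (simp add: eventually_at_filter)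
  qed
  then show ?thesis
    unfolding has_vector_derivative_def has_derivative_within
    by (simp add: bounded_linear_scaleR_left)
qed

text \<open>By \<open>v_growth\<close> the speed weighted by a decaying exponential does not
  increase; the minus sign makes the function monotone in the sense of \<open>mono_on\<close>, and
  monotone functions have countably many discontinuities.\<close>

lemma countable_discontinuities:
  "countable {t \<in> {0<..}. \<not> isCont (\<lambda>t. - (exp (- (\<omega> * t)) * norm (vel w t))) t}"
proof (rule mono_on_ctble_discont_open)
  show "mono_on {0<..} (\<lambda>t. - (exp (- (\<omega> * t)) * norm (vel w t)))"
  proof (rule mono_onI)
    fix s t :: real assume st: "s \<in> {0<..}" "t \<in> {0<..}" "s \<le> t"
    have "exp (- (\<omega> * t)) * norm (vel w t) \<le> exp (- (\<omega> * t)) * (exp (\<omega> * (t - s)) * norm (vel w s))"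
      using v_growth[of s "t - s"] st by (intro mult_left_mono) auto
    also have "\<dots> = exp (- (\<omega> * s)) * norm (vel w s)"
      by (simp add: right_diff_distrib flip: mult.assoc exp_add)
    finally show "- (exp (- (\<omega> * s)) * norm (vel w s)) \<le> - (exp (- (\<omega> * t)) * norm (vel w t))"
      by simp
  qed
qed simp

end

lemma projected_dynamics_exists:
  obtains w Q where "w 0 = x0" "\<And>t. t \<ge> 0 \<Longrightarrow> w t \<in> C"
    "\<And>s t. s \<ge> 0 \<Longrightarrow> t \<ge> 0 \<Longrightarrow> norm (w t - w s) \<le> \<bar>t - s\<bar> * B"
    "countable Q"
    "\<And>t. t \<ge> 0 \<Longrightarrow> t \<notin> Q \<Longrightarrow> (w has_vector_derivative proj_tangent C (w t) (f (w t))) (at t within {0..})"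
proof -
  obtain r w where rw: "strict_mono r" "\<And>t. t \<ge> 0 \<Longrightarrow> (\<lambda>n. e (h (r n)) (idx (h (r n)) t)) \<longlonglongrightarrow> w t"
    using limit_exists by blast
  show thesis
  proof (rule that[of w])
    \<comment> \<open>Time 0 joins the exceptional set because continuity is considered on the open
      half-line.\<close>
    let ?D = "{t \<in> {0<..}. \<not> isCont (\<lambda>t. - (exp (- (\<omega> * t)) * norm (proj_tangent C (w t) (f (w t))))) t}"
    show "countable (insert 0 ?D)"
      using countable_discontinuities[OF rw] by simp
    show "(w has_vector_derivative proj_tangent C (w t) (f (w t))) (at t within {0..})"
      if "t \<ge> 0" "t \<notin> insert 0 ?D" for t
      using has_derivative_at_continuity_points[OF rw, of t] that by auto
  qed (use w_initial[OF rw] w_mem[OF rw] w_lipschitz[OF rw] in auto)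
qed

end

section \<open>Functions that are Lipschitz on bounded sets\<close>

text \<open>A Lipschitz constant on each ball: unlike global Lipschitz continuity, this is preserved
  by products, so the rules in \<open>lob_intros\<close> settle the cubic term of the closed loop by
  its syntactic form.\<close>

definition lipschitz_on_bounded :: "('v::real_normed_vector \<Rightarrow> 'w::real_normed_vector) \<Rightarrow> bool" where
  "lipschitz_on_bounded f \<longleftrightarrow>
     (\<forall>R. \<exists>K\<ge>0. \<forall>x\<in>cball 0 R. \<forall>y\<in>cball 0 R. norm (f x - f y) \<le> K * norm (x - y))"

named_theorems lob_intros

lemma lipschitz_on_boundedI:
  assumes "\<And>R. R \<ge> 0 \<Longrightarrow> \<exists>K\<ge>0. \<forall>x\<in>cball 0 R. \<forall>y\<in>cball 0 R. norm (f x - f y) \<le> K * norm (x - y)"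
  shows "lipschitz_on_bounded f"
  unfolding lipschitz_on_bounded_def
proof
  fix R :: real
  obtain K where "K \<ge> 0" "\<forall>x\<in>cball 0 \<bar>R\<bar>. \<forall>y\<in>cball 0 \<bar>R\<bar>. norm (f x - f y) \<le> K * norm (x - y)"
    using assms[of "\<bar>R\<bar>"] by auto
  then show "\<exists>K\<ge>0. \<forall>x\<in>cball 0 R. \<forall>y\<in>cball 0 R. norm (f x - f y) \<le> K * norm (x - y)"
    by (intro exI[of _ K]) auto
qed

lemma lipschitz_on_boundedE:
  assumes "lipschitz_on_bounded f"
  obtains K where "K \<ge> 0"
    "\<And>x y. norm x \<le> R \<Longrightarrow> norm y \<le> R \<Longrightarrow> norm (f x - f y) \<le> K * norm (x - y)"
  using assms unfolding lipschitz_on_bounded_def by (metis mem_cball_0)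

lemma lipschitz_on_bounded_bound:
  fixes f :: "'v::real_normed_vector \<Rightarrow> 'w::real_normed_vector"
  assumes "lipschitz_on_bounded f"
  obtains M where "M \<ge> 0" "\<And>x. norm x \<le> R \<Longrightarrow> norm (f x) \<le> M"
proof -
  obtain K where K: "K \<ge> 0"
    "\<And>x y. norm x \<le> \<bar>R\<bar> \<Longrightarrow> norm y \<le> \<bar>R\<bar> \<Longrightarrow> norm (f x - f y) \<le> K * norm (x - y)"
    using lipschitz_on_boundedE[OF assms] by blast
  show thesis
  proof (rule that[of "K * \<bar>R\<bar> + norm (f 0)"])
    fix x :: 'v assume "norm x \<le> R"
    then have "norm (f x - f 0) \<le> K * norm (x - 0)"
      by (intro K) auto
    also have "\<dots> \<le> K * \<bar>R\<bar>"
      using \<open>norm x \<le> R\<close> K(1) by (intro mult_left_mono) auto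
    finally show "norm (f x) \<le> K * \<bar>R\<bar> + norm (f 0)"
      using norm_triangle_ineq[of "f x - f 0" "f 0"] by simp
  qed (use K(1) in simp)
qed

lemma lob_bounded_linear:
  assumes "bounded_linear f"
  shows "lipschitz_on_bounded f"
proof (rule lipschitz_on_boundedI)
  obtain K where "K > 0" "\<And>x. norm (f x) \<le> norm x * K"
    using bounded_linear.pos_bounded[OF assms] by blast
  then show "\<exists>K\<ge>0. \<forall>x\<in>cball 0 R. \<forall>y\<in>cball 0 R. norm (f x - f y) \<le> K * norm (x - y)" for R
    by (intro exI[of _ K]) (simp add: linear_diff[OF bounded_linear.linear[OF assms], symmetric] mult.commute)
qed

lemma lob_linear:
  fixes f :: "'v::euclidean_space \<Rightarrow> 'w::real_normed_vector"
  shows "linear f \<Longrightarrow> lipschitz_on_bounded f"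
  by (simp add: lob_bounded_linear linear_linear)

lemma lob_const [lob_intros]: "lipschitz_on_bounded (\<lambda>x. c)"
  by (rule lipschitz_on_boundedI) (auto intro: exI[of _ 0])

lemma lob_id [lob_intros]: "lipschitz_on_bounded (\<lambda>x. x)"
  by (rule lob_bounded_linear) (rule bounded_linear_ident)

lemma lob_compose:
  assumes "lipschitz_on_bounded g" "lipschitz_on_bounded f"
  shows "lipschitz_on_bounded (\<lambda>x. g (f x))"
proof (rule lipschitz_on_boundedI)
  fix R :: real
  obtain M where M: "\<And>x. norm x \<le> R \<Longrightarrow> norm (f x) \<le> M"
    using lipschitz_on_bounded_bound[OF assms(2)] by blast
  obtain K where K: "K \<ge> 0" "\<And>x y. norm x \<le> R \<Longrightarrow> norm y \<le> R \<Longrightarrow> norm (f x - f y) \<le> K * norm (x - y)"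
    using lipschitz_on_boundedE[OF assms(2)] by blast
  obtain L where L: "L \<ge> 0" "\<And>x y. norm x \<le> M \<Longrightarrow> norm y \<le> M \<Longrightarrow> norm (g x - g y) \<le> L * norm (x - y)"
    using lipschitz_on_boundedE[OF assms(1)] by blast
  have "norm (g (f x) - g (f y)) \<le> L * K * norm (x - y)" if "norm x \<le> R" "norm y \<le> R" for x y
  proof -
    have "norm (g (f x) - g (f y)) \<le> L * norm (f x - f y)"
      using that by (intro L M)
    also have "\<dots> \<le> L * (K * norm (x - y))"
      using that by (intro mult_left_mono K L)
    finally show ?thesis by (simp add: mult_ac)
  qed
  then show "\<exists>K\<ge>0. \<forall>x\<in>cball 0 R. \<forall>y\<in>cball 0 R. norm (g (f x) - g (f y)) \<le> K * norm (x - y)"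
    using K(1) L(1) by (intro exI[of _ "L * K"]) auto
qed

lemma lob_Pair [lob_intros]:
  assumes "lipschitz_on_bounded f" "lipschitz_on_bounded g"
  shows "lipschitz_on_bounded (\<lambda>x. (f x, g x))"
proof (rule lipschitz_on_boundedI)
  fix R :: real
  obtain K where K: "K \<ge> 0" "\<And>x y. norm x \<le> R \<Longrightarrow> norm y \<le> R \<Longrightarrow> norm (f x - f y) \<le> K * norm (x - y)"
    using lipschitz_on_boundedE[OF assms(1)] by blast
  obtain L where L: "L \<ge> 0" "\<And>x y. norm x \<le> R \<Longrightarrow> norm y \<le> R \<Longrightarrow> norm (g x - g y) \<le> L * norm (x - y)"
    using lipschitz_on_boundedE[OF assms(2)] by blast
  have "norm ((f x, g x) - (f y, g y)) \<le> (K + L) * norm (x - y)" if "norm x \<le> R" "norm y \<le> R" for x y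
    using norm_Pair_le[of "f x - f y" "g x - g y"] K(2)[OF that] L(2)[OF that]
    by (simp add: algebra_simps)
  then show "\<exists>K\<ge>0. \<forall>x\<in>cball 0 R. \<forall>y\<in>cball 0 R. norm ((f x, g x) - (f y, g y)) \<le> K * norm (x - y)"
    using K(1) L(1) by (intro exI[of _ "K + L"]) auto
qed

lemma lob_add [lob_intros]:
  assumes "lipschitz_on_bounded f" "lipschitz_on_bounded g"
  shows "lipschitz_on_bounded (\<lambda>x. f x + g x)"
  using lob_compose[OF lob_bounded_linear[OF bounded_linear_add[OF bounded_linear_fst bounded_linear_snd]] lob_Pair[OF assms]]
  by simp

lemma lob_diff [lob_intros]:
  assumes "lipschitz_on_bounded f" "lipschitz_on_bounded g"
  shows "lipschitz_on_bounded (\<lambda>x. f x - g x)"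
  using lob_compose[OF lob_bounded_linear[OF bounded_linear_sub[OF bounded_linear_fst bounded_linear_snd]] lob_Pair[OF assms]]
  by simp

lemma lob_minus [lob_intros]: "lipschitz_on_bounded f \<Longrightarrow> lipschitz_on_bounded (\<lambda>x. - f x)"
  using lob_diff[OF lob_const[of 0]] by simp

lemma lob_sum [lob_intros]:
  "(\<And>i. i \<in> I \<Longrightarrow> lipschitz_on_bounded (f i)) \<Longrightarrow> lipschitz_on_bounded (\<lambda>x. \<Sum>i\<in>I. f i x)"
  by (induction I rule: infinite_finite_induct) (auto intro: lob_intros)

lemma lob_bilinear:
  assumes b: "bounded_bilinear b" and f: "lipschitz_on_bounded f" and g: "lipschitz_on_bounded g"
  shows "lipschitz_on_bounded (\<lambda>x. b (f x) (g x))"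
proof (rule lipschitz_on_boundedI)
  fix R :: real
  obtain A where A: "A > 0" "\<And>x y. norm (b x y) \<le> norm x * norm y * A"
    using bounded_bilinear.pos_bounded[OF b] by blast
  obtain K where K: "K \<ge> 0" "\<And>x y. norm x \<le> R \<Longrightarrow> norm y \<le> R \<Longrightarrow> norm (f x - f y) \<le> K * norm (x - y)"
    using lipschitz_on_boundedE[OF f] by blast
  obtain L where L: "L \<ge> 0" "\<And>x y. norm x \<le> R \<Longrightarrow> norm y \<le> R \<Longrightarrow> norm (g x - g y) \<le> L * norm (x - y)"
    using lipschitz_on_boundedE[OF g] by blast
  obtain M where M: "M \<ge> 0" "\<And>x. norm x \<le> R \<Longrightarrow> norm (f x) \<le> M"
    using lipschitz_on_bounded_bound[OF f] by blast
  obtain N where N: "N \<ge> 0" "\<And>x. norm x \<le> R \<Longrightarrow> norm (g x) \<le> N"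
    using lipschitz_on_bounded_bound[OF g] by blast
  have "norm (b (f x) (g x) - b (f y) (g y)) \<le> (K * N * A + M * L * A) * norm (x - y)"
    if "norm x \<le> R" "norm y \<le> R" for x y
  proof -
    have "b (f x) (g x) - b (f y) (g y) = b (f x - f y) (g x) + b (f y) (g x - g y)"
      by (simp add: bounded_bilinear.diff_left[OF b] bounded_bilinear.diff_right[OF b])
    also have "norm \<dots> \<le> norm (f x - f y) * norm (g x) * A + norm (f y) * norm (g x - g y) * A"
      by (rule order_trans[OF norm_triangle_ineq add_mono[OF A(2) A(2)]])
    also have "\<dots> \<le> (K * norm (x - y)) * N * A + M * (L * norm (x - y)) * A"
      using A(1) K(1) L(1) M(1) N(1) that
      by (intro add_mono mult_mono K L M N mult_nonneg_nonneg norm_ge_zero order_refl) auto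
    finally show ?thesis by (simp add: algebra_simps)
  qed
  then show "\<exists>K\<ge>0. \<forall>x\<in>cball 0 R. \<forall>y\<in>cball 0 R. norm (b (f x) (g x) - b (f y) (g y)) \<le> K * norm (x - y)"
    using A(1) K(1) L(1) M(1) N(1) by (intro exI[of _ "K * N * A + M * L * A"]) auto
qed

lemmas lob_inner [lob_intros] = lob_bilinear[OF bounded_bilinear_inner]
lemmas lob_mult [lob_intros] = lob_bilinear[OF bounded_bilinear_mult]
lemmas lob_scaleR [lob_intros] = lob_bilinear[OF bounded_bilinear_scaleR]
lemmas lob_fst [lob_intros] = lob_compose[OF lob_bounded_linear[OF bounded_linear_fst]]
lemmas lob_snd [lob_intros] = lob_compose[OF lob_bounded_linear[OF bounded_linear_snd]]
lemmas lob_vec_nth [lob_intros] = lob_compose[OF lob_bounded_linear[OF bounded_linear_vec_nth]]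

lemma lob_vec_lambda [lob_intros]:
  fixes f :: "'n::finite \<Rightarrow> 'v::real_normed_vector \<Rightarrow> 'w::real_normed_vector"
  assumes "\<And>i. lipschitz_on_bounded (f i)"
  shows "lipschitz_on_bounded (\<lambda>x. \<chi> i. f i x)"
proof (rule lipschitz_on_boundedI)
  fix R :: real
  have "\<exists>K\<ge>0. \<forall>x y. norm x \<le> R \<longrightarrow> norm y \<le> R \<longrightarrow> norm (f i x - f i y) \<le> K * norm (x - y)" for i
    using lipschitz_on_boundedE[OF assms[of i], of R] by metis
  then obtain K where K: "\<And>i. K i \<ge> 0"
    "\<And>i x y. norm x \<le> R \<Longrightarrow> norm y \<le> R \<Longrightarrow> norm (f i x - f i y) \<le> K i * norm (x - y)"
    by metis
  have "norm ((\<chi> i. f i x) - (\<chi> i. f i y)) \<le> (\<Sum>i\<in>UNIV. K i) * norm (x - y)"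
    if "norm x \<le> R" "norm y \<le> R" for x y
  proof -
    have "norm ((\<chi> i. f i x) - (\<chi> i. f i y)) \<le> (\<Sum>i\<in>UNIV. norm (f i x - f i y))"
      unfolding norm_vec_def by (rule order_trans[OF L2_set_le_sum]) simp_all
    also have "\<dots> \<le> (\<Sum>i\<in>UNIV. K i * norm (x - y))"
      using that by (intro sum_mono K)
    finally show ?thesis by (simp add: sum_distrib_right)
  qed
  then show "\<exists>K\<ge>0. \<forall>x\<in>cball 0 R. \<forall>y\<in>cball 0 R. norm ((\<chi> i. f i x) - (\<chi> i. f i y)) \<le> K * norm (x - y)"
    using K(1) by (intro exI[of _ "\<Sum>i\<in>UNIV. K i"]) (auto intro: sum_nonneg)
qed

lemma lob_C1:
  fixes f :: "'v::euclidean_space \<Rightarrow> 'w::real_normed_vector"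
  assumes "C1 f"
  shows "lipschitz_on_bounded f"
proof (rule lipschitz_on_boundedI)
  fix R :: real
  obtain f' :: "'v \<Rightarrow> 'v \<Rightarrow>\<^sub>L 'w" where f': "\<And>x. (f has_derivative blinfun_apply (f' x)) (at x)"
    and cont: "continuous_on UNIV f'"
    using assms unfolding C1_def by blast
  have "bounded (f' ` cball 0 R)"
    by (intro compact_imp_bounded compact_continuous_image continuous_on_subset[OF cont]) auto
  then obtain K where K: "K > 0" "\<And>x. x \<in> cball 0 R \<Longrightarrow> norm (f' x) \<le> K"
    by (auto simp: bounded_pos)
  have "norm (f x - f y) \<le> K * norm (x - y)" if "x \<in> cball 0 R" "y \<in> cball 0 R" for x y
  proof (rule differentiable_bound[OF convex_cball _ _ that])
    show "(f has_derivative blinfun_apply (f' x)) (at x within cball 0 R)" for x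
      using f' has_derivative_at_withinI by blast
    show "x \<in> cball 0 R \<Longrightarrow> onorm (blinfun_apply (f' x)) \<le> K" for x
      using K(2) by (simp add: norm_blinfun.rep_eq)
  qed
  then show "\<exists>K\<ge>0. \<forall>x\<in>cball 0 R. \<forall>y\<in>cball 0 R. norm (f x - f y) \<le> K * norm (x - y)"
    using K(1) by (intro exI[of _ K]) auto
qed

text \<open>Provides the exponential weight of the uniqueness proof.\<close>

lemma lob_exp [lob_intros]:
  fixes f :: "'v::real_normed_vector \<Rightarrow> real"
  assumes "lipschitz_on_bounded f"
  shows "lipschitz_on_bounded (\<lambda>x. exp (f x))"
proof (rule lob_compose[OF lob_C1 assms])
  show "C1 (exp :: real \<Rightarrow> real)"
    unfolding C1_def
    by (intro exI[of _ "\<lambda>x. exp x *\<^sub>R id_blinfun"] conjI allI)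
      (auto intro!: continuous_intros derivative_eq_intros simp: scaleR_blinfun.rep_eq mult.commute)
qed

lemma abs_continuous_on_compose:
  fixes w :: "real \<Rightarrow> 'v::real_normed_vector"
  assumes "lipschitz_on_bounded \<phi>" "abs_continuous_on a b w"
  shows "abs_continuous_on a b (\<lambda>t. \<phi> (w t))"
proof -
  have "bounded (w ` {a..b})"
    using abs_continuous_on_imp_continuous_on[OF assms(2)]
    by (intro compact_imp_bounded compact_continuous_image) auto
  then obtain R where R: "\<And>t. t \<in> {a..b} \<Longrightarrow> norm (w t) \<le> R"
    unfolding bounded_iff by blast
  obtain K where K: "K \<ge> 0" "\<And>x y. norm x \<le> R \<Longrightarrow> norm y \<le> R \<Longrightarrow> norm (\<phi> x - \<phi> y) \<le> K * norm (x - y)"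
    using lipschitz_on_boundedE[OF assms(1)] by blast
  show ?thesis
  proof (rule abs_continuous_on_dominated[OF assms(2) K(1)])
    fix s t assume "a \<le> s" "s \<le> t" "t \<le> b"
    then have "norm (\<phi> (w t) - \<phi> (w s)) \<le> K * norm (w t - w s)"
      by (intro K R) auto
    also have "\<dots> \<le> K * (norm (w t - w s) + (t - s))"
      using K(1) \<open>s \<le> t\<close> by (intro mult_left_mono) auto
    finally show "norm (\<phi> (w t) - \<phi> (w s)) \<le> K * (norm (w t - w s) + (t - s))" .
  qed
qed

lemma abs_continuous_on_Pair:
  assumes "abs_continuous_on a b v" "abs_continuous_on a b w"
  shows "abs_continuous_on a b (\<lambda>t. (v t, w t))"
  unfolding abs_continuous_on_iff
proof (intro allI impI)
  fix \<epsilon> :: real assume "\<epsilon> > 0"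
  then have "\<epsilon> / 2 > 0" by simp
  obtain \<delta> where \<delta>: "\<delta> > 0" "\<And>D. interval_family a b D \<Longrightarrow>
     (\<Sum>(s, t)\<in>D. t - s) < \<delta> \<Longrightarrow> (\<Sum>(s, t)\<in>D. norm (v t - v s)) < \<epsilon> / 2"
    using abs_continuous_onE[OF assms(1) \<open>\<epsilon> / 2 > 0\<close>] by blast
  obtain \<eta> where \<eta>: "\<eta> > 0" "\<And>D. interval_family a b D \<Longrightarrow>
     (\<Sum>(s, t)\<in>D. t - s) < \<eta> \<Longrightarrow> (\<Sum>(s, t)\<in>D. norm (w t - w s)) < \<epsilon> / 2"
    using abs_continuous_onE[OF assms(2) \<open>\<epsilon> / 2 > 0\<close>] by blast
  show "\<exists>\<delta>>0. \<forall>D. interval_family a b D \<and>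
     (\<Sum>(s, t)\<in>D. t - s) < \<delta> \<longrightarrow> (\<Sum>(s, t)\<in>D. norm ((v t, w t) - (v s, w s))) < \<epsilon>"
  proof (intro exI[of _ "min \<delta> \<eta>"] conjI allI impI)
    fix D :: "(real \<times> real) set"
    assume D: "interval_family a b D \<and> (\<Sum>(s, t)\<in>D. t - s) < min \<delta> \<eta>"
    have "(\<Sum>(s, t)\<in>D. norm ((v t, w t) - (v s, w s))) \<le> (\<Sum>(s, t)\<in>D. norm (v t - v s) + norm (w t - w s))"
      by (rule sum_mono) (auto simp: norm_Pair_le)
    also have "\<dots> = (\<Sum>(s, t)\<in>D. norm (v t - v s)) + (\<Sum>(s, t)\<in>D. norm (w t - w s))"
      by (simp add: case_prod_unfold sum.distrib)
    also have "\<dots> < \<epsilon>"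
      using D \<delta>(2)[of D] \<eta>(2)[of D] by simp
    finally show "(\<Sum>(s, t)\<in>D. norm ((v t, w t) - (v s, w s))) < \<epsilon>" .
  qed (use \<delta> \<eta> in auto)
qed

lemma caratheodory_solutionE:
  assumes "caratheodory_solution f w0 w"
  obtains N where "negligible N" "w 0 = w0" "\<And>T. T \<ge> 0 \<Longrightarrow> abs_continuous_on 0 T w"
    "\<And>t. t \<ge> 0 \<Longrightarrow> t \<notin> N \<Longrightarrow> (w has_vector_derivative f (w t)) (at t within {0..})"
proof -
  obtain N where "N \<in> null_sets lebesgue"
    "{t \<in> space lebesgue. \<not> (0 \<le> t \<longrightarrow> (w has_vector_derivative f (w t)) (at t within {0..}))} \<subseteq> N"
    using assms unfolding caratheodory_solution_def eventually_ae_filter by blast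
  then show thesis
    using assms by (intro that[of N]) (auto simp: caratheodory_solution_def negligible_iff_null_sets)
qed

lemma has_real_derivative_compose_vector:
  fixes \<phi> :: "'v::real_normed_vector \<Rightarrow> real"
  assumes "(\<phi> has_derivative \<phi>') (at (w t))" "(w has_vector_derivative d) (at t within A)"
  shows "((\<lambda>t. \<phi> (w t)) has_real_derivative \<phi>' d) (at t within A)"
proof -
  have "((\<lambda>t. \<phi> (w t)) has_derivative (\<lambda>x. \<phi>' (x *\<^sub>R d))) (at t within A)"
    using has_derivative_compose[OF assms(2)[unfolded has_vector_derivative_def] assms(1)] .
  also have "(\<lambda>x. \<phi>' (x *\<^sub>R d)) = (*) (\<phi>' d)"
    using linear_cmul[OF has_derivative_linear[OF assms(1)]] by (auto simp: mult.commute)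
  finally show ?thesis
    by (simp add: has_field_derivative_def)
qed

lemma nonincreasing_along:
  fixes u :: "real \<Rightarrow> real"
  assumes "abs_continuous_on 0 b u" "0 \<le> a" "a \<le> b" "negligible N"
    and der: "\<And>t. a \<le> t \<Longrightarrow> t \<le> b \<Longrightarrow> t \<notin> N \<Longrightarrow> \<exists>d\<le>0. (u has_real_derivative d) (at t within {0..})"
  shows "u b \<le> u a"
proof (rule abs_continuous_on_nonincreasing[OF abs_continuous_on_mono[OF assms(1,2) order_refl] assms(3,4)])
  fix t assume t: "t \<in> {a..b} - N"
  then obtain d where d: "d \<le> 0" "(u has_real_derivative d) (at t within {0..})"
    using der by auto
  have "(u has_real_derivative d) (at t within {a..b})"
    by (rule DERIV_subset[OF d(2)]) (use assms(2) in auto)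
  then show "\<exists>d\<le>0. (u has_real_derivative d) (at t within {a..b})"
    using d(1) by blast
qed

section \<open>Squared distance to a convex set, invariance and uniqueness\<close>

context
  fixes S :: "'v::euclidean_space set"
  assumes S: "closed S" "convex S" "S \<noteq> {}"
begin

abbreviation (input) P :: "'v \<Rightarrow> 'v" where "P \<equiv> closest_point S"

text \<open>The upper bound uses \<open>P x\<close> as a competitor for the point nearest to
  \<open>y\<close>. The lower bound exchanges \<open>x\<close> and \<open>y\<close>, and
  nonexpansiveness of the projection absorbs the change of the residual.\<close>

lemma sq_dist_expansion:
  "\<bar>(norm (y - P y))\<^sup>2 - (norm (x - P x))\<^sup>2 - 2 * ((x - P x) \<bullet> (y - x))\<bar> \<le> (norm (y - x))\<^sup>2"
proof -
  have le: "(norm (y - P y))\<^sup>2 \<le> (norm (y - P x))\<^sup>2" for x y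
    using closest_point_le[OF S(1) closest_point_in_set[OF S(1,3)], of y x]
    by (simp add: dist_norm power_mono)
  have ex: "(norm (y - P x))\<^sup>2 = (norm (x - P x))\<^sup>2 + 2 * ((x - P x) \<bullet> (y - x)) + (norm (y - x))\<^sup>2" for x y
    by (simp add: power2_norm_eq_inner algebra_simps inner_commute)
  have "(P y - P x) \<bullet> (y - x) \<le> norm (P y - P x) * norm (y - x)"
    by (rule norm_cauchy_schwarz)
  also have "\<dots> \<le> norm (y - x) * norm (y - x)"
    using closest_point_lipschitz[OF S(2,1,3), of y x] by (intro mult_right_mono) (auto simp: dist_norm)
  finally have "(P y - P x) \<bullet> (y - x) \<le> (norm (y - x))\<^sup>2"
    by (simp add: power2_eq_square)
  moreover have "(y - P y) \<bullet> (x - y) = - ((x - P x) \<bullet> (y - x)) - (norm (y - x))\<^sup>2 + (P y - P x) \<bullet> (y - x)"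
    by (simp add: power2_norm_eq_inner algebra_simps inner_commute)
  ultimately show ?thesis
    using le[of y x] le[of x y] ex[of y x] ex[of x y] norm_minus_commute[of x y] by simp
qed

text \<open>The quadratic remainder gives differentiability everywhere, including at boundary points
  of \<open>S\<close>, where \<open>P\<close> itself may fail to be differentiable.\<close>

lemma has_derivative_sq_dist:
  "((\<lambda>x. (norm (x - P x))\<^sup>2) has_derivative (\<lambda>h. 2 * ((x - P x) \<bullet> h))) (at x)"
  unfolding has_derivative_within_alt
proof (intro conjI allI impI)
  show "bounded_linear (\<lambda>h. 2 * ((x - P x) \<bullet> h))"
    by (intro bounded_linear_mult_right[THEN bounded_linear_compose] bounded_linear_inner_right)
  fix e :: real assume "e > 0"
  have "norm ((norm (y - P y))\<^sup>2 - (norm (x - P x))\<^sup>2 - 2 * ((x - P x) \<bullet> (y - x))) \<le> e * norm (y - x)"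
    if "norm (y - x) < e" for y
    using sq_dist_expansion[of y x] mult_right_mono[OF less_imp_le[OF that], of "norm (y - x)"]
    by (simp add: power2_eq_square)
  then show "\<exists>d>0. \<forall>y\<in>UNIV. norm (y - x) < d \<longrightarrow>
      norm ((norm (y - P y))\<^sup>2 - (norm (x - P x))\<^sup>2 - 2 * ((x - P x) \<bullet> (y - x))) \<le> e * norm (y - x)"
    using \<open>e > 0\<close> by blast
qed

lemma lob_sq_dist: "lipschitz_on_bounded (\<lambda>x. (norm (x - P x))\<^sup>2)"
proof -
  have "lipschitz_on_bounded P"
    using closest_point_lipschitz[OF S(2,1,3)]
    by (intro lipschitz_on_boundedI exI[of _ 1]) (auto simp: dist_norm)
  then show ?thesis
    unfolding power2_norm_eq_inner by (intro lob_intros)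
qed

text \<open>A velocity in the tangent cone never points away from a convex set, even at points outside the set,
  so the squared distance to the set cannot increase.\<close>

lemma tangent_velocity_invariant:
  assumes ac: "\<And>T. T \<ge> 0 \<Longrightarrow> abs_continuous_on 0 T w" and N: "negligible N"
    and der: "\<And>t. t \<ge> 0 \<Longrightarrow> t \<notin> N \<Longrightarrow> (w has_vector_derivative w' t) (at t within {0..})"
    and tan: "\<And>t. t \<ge> 0 \<Longrightarrow> t \<notin> N \<Longrightarrow> w' t \<in> tangent_cone S (w t)"
    and "w 0 \<in> S" "T \<ge> 0"
  shows "w T \<in> S"
proof -
  have "(norm (w T - P (w T)))\<^sup>2 \<le> (norm (w 0 - P (w 0)))\<^sup>2"
  proof (rule nonincreasing_along[OF abs_continuous_on_compose[OF lob_sq_dist ac[OF \<open>T \<ge> 0\<close>]] order_refl \<open>T \<ge> 0\<close> N])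
    fix t assume t: "0 \<le> t" "t \<notin> N"
    \<comment> \<open>Changing the base point from \<open>P (w t)\<close> to \<open>w t\<close>
      subtracts the squared residual, so the inequality for the projection persists at a point
      outside \<open>S\<close>.\<close>
    have "(w t - P (w t)) \<bullet> (z - w t) \<le> 0" if "z \<in> S" for z
    proof -
      have "(w t - P (w t)) \<bullet> (z - P (w t)) \<le> 0"
        by (rule closest_point_dot[OF S(2,1) that])
      moreover have "(w t - P (w t)) \<bullet> (w t - P (w t)) \<ge> 0"
        by simp
      moreover have "z - w t = (z - P (w t)) - (w t - P (w t))"
        by simp
      ultimately show ?thesis
        by (simp only: inner_diff_right)
    qed
    then have "(w t - P (w t)) \<bullet> w' t \<le> 0"
      by (rule inner_tangent_cone_le[OF tan[OF t]])
    then show "\<exists>d\<le>0. ((\<lambda>t. (norm (w t - P (w t)))\<^sup>2) has_real_derivative d) (at t within {0..})"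
      using has_real_derivative_compose_vector[OF has_derivative_sq_dist der[OF t]]
      by (intro exI[of _ "2 * ((w t - P (w t)) \<bullet> w' t)"]) auto
  qed
  then have "w T = P (w T)"
    using closest_point_self[OF \<open>w 0 \<in> S\<close>] by simp
  then show ?thesis
    using closest_point_in_set[OF S(1,3), of "w T"] by simp
qed

lemma proj_tangent_mem_tangent_cone: "proj_tangent S x f \<in> tangent_cone S x"
  unfolding proj_tangent_def
  using S(3) diff_mem_tangent_cone[of _ S x] by (intro closest_point_in_set closed_tangent_cone) auto

text \<open>The normal parts only bring the two solutions closer, so the squared distance grows at
  rate at most twice the Lipschitz constant \<open>K\<close> on a ball containing both up to time
  \<open>T\<close>. The exponential weight makes it nonincreasing.\<close>

lemma projected_dynamics_unique:
  assumes f: "lipschitz_on_bounded f" and N: "negligible N"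
    and ac1: "abs_continuous_on 0 T w1" and ac2: "abs_continuous_on 0 T w2"
    and d1: "\<And>t. t \<ge> 0 \<Longrightarrow> t \<notin> N \<Longrightarrow> (w1 has_vector_derivative proj_tangent S (w1 t) (f (w1 t))) (at t within {0..})"
    and d2: "\<And>t. t \<ge> 0 \<Longrightarrow> t \<notin> N \<Longrightarrow> (w2 has_vector_derivative proj_tangent S (w2 t) (f (w2 t))) (at t within {0..})"
    and S1: "\<And>t. t \<ge> 0 \<Longrightarrow> w1 t \<in> S" and S2: "\<And>t. t \<ge> 0 \<Longrightarrow> w2 t \<in> S"
    and eq: "w1 0 = w2 0" and "T \<ge> 0"
  shows "w1 T = w2 T"
proof -
  have "bounded (w1 ` {0..T} \<union> w2 ` {0..T})"
    using abs_continuous_on_imp_continuous_on[OF ac1] abs_continuous_on_imp_continuous_on[OF ac2]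
    by (auto intro!: compact_imp_bounded compact_continuous_image)
  then obtain R where R: "\<And>t. t \<in> {0..T} \<Longrightarrow> norm (w1 t) \<le> R" "\<And>t. t \<in> {0..T} \<Longrightarrow> norm (w2 t) \<le> R"
    unfolding bounded_iff by blast
  obtain K where K: "K \<ge> 0" "\<And>x y. norm x \<le> R \<Longrightarrow> norm y \<le> R \<Longrightarrow> norm (f x - f y) \<le> K * norm (x - y)"
    using lipschitz_on_boundedE[OF f] by blast
  let ?u = "\<lambda>t. exp (- (2 * K) * t) * ((w1 t - w2 t) \<bullet> (w1 t - w2 t))"
  have "abs_continuous_on 0 T (\<lambda>t::real. t)"
    by (rule abs_continuous_on_lipschitz[of 1]) auto
  then have "abs_continuous_on 0 T (\<lambda>t. (t, w1 t, w2 t))"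
    by (intro abs_continuous_on_Pair ac1 ac2)
  moreover have "lipschitz_on_bounded (\<lambda>p::real \<times> 'v \<times> 'v. exp (- (2 * K) * fst p) *
      ((fst (snd p) - snd (snd p)) \<bullet> (fst (snd p) - snd (snd p))))"
    by (intro lob_intros)
  ultimately have ac: "abs_continuous_on 0 T ?u"
    by (auto dest!: abs_continuous_on_compose)
  have "?u T \<le> ?u 0"
  proof (rule nonincreasing_along[OF ac order_refl \<open>T \<ge> 0\<close> N])
    fix t assume t: "0 \<le> t" "t \<le> T" "t \<notin> N"
    let ?v1 = "proj_tangent S (w1 t) (f (w1 t))" and ?v2 = "proj_tangent S (w2 t) (f (w2 t))"
    let ?d = "w1 t - w2 t"
    have "(f (w1 t) - ?v1) \<bullet> (w2 t - w1 t) \<le> 0" "(f (w2 t) - ?v2) \<bullet> (w1 t - w2 t) \<le> 0"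
      using proj_tangent_normal[OF S(2) S1[OF t(1)], of "f (w1 t)"] S2[OF t(1)]
        proj_tangent_normal[OF S(2) S2[OF t(1)], of "f (w2 t)"] S1[OF t(1)]
      by (auto simp: normal_cone_def)
    then have "?d \<bullet> (?v1 - ?v2) \<le> ?d \<bullet> (f (w1 t) - f (w2 t))"
      by (simp add: algebra_simps inner_commute)
    also have "\<dots> \<le> norm ?d * norm (f (w1 t) - f (w2 t))"
      by (rule norm_cauchy_schwarz)
    also have "\<dots> \<le> norm ?d * (K * norm ?d)"
      using K R t by (intro mult_left_mono) auto
    also have "\<dots> = K * (?d \<bullet> ?d)"
      using dot_square_norm[of ?d] by (simp add: power2_eq_square)
    finally have le: "?d \<bullet> (?v1 - ?v2) \<le> K * (?d \<bullet> ?d)" .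
    have "((\<lambda>t. w1 t - w2 t) has_vector_derivative ?v1 - ?v2) (at t within {0..})"
      by (intro has_vector_derivative_diff d1 d2 t)
    moreover have "((\<lambda>x. x \<bullet> x) has_derivative (\<lambda>h. 2 * (?d \<bullet> h))) (at ?d)"
      by (auto intro!: derivative_eq_intros simp: inner_commute)
    ultimately have du: "((\<lambda>t. (w1 t - w2 t) \<bullet> (w1 t - w2 t)) has_real_derivative 2 * (?d \<bullet> (?v1 - ?v2))) (at t within {0..})"
      using has_real_derivative_compose_vector by fast
    have "((\<lambda>t. exp (- (2 * K) * t)) has_real_derivative exp (- (2 * K) * t) * - (2 * K)) (at t within {0..})"
      by (auto intro!: derivative_eq_intros)
    then have D: "(?u has_real_derivative
        exp (- (2 * K) * t) * - (2 * K) * (?d \<bullet> ?d) + 2 * (?d \<bullet> (?v1 - ?v2)) * exp (- (2 * K) * t)) (at t within {0..})"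
      by (rule DERIV_mult[OF _ du])
    have "exp (- (2 * K) * t) * - (2 * K) * (?d \<bullet> ?d) + 2 * (?d \<bullet> (?v1 - ?v2)) * exp (- (2 * K) * t)
      = 2 * exp (- (2 * K) * t) * (?d \<bullet> (?v1 - ?v2) - K * (?d \<bullet> ?d))"
      by (simp add: algebra_simps)
    also have "\<dots> \<le> 0"
      using le by (intro mult_nonneg_nonpos) auto
    finally show "\<exists>d\<le>0. (?u has_real_derivative d) (at t within {0..})"
      using D by blast
  qed
  then have "(w1 T - w2 T) \<bullet> (w1 T - w2 T) \<le> 0"
    using eq by (simp add: mult_le_0_iff)
  from inner_self_le_0D[OF this] show ?thesis by simp
qed

end

section \<open>Global existence under a Lyapunov function\<close>

lemma countable_imp_negligible: "countable A \<Longrightarrow> negligible (A :: 'v::euclidean_space set)"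
  by (simp add: negligible_iff_null_sets null_sets_completionI countable_imp_null_set_lborel)

lemma nonincreasing_tendsto_at_top:
  fixes u :: "real \<Rightarrow> real"
  assumes "\<And>s t. a \<le> s \<Longrightarrow> s \<le> t \<Longrightarrow> u t \<le> u s" "\<And>t. a \<le> t \<Longrightarrow> m \<le> u t"
  obtains l where "(u \<longlongrightarrow> l) at_top"
proof
  have bdd: "bdd_below (u ` {a..})"
    by (rule bdd_belowI2[of _ m]) (use assms(2) in simp)
  show "(u \<longlongrightarrow> Inf (u ` {a..})) at_top"
  proof (rule decreasing_tendsto)
    show "\<forall>\<^sub>F t in at_top. Inf (u ` {a..}) \<le> u t"
      using eventually_ge_at_top[of a] by eventually_elim (rule cInf_lower[OF _ bdd], simp)
    fix x assume "Inf (u ` {a..}) < x"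
    then obtain s where "s \<ge> a" "u s < x"
      using cInf_less_iff[OF _ bdd, of x] by auto
    show "\<forall>\<^sub>F t in at_top. u t < x"
      using eventually_ge_at_top[of s] by eventually_elim (use assms(1) \<open>s \<ge> a\<close> \<open>u s < x\<close> in fastforce)
  qed
qed

text \<open>The field is modified outside a large ball to make it bounded and Lipschitz; the Lyapunov
  function keeps the trajectory of the modified field inside the ball.\<close>

lemma projected_dynamics_global:
  fixes S :: "'v::euclidean_space set"
  assumes S: "closed S" "convex S" "x0 \<in> S"
    and f: "lipschitz_on_bounded f"
    and V: "lipschitz_on_bounded V" "\<And>x. (V has_derivative V' x) (at x)"
    and decr: "\<And>x. x \<in> S \<Longrightarrow> V' x (proj_tangent S x (f x)) \<le> (0::real)"
    and R: "\<And>x. V x \<le> V x0 \<Longrightarrow> norm x \<le> R"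
  obtains w Q M where "w 0 = x0" "\<And>t. t \<ge> 0 \<Longrightarrow> w t \<in> S" "\<And>t. t \<ge> 0 \<Longrightarrow> norm (w t) \<le> R"
    "M \<ge> 0" "\<And>s t. s \<ge> 0 \<Longrightarrow> t \<ge> 0 \<Longrightarrow> norm (w t - w s) \<le> M * \<bar>t - s\<bar>"
    "countable Q"
    "\<And>t. t \<ge> 0 \<Longrightarrow> t \<notin> Q \<Longrightarrow> (w has_vector_derivative proj_tangent S (w t) (f (w t))) (at t within {0..})"
proof -
  have R0: "R \<ge> 0"
    using R[OF order_refl] norm_ge_zero order_trans by blast
  define P where "P = closest_point (cball (0::'v) (R + 1))"
  have Pn: "norm (P x) \<le> R + 1" for x
    using closest_point_in_set[of "cball (0::'v) (R + 1)" x] R0 by (simp add: P_def)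
  have Plip: "norm (P x - P y) \<le> norm (x - y)" for x y
    using closest_point_lipschitz[of "cball (0::'v) (R + 1)" x y] R0 by (auto simp: P_def dist_norm)
  have Pid: "P x = x" if "norm x \<le> R + 1" for x
    using that by (simp add: P_def closest_point_self)
  obtain K where K: "K \<ge> 0" "\<And>x y. norm x \<le> R + 1 \<Longrightarrow> norm y \<le> R + 1 \<Longrightarrow> norm (f x - f y) \<le> K * norm (x - y)"
    using lipschitz_on_boundedE[OF f] by blast
  obtain M where M: "M \<ge> 0" "\<And>x. norm x \<le> R + 1 \<Longrightarrow> norm (f x) \<le> M"
    using lipschitz_on_bounded_bound[OF f] by blast
  interpret projected_field S "\<lambda>x. f (P x)" K M x0
  proof
    show "norm (f (P x) - f (P y)) \<le> K * norm (x - y)" for x y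
      by (rule order_trans[OF K(2)[OF Pn Pn]]) (intro mult_left_mono Plip K)
  qed (use S K M Pn in auto)
  obtain w Q where w: "w 0 = x0" "\<And>t. t \<ge> 0 \<Longrightarrow> w t \<in> S"
    "\<And>s t. s \<ge> 0 \<Longrightarrow> t \<ge> 0 \<Longrightarrow> norm (w t - w s) \<le> \<bar>t - s\<bar> * M" "countable Q"
    "\<And>t. t \<ge> 0 \<Longrightarrow> t \<notin> Q \<Longrightarrow> (w has_vector_derivative proj_tangent S (w t) (f (P (w t)))) (at t within {0..})"
    using projected_dynamics_exists by blast
  have ac: "abs_continuous_on 0 T w" if "T \<ge> 0" for T
  proof (rule abs_continuous_on_lipschitz[OF M(1)])
    show "norm (w t - w s) \<le> M * (t - s)" if "0 \<le> s" "s \<le> t" for s t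
      using w(3)[of s t] that by (simp add: mult.commute)
  qed
  \<comment> \<open>The bound is supposed only before \<open>T\<close>; the time \<open>T\<close>
    itself is put into the negligible set, so that the estimate can be applied at a first exit
    time.\<close>
  have step: "norm (w T) \<le> R" if "T \<ge> 0" and le: "\<And>t. 0 \<le> t \<Longrightarrow> t < T \<Longrightarrow> norm (w t) \<le> R + 1" for T
  proof -
    have "V (w T) \<le> V (w 0)"
    proof (rule nonincreasing_along[OF abs_continuous_on_compose[OF V(1) ac] order_refl])
      show "negligible (insert T Q)"
        using w(4) by (intro countable_imp_negligible) simp
      fix t assume t: "0 \<le> t" "t \<le> T" "t \<notin> insert T Q"
      then have "P (w t) = w t"
        using le[of t] by (intro Pid) auto
      then have "((\<lambda>t. V (w t)) has_real_derivative V' (w t) (proj_tangent S (w t) (f (w t)))) (at t within {0..})"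
        using has_real_derivative_compose_vector[OF V(2) w(5)[of t]] t by simp
      then show "\<exists>d\<le>0. ((\<lambda>t. V (w t)) has_real_derivative d) (at t within {0..})"
        using decr w(2) t by blast
    qed (use that in auto)
    then show ?thesis using R w(1) by simp
  qed
  \<comment> \<open>Times at which the norm is at least \<open>R + 1\<close>. At the least of them
    \<open>step\<close> would give at most \<open>R\<close>; the gap between the radii is the
    contradiction.\<close>
  define A where "A = {0..} \<inter> (\<lambda>t. norm (w t)) -` {R + 1..}"
  have "A = {}"
  proof (rule ccontr)
    assume "A \<noteq> {}"
    have "M-lipschitz_on {0..} w"
      using w(3) M(1) by (auto simp: lipschitz_on_def dist_norm mult.commute)
    then have "continuous_on {0..} (\<lambda>t. norm (w t))"
      by (intro continuous_on_norm lipschitz_on_continuous_on)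
    then have "closed A"
      unfolding A_def by (intro continuous_closed_preimage) auto
    moreover have bdd: "bdd_below A"
      by (auto simp: A_def intro: bdd_belowI[of _ 0])
    ultimately have inf: "Inf A \<in> A"
      using closed_contains_Inf \<open>A \<noteq> {}\<close> by blast
    have "norm (w t) \<le> R + 1" if "0 \<le> t" "t < Inf A" for t
      using cInf_lower[OF _ bdd, of t] that by (force simp: A_def)
    then have "norm (w (Inf A)) \<le> R"
      using inf by (intro step) (auto simp: A_def)
    then show False
      using inf by (simp add: A_def)
  qed
  then have "norm (w t) \<le> R + 1" if "t \<ge> 0" for t
    using that by (force simp: A_def)
  then have wR: "norm (w t) \<le> R" if "t \<ge> 0" for t
    using that by (intro step) auto
  show thesis
  proof (rule that[of w M Q])
    show "norm (w t - w s) \<le> M * \<bar>t - s\<bar>" if "s \<ge> 0" "t \<ge> 0" for s t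
      using w(3)[OF that] by (simp add: mult.commute)
    show "(w has_vector_derivative proj_tangent S (w t) (f (w t))) (at t within {0..})" if "t \<ge> 0" "t \<notin> Q" for t
      using w(5)[OF that] Pid[of "w t"] wR[OF that(1)] by simp
  qed (use w(1,2,4) wR M(1) in auto)
qed

text \<open>The vectors \<open>(n v - x) / n\<close> lie in the cone and tend to \<open>v\<close>,
  for any base point \<open>x\<close>. Invariance of \<open>consensus_perp\<close> uses this before
  \<open>z\<close> is known to remain there.\<close>

lemma subspace_mem_tangent_cone:
  assumes "subspace S" "v \<in> S"
  shows "v \<in> tangent_cone S x"
proof -
  have lim: "(\<lambda>n. inverse (real (Suc n)) *\<^sub>R (real (Suc n) *\<^sub>R v - x)) \<longlonglongrightarrow> v"
  proof -
    have "(\<lambda>n. v - inverse (real (Suc n)) *\<^sub>R x) \<longlonglongrightarrow> v - 0 *\<^sub>R x"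
      by (intro tendsto_intros LIMSEQ_inverse_real_of_nat)
    moreover have "inverse (real (Suc n)) *\<^sub>R (real (Suc n) *\<^sub>R v - x) = v - inverse (real (Suc n)) *\<^sub>R x" for n
      by (simp only: scaleR_diff_right) simp
    ultimately show ?thesis by simp
  qed
  have mem: "inverse (real (Suc n)) *\<^sub>R (real (Suc n) *\<^sub>R v - x) \<in> tangent_cone S x" for n
    using assms by (intro scaled_diff_mem_tangent_cone) (auto simp: subspace_scale)
  show ?thesis
    by (rule closed_sequentially[OF closed_tangent_cone mem lim])
qed

lemma proj_tangent_subspace:
  fixes S :: "'v::euclidean_space set"
  assumes "subspace S" "v \<in> S" "x \<in> S"
  shows "proj_tangent S x v = v"
  by (rule proj_tangent_eqI)
    (use assms subspace_mem_tangent_cone in \<open>auto simp: subspace_imp_convex normal_cone_def\<close>)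

section \<open>The Laplacian of a connected graph\<close>

lemma positive_definite_coercive:
  fixes A :: "'v::euclidean_space \<Rightarrow> 'v"
  assumes "linear A" "\<And>x. x \<noteq> 0 \<Longrightarrow> x \<bullet> A x > 0"
  obtains c where "c > 0" "\<And>x. x \<bullet> A x \<ge> c * (norm x)\<^sup>2"
proof -
  have "continuous_on (sphere (0::'v) 1) (\<lambda>x. x \<bullet> A x)"
    by (intro continuous_intros linear_continuous_on linear_linear[THEN iffD2, OF assms(1)] )
  moreover obtain b :: 'v where "b \<in> Basis" using nonempty_Basis by blast
  then have "sphere (0::'v) 1 \<noteq> {}" by (auto intro: exI[of _ b])
  ultimately obtain m where m: "norm m = 1" "\<And>x. norm x = 1 \<Longrightarrow> m \<bullet> A m \<le> x \<bullet> A x"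
    using continuous_attains_inf[OF compact_sphere, of "0::'v" 1 "\<lambda>x. x \<bullet> A x"] by auto
  show thesis
  proof (rule that[of "m \<bullet> A m"])
    show "m \<bullet> A m > 0" using m(1) assms(2)[of m] by force
    fix x :: 'v
    show "x \<bullet> A x \<ge> m \<bullet> A m * (norm x)\<^sup>2"
    proof (cases "x = 0")
      case False
      define u where "u = x /\<^sub>R norm x"
      have x: "x = norm x *\<^sub>R u" "norm u = 1" using False by (simp_all add: u_def)
      have "x \<bullet> A x = (norm x)\<^sup>2 * (u \<bullet> A u)"
        by (subst (1 2) x(1)) (simp add: linear_cmul[OF assms(1)] power2_eq_square)
      then show ?thesis
        using mult_left_mono[OF m(2)[OF x(2)], of "(norm x)\<^sup>2"] by (simp add: mult.commute)
    qed simp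
  qed
qed

lemma linear_kron_id: "linear (kron_id A)"
  by (rule linearI) (simp_all add: kron_id_def vec_eq_iff scaleR_add_right sum.distrib scaleR_sum_right mult.commute sum_distrib_left algebra_simps)

lemma linear_kron_ones: "linear kron_ones"
  by (rule linearI) (simp_all add: kron_ones_def vec_eq_iff)

lemma inner_kron_ones: "kron_ones v \<bullet> y = v \<bullet> (\<Sum>i\<in>UNIV. y $ i)"
  by (subst inner_vec_def) (simp add: kron_ones_def inner_sum_right)

lemma subspace_consensus_perp: "subspace consensus_perp"
  by (rule subspaceI) (simp_all add: consensus_perp_def sum.distrib flip: scaleR_sum_right)

lemma kron_id_diag: "kron_id (diag k) y $ i = k $ i *\<^sub>R y $ i"
  by (simp add: kron_id_def diag_def if_distrib if_distribR cong: if_cong)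

lemma laplacian_component:
  fixes y :: "real^'q^'a::finite"
  shows "kron_id (laplacian E) y $ i = (\<Sum>j\<in>UNIV. adjacency E $ i $ j *\<^sub>R (y $ i - y $ j))"
proof -
  have "kron_id (laplacian E) y $ i = (\<Sum>j\<in>UNIV. (diag (\<chi> i. \<Sum>j\<in>UNIV. adjacency E $ i $ j) $ i $ j) *\<^sub>R y $ j)
      - (\<Sum>j\<in>UNIV. adjacency E $ i $ j *\<^sub>R y $ j)"
    by (simp add: kron_id_def laplacian_def scaleR_diff_left sum_subtractf)
  also have "(\<Sum>j\<in>UNIV. (diag (\<chi> i. \<Sum>j\<in>UNIV. adjacency E $ i $ j) $ i $ j) *\<^sub>R y $ j) = (\<Sum>j\<in>UNIV. adjacency E $ i $ j *\<^sub>R y $ i)"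
    by (simp add: diag_def if_distrib if_distribR scaleR_sum_left cong: if_cong)
  finally show ?thesis
    by (simp add: scaleR_diff_right sum_subtractf)
qed

context
  fixes E :: "('a::finite \<times> 'a) set"
  assumes symE: "sym E" and connected: "\<And>i j. (i, j) \<in> E\<^sup>*"
begin

abbreviation (input) L :: "real^'q^'a \<Rightarrow> real^'q^'a" where "L \<equiv> kron_id (laplacian E)"

text \<open>Exchanging the summation indices and averaging symmetrises the double sum.
  Self-adjointness and nonnegativity are then visible termwise.\<close>

lemma inner_laplacian:
  "y \<bullet> L z = (\<Sum>i\<in>UNIV. \<Sum>j\<in>UNIV. adjacency E $ i $ j * ((y $ i - y $ j) \<bullet> (z $ i - z $ j))) / 2"
proof -
  let ?a = "\<lambda>i j. adjacency E $ i $ j"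
  have a: "?a i j = ?a j i" for i j
    using symE by (auto simp: adjacency_def sym_def)
  have 1: "y \<bullet> L z = (\<Sum>i\<in>UNIV. \<Sum>j\<in>UNIV. ?a i j * (y $ i \<bullet> (z $ i - z $ j)))"
    by (simp add: inner_vec_def[of y] laplacian_component inner_sum_right)
  also have "\<dots> = (\<Sum>i\<in>UNIV. \<Sum>j\<in>UNIV. ?a j i * (y $ j \<bullet> (z $ j - z $ i)))"
    by (rule sum.swap)
  also have "\<dots> = (\<Sum>i\<in>UNIV. \<Sum>j\<in>UNIV. ?a i j * - (y $ j \<bullet> (z $ i - z $ j)))"
    by (intro sum.cong refl) (simp add: a inner_diff_right)
  finally have 2: "y \<bullet> L z = (\<Sum>i\<in>UNIV. \<Sum>j\<in>UNIV. ?a i j * - (y $ j \<bullet> (z $ i - z $ j)))" .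
  have "y \<bullet> L z + y \<bullet> L z = (\<Sum>i\<in>UNIV. \<Sum>j\<in>UNIV. ?a i j * ((y $ i - y $ j) \<bullet> (z $ i - z $ j)))"
    unfolding inner_diff_left by (subst 1, subst 2) (simp add: algebra_simps flip: sum.distrib)
  then show ?thesis by simp
qed

lemma laplacian_self_adjoint: "y \<bullet> L z = L y \<bullet> z"
  unfolding inner_commute[of "L y" z] inner_laplacian by (simp add: inner_commute)

lemma laplacian_nonneg: "y \<bullet> L y \<ge> 0"
  unfolding inner_laplacian by (intro divide_nonneg_nonneg sum_nonneg mult_nonneg_nonneg) (auto simp: adjacency_def)

lemma laplacian_kron_ones: "L (kron_ones v) = 0"
  by (simp add: vec_eq_iff laplacian_component kron_ones_def)

lemma laplacian_mem_perp: "L y \<in> consensus_perp"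
proof -
  have "v \<bullet> (\<Sum>i\<in>UNIV. L y $ i) = 0" for v
    using laplacian_self_adjoint[of "kron_ones v" y] by (simp add: inner_kron_ones laplacian_kron_ones)
  from this[of "\<Sum>i\<in>UNIV. L y $ i"] show ?thesis
    by (simp add: consensus_perp_def)
qed

text \<open>Every edge term of the symmetrised sum must vanish, and equality along edges propagates
  along paths.\<close>

lemma laplacian_form_zero:
  assumes "y \<bullet> L y = 0"
  shows "y = kron_ones (y $ i)"
proof -
  have nn: "adjacency E $ i $ j * ((y $ i - y $ j) \<bullet> (y $ i - y $ j)) \<ge> 0" for i j
    by (simp add: adjacency_def)
  have "(\<Sum>i\<in>UNIV. \<Sum>j\<in>UNIV. adjacency E $ i $ j * ((y $ i - y $ j) \<bullet> (y $ i - y $ j))) = 0"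
    using assms unfolding inner_laplacian by simp
  then have z: "adjacency E $ i $ j * ((y $ i - y $ j) \<bullet> (y $ i - y $ j)) = 0" for i j
    using nn by (simp add: sum_nonneg_eq_0_iff sum_nonneg del: mult_eq_0_iff)
  have edge: "y $ i = y $ j" if "(i, j) \<in> E" for i j
    using z[of i j] that by (simp add: adjacency_def)
  have "y $ j = y $ i" for j
    using connected[of i j] by (induction rule: rtrancl_induct) (use edge in auto)
  then show ?thesis
    by (simp add: vec_eq_iff[of y] kron_ones_def)
qed

text \<open>Adding the all-ones block operator removes the kernel: the map is positive definite and
  agrees with \<open>L\<close> on \<open>consensus_perp\<close>, so it can be inverted in place of
  \<open>L\<close>.\<close>

definition shifted_laplacian :: "real^'q^'a \<Rightarrow> real^'q^'a" where
  "shifted_laplacian y = L y + kron_ones (\<Sum>i\<in>UNIV. y $ i)"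

lemma linear_shifted_laplacian: "linear shifted_laplacian"
proof -
  have "linear (\<lambda>y. \<Sum>i\<in>UNIV. y $ i)"
    by (rule linearI) (simp_all add: sum.distrib flip: scaleR_sum_right)
  then show ?thesis
    unfolding shifted_laplacian_def
    using linear_compose_add[OF linear_kron_id linear_compose[OF _ linear_kron_ones]] by (simp add: o_def)
qed

lemma inner_shifted_laplacian:
  "y \<bullet> shifted_laplacian z = y \<bullet> L z + (\<Sum>i\<in>UNIV. y $ i) \<bullet> (\<Sum>i\<in>UNIV. z $ i)"
  using inner_kron_ones[of "\<Sum>i\<in>UNIV. z $ i" y]
  by (simp add: shifted_laplacian_def inner_add_right inner_commute)

lemma shifted_laplacian_positive:
  assumes "y \<noteq> 0"
  shows "y \<bullet> shifted_laplacian y > 0"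
proof (rule ccontr)
  assume "\<not> y \<bullet> shifted_laplacian y > 0"
  then have le: "y \<bullet> L y + (\<Sum>i\<in>UNIV. y $ i) \<bullet> (\<Sum>i\<in>UNIV. y $ i) \<le> 0"
    by (simp add: inner_shifted_laplacian)
  then have "(\<Sum>i\<in>UNIV. y $ i) \<bullet> (\<Sum>i\<in>UNIV. y $ i) \<le> 0"
    using laplacian_nonneg[of y] by linarith
  then have s: "(\<Sum>i\<in>UNIV. y $ i) = 0"
    by (rule inner_self_le_0D)
  then have "y \<bullet> L y = 0"
    using le laplacian_nonneg[of y] by simp
  then have y: "y = kron_ones (y $ i)" for i
    by (rule laplacian_form_zero)
  have "y $ i = 0" for i
  proof -
    have "real CARD('a) *\<^sub>R y $ i = (\<Sum>j\<in>(UNIV :: 'a set). kron_ones (y $ i) $ j)"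
      by (simp add: kron_ones_def sum_constant_scaleR del: sum_constant)
    also have "\<dots> = 0"
      using s y[of i] by simp
    finally show ?thesis by simp
  qed
  then show False
    using assms by (simp add: vec_eq_iff)
qed

lemma laplacian_coercive:
  obtains c where "c > 0" "\<And>y :: real^'q^'a. y \<in> consensus_perp \<Longrightarrow> c * (norm y)\<^sup>2 \<le> y \<bullet> L y"
proof -
  obtain c where c: "c > 0" "\<And>y :: real^'q^'a. y \<bullet> shifted_laplacian y \<ge> c * (norm y)\<^sup>2"
    using positive_definite_coercive[OF linear_shifted_laplacian shifted_laplacian_positive] by blast
  have "c * (norm y)\<^sup>2 \<le> y \<bullet> L y" if "y \<in> consensus_perp" for y :: "real^'q^'a"
    using c(2)[of y] that by (simp add: inner_shifted_laplacian consensus_perp_def)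
  then show thesis
    by (rule that[OF c(1)])
qed

lemma consensus_decomposition:
  fixes y :: "real^'q^'a"
  obtains m y' where "y = kron_ones m + y'" "y' \<in> consensus_perp"
proof
  show "y = kron_ones ((1 / real CARD('a)) *\<^sub>R (\<Sum>i\<in>UNIV. y $ i)) + (y - kron_ones ((1 / real CARD('a)) *\<^sub>R (\<Sum>i\<in>UNIV. y $ i)))"
    by simp
  show "y - kron_ones ((1 / real CARD('a)) *\<^sub>R (\<Sum>i\<in>UNIV. y $ i)) \<in> consensus_perp"
    by (simp add: consensus_perp_def kron_ones_def sum_subtractf sum_constant_scaleR del: sum_constant)
qed

text \<open>\<open>M\<close> is the inverse of the shifted Laplacian. It is positive definite on the
  whole space and acts on \<open>consensus_perp\<close> as the pseudoinverse of
  \<open>L\<close>.\<close>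

lemma laplacian_pseudoinverse:
  obtains M :: "real^'q^'a \<Rightarrow> real^'q^'a" and c where "linear M" "\<And>x y. x \<bullet> M y = M x \<bullet> y"
    "c > 0" "\<And>z. c * (norm z)\<^sup>2 \<le> z \<bullet> M z" "\<And>z l. z \<in> consensus_perp \<Longrightarrow> M z \<bullet> L l = z \<bullet> l"
proof -
  let ?A = "shifted_laplacian :: real^'q^'a \<Rightarrow> real^'q^'a"
  have inj: "inj ?A"
    unfolding linear_injective_0[OF linear_shifted_laplacian]
    using shifted_laplacian_positive by force
  then have surj: "surj ?A"
    using linear_injective_imp_surjective linear_shifted_laplacian by blast
  define M where "M = inv ?A"
  have AM: "?A (M x) = x" for x
    unfolding M_def using surj by (rule surj_f_inv_f)
  have MA: "M (?A x) = x" for x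
    unfolding M_def using inj by simp
  have lin: "linear M"
    unfolding M_def using inj linear_shifted_laplacian inj_linear_imp_inv_linear by blast
  have Asym: "x \<bullet> ?A y = ?A x \<bullet> y" for x y
    unfolding inner_commute[of "?A x" y] inner_shifted_laplacian
    using laplacian_self_adjoint[of x y] inner_commute[of "L x" y]
      inner_commute[of "\<Sum>i\<in>UNIV. x $ i" "\<Sum>i\<in>UNIV. y $ i"] by simp
  have Msym: "x \<bullet> M y = M x \<bullet> y" for x y
    using Asym[of "M x" "M y"] by (simp add: AM)
  have pos: "z \<bullet> M z > 0" if "z \<noteq> 0" for z
  proof -
    have "M z \<noteq> 0" using AM[of z] that linear_0[OF linear_shifted_laplacian] by metis
    then show ?thesis
      using shifted_laplacian_positive[of "M z"] by (simp add: AM inner_commute)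
  qed
  obtain c where c: "c > 0" "\<And>z. z \<bullet> M z \<ge> c * (norm z)\<^sup>2"
    using positive_definite_coercive[OF lin pos] by blast
  have MLap: "M z \<bullet> L l = z \<bullet> l" if z: "z \<in> consensus_perp" for z l
  proof -
    obtain m l' where l: "l = kron_ones m + l'" "l' \<in> consensus_perp"
      using consensus_decomposition[of l] by blast
    \<comment> \<open>\<open>L\<close> ignores the consensus part of \<open>l\<close>, and the added
      block ignores \<open>l'\<close>.\<close>
    have "L l = ?A l'"
      using l by (simp add: linear_add[OF linear_kron_id] laplacian_kron_ones shifted_laplacian_def consensus_perp_def
          linear_0[OF linear_kron_ones])
    then have "M z \<bullet> L l = z \<bullet> l'"
      using Msym[of z "?A l'"] by (simp add: MA)
    also have "\<dots> = z \<bullet> l"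
      using z inner_kron_ones[of m z] by (simp add: l inner_add_right consensus_perp_def inner_commute)
    finally show ?thesis .
  qed
  show thesis
    by (rule that[OF lin Msym c MLap])
qed

end

section \<open>Variational inequalities and multipliers\<close>

lemma has_derivative_direction:
  assumes "(h has_derivative h') (at x)"
  shows "((\<lambda>t. (h (x + t *\<^sub>R d) - h x) / t) \<longlongrightarrow> (h' d :: real)) (at_right 0)"
proof -
  have "((\<lambda>t. x + t *\<^sub>R d) has_vector_derivative d) (at 0)"
    by (auto intro!: derivative_eq_intros)
  then have "((\<lambda>t. h (x + t *\<^sub>R d)) has_real_derivative h' d) (at 0)"
    using has_real_derivative_compose_vector[of h h' "\<lambda>t. x + t *\<^sub>R d" 0] assms by simp
  then have "((\<lambda>t. (h (x + t *\<^sub>R d) - h x) / t) \<longlongrightarrow> h' d) (at 0)"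
    by (simp add: DERIV_def)
  then show ?thesis
    by (rule filterlim_at_split[THEN iffD1, THEN conjunct2])
qed

lemma convex_gradient_inequality:
  fixes h :: "'v::real_normed_vector \<Rightarrow> real"
  assumes "convex_on UNIV h" "(h has_derivative h') (at x)"
  shows "h x + h' (y - x) \<le> h y"
proof -
  have "\<forall>\<^sub>F t in at_right 0. (h (x + t *\<^sub>R (y - x)) - h x) / t \<le> h y - h x"
  proof (rule eventually_at_rightI[of 0 1])
    fix t :: real assume t: "t \<in> {0<..<1}"
    have "x + t *\<^sub>R (y - x) = (1 - t) *\<^sub>R x + t *\<^sub>R y"
      by (simp add: algebra_simps)
    then have "h (x + t *\<^sub>R (y - x)) \<le> (1 - t) * h x + t * h y"
      using convex_onD[OF assms(1), of t x y] t by simp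
    then have "h (x + t *\<^sub>R (y - x)) - h x \<le> t * (h y - h x)"
      by (simp add: algebra_simps)
    then show "(h (x + t *\<^sub>R (y - x)) - h x) / t \<le> h y - h x"
      using t by (simp add: divide_le_eq mult.commute)
  qed simp
  then have "h' (y - x) \<le> h y - h x"
    using tendsto_upperbound[OF has_derivative_direction[OF assms(2)]] by simp
  then show ?thesis by simp
qed

lemma minimum_directional_derivative_nonneg:
  fixes h :: "'v::real_normed_vector \<Rightarrow> real"
  assumes "convex S" "x \<in> S" "y \<in> S" "\<And>z. z \<in> S \<Longrightarrow> h x \<le> h z" "(h has_derivative h') (at x)"
  shows "0 \<le> h' (y - x)"
proof -
  have "\<forall>\<^sub>F t in at_right 0. 0 \<le> (h (x + t *\<^sub>R (y - x)) - h x) / t"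
  proof (rule eventually_at_rightI[of 0 1])
    fix t :: real assume t: "t \<in> {0<..<1}"
    have "x + t *\<^sub>R (y - x) = (1 - t) *\<^sub>R x + t *\<^sub>R y"
      by (simp add: algebra_simps)
    then have "x + t *\<^sub>R (y - x) \<in> S"
      using t by (simp add: convexD[OF assms(1-3)])
    then show "0 \<le> (h (x + t *\<^sub>R (y - x)) - h x) / t"
      using assms(4) t by simp
  qed simp
  then show ?thesis
    using tendsto_lowerbound[OF has_derivative_direction[OF assms(5)]] by simp
qed

lemma has_derivative_vec_lambda:
  fixes f :: "'i::finite \<Rightarrow> 'v::real_normed_vector \<Rightarrow> 'w::euclidean_space"
  assumes "\<And>i. (f i has_derivative f' i) (at x)"
  shows "((\<lambda>x. \<chi> i. f i x) has_derivative (\<lambda>h. \<chi> i. f' i h)) (at x)"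
  by (subst has_derivative_componentwise_within)
    (auto simp: Basis_vec_def inner_axis intro!: has_derivative_inner_left assms)

lemma grad_eq:
  assumes "(f has_derivative (\<lambda>h. D \<bullet> h)) (at x)"
  shows "grad f x = D"
  unfolding grad_def
proof (rule the_equality)
  show "GDERIV f x :> D"
    using assms by (simp add: gderiv_def inner_commute)
  fix D' assume "GDERIV f x :> D'"
  then have "(\<lambda>h. h \<bullet> D') = (\<lambda>h. D \<bullet> h)"
    using has_derivative_unique assms by (auto simp: gderiv_def)
  then show "D' = D"
    by (metis inner_commute vector_eq_ldot)
qed

lemma has_derivative_riesz:
  fixes f :: "'v::euclidean_space \<Rightarrow> real"
  assumes "(f has_derivative f') (at x)"
  obtains D where "f' = (\<lambda>h. D \<bullet> h)"
proof
  have "linear f'" using assms by (rule has_derivative_linear)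
  then show "f' = (\<lambda>h. adjoint f' 1 \<bullet> h)"
    using adjoint_works[of f' _ 1] by (auto simp: inner_commute)
qed

text \<open>Solutions are the fixed points of the projected gradient step, which is a contraction
  for a small step by strong monotonicity.\<close>

lemma variational_inequality_solution:
  fixes F :: "'v::euclidean_space \<Rightarrow> 'v"
  assumes K: "closed K" "convex K" "K \<noteq> {}" and "\<theta>-lipschitz_on UNIV F"
    and mono: "strongly_monotone \<mu> F" and "\<mu> > 0"
  obtains x where "x \<in> K" "\<And>y. y \<in> K \<Longrightarrow> 0 \<le> F x \<bullet> (y - x)"
proof -
  \<comment> \<open>The maximum ensures \<open>\<mu> \<le> L\<close>, so that the contraction factor
    below is nonnegative.\<close>
  define L where "L = max \<theta> \<mu>"
  have L: "L > 0" "\<mu> \<le> L" "norm (F x - F y) \<le> L * norm (x - y)" for x y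
  proof -
    have "norm (F x - F y) \<le> \<theta> * norm (x - y)"
      using assms(4) by (simp add: lipschitz_on_def dist_norm)
    also have "\<dots> \<le> L * norm (x - y)"
      by (intro mult_right_mono) (simp_all add: L_def)
    finally show "norm (F x - F y) \<le> L * norm (x - y)" .
  qed (use \<open>\<mu> > 0\<close> in \<open>simp_all add: L_def\<close>)
  \<comment> \<open>This step minimises the squared factor
    \<open>1 - 2 * \<tau> * \<mu> + \<tau>\<^sup>2 * L\<^sup>2\<close>, whose minimum is
    \<open>q\<close>.\<close>
  define \<tau> where "\<tau> = \<mu> / L\<^sup>2"
  define q where "q = 1 - (\<mu> / L)\<^sup>2"
  have q: "0 \<le> q" "q < 1"
    using \<open>\<mu> > 0\<close> L(1,2) by (simp_all add: q_def power_le_one)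
  have \<tau>: "\<tau> > 0" using \<open>\<mu> > 0\<close> L(1) by (simp add: \<tau>_def)
  let ?T = "\<lambda>x. closest_point K (x - \<tau> *\<^sub>R F x)"
  have "\<exists>!x\<in>K. ?T x = x"
  proof (rule Banach_fix[of K "sqrt q"])
    show "complete K" using K(1) by (simp add: complete_eq_closed)
    show "?T ` K \<subseteq> K" using closest_point_in_set[OF K(1,3)] by blast
    fix x y :: 'v
    let ?d = "x - y" and ?e = "F x - F y"
    have "(norm (?d - \<tau> *\<^sub>R ?e))\<^sup>2 = (norm ?d)\<^sup>2 - 2 * \<tau> * (?e \<bullet> ?d) + \<tau>\<^sup>2 * (norm ?e)\<^sup>2"
      by (simp only: power2_norm_eq_inner) (simp add: inner_diff_left inner_diff_right inner_commute power2_eq_square algebra_simps)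
    also have "\<dots> \<le> (norm ?d)\<^sup>2 - 2 * \<tau> * (\<mu> * (norm ?d)\<^sup>2) + \<tau>\<^sup>2 * (L * norm ?d)\<^sup>2"
      using mono \<tau> L(3)[of x y] unfolding strongly_monotone_def
      by (intro add_mono diff_mono mult_left_mono power_mono) auto
    also have "\<dots> = (1 - 2 * \<tau> * \<mu> + \<tau>\<^sup>2 * L\<^sup>2) * (norm ?d)\<^sup>2"
      by (simp add: algebra_simps power_mult_distrib)
    also have "1 - 2 * \<tau> * \<mu> + \<tau>\<^sup>2 * L\<^sup>2 = q"
      using L(1) by (simp add: \<tau>_def q_def field_simps power2_eq_square)
    finally have "norm (?d - \<tau> *\<^sub>R ?e) \<le> sqrt (q * (norm ?d)\<^sup>2)"
      by (rule real_le_rsqrt)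
    also have "\<dots> = sqrt q * norm ?d"
      by (simp add: real_sqrt_mult)
    finally have "norm ((x - \<tau> *\<^sub>R F x) - (y - \<tau> *\<^sub>R F y)) \<le> sqrt q * norm ?d"
      by (simp add: algebra_simps)
    then show "dist (?T x) (?T y) \<le> sqrt q * dist x y"
      using closest_point_lipschitz[OF K(2,1,3)] order_trans unfolding dist_norm by blast
  qed (use K q in auto)
  then obtain x where x: "x \<in> K" "?T x = x" by blast
  have "0 \<le> F x \<bullet> (y - x)" if "y \<in> K" for y
  proof -
    have "(x - \<tau> *\<^sub>R F x - x) \<bullet> (y - x) \<le> 0"
      using closest_point_dot[OF K(2,1) that, of "x - \<tau> *\<^sub>R F x"] x(2) by simp
    then show ?thesis
      using \<tau> by (simp add: zero_le_mult_iff)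
  qed
  then show thesis using that x(1) by blast
qed

text \<open>Lagrange duality for a linear objective: a hyperplane separates the origin from the
  upward closed set of attainable constraint and objective values, and a Slater point makes its
  objective coefficient nonzero.\<close>

lemma slater_multiplier:
  fixes G :: "'v::euclidean_space \<Rightarrow> real^'m::finite"
  assumes S: "convex S" "x \<in> S" and G: "\<And>j. convex_on UNIV (\<lambda>y. G y $ j)" and "G x \<le> 0"
    and slater: "y0 \<in> S" "\<And>j. G y0 $ j < 0"
    and opt: "\<And>y. y \<in> S \<Longrightarrow> G y \<le> 0 \<Longrightarrow> 0 \<le> p \<bullet> (y - x)"
  obtains l where "0 \<le> l" "l \<bullet> G x = 0" "\<And>y. y \<in> S \<Longrightarrow> 0 \<le> p \<bullet> (y - x) + l \<bullet> G y"
proof -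
  \<comment> \<open>The strict inequality in the objective value keeps the origin outside
    \<open>A\<close>, as optimality gives only a weak inequality.\<close>
  define A where "A = {(u, r). \<exists>y\<in>S. G y \<le> u \<and> p \<bullet> (y - x) < (r::real)}"
  have conv: "convex A"
  proof (rule convexI)
    fix a b :: "(real^'m) \<times> real" and s t :: real
    assume ab: "a \<in> A" "b \<in> A" and st: "0 \<le> s" "0 \<le> t" "s + t = 1"
    obtain y where y: "y \<in> S" "G y \<le> fst a" "p \<bullet> (y - x) < snd a" using ab(1) by (auto simp: A_def)
    obtain z where z: "z \<in> S" "G z \<le> fst b" "p \<bullet> (z - x) < snd b" using ab(2) by (auto simp: A_def)
    have "G (s *\<^sub>R y + t *\<^sub>R z) $ j \<le> s * fst a $ j + t * fst b $ j" for j
    proof -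
      have "G (s *\<^sub>R y + t *\<^sub>R z) $ j \<le> s * G y $ j + t * G z $ j"
        using G[of j] st by (auto simp: convex_on_def)
      also have "\<dots> \<le> s * fst a $ j + t * fst b $ j"
        using y(2) z(2) st by (intro add_mono mult_left_mono) (auto simp: less_eq_vec_def)
      finally show ?thesis .
    qed
    moreover have "p \<bullet> (s *\<^sub>R y + t *\<^sub>R z - x) < s * snd a + t * snd b"
    proof -
      have "x = s *\<^sub>R x + t *\<^sub>R x" using st by (simp flip: scaleR_add_left)
      then have "p \<bullet> (s *\<^sub>R y + t *\<^sub>R z - x) = s * (p \<bullet> (y - x)) + t * (p \<bullet> (z - x))"
        by (smt (verit) add_diff_add inner_add_right inner_scaleR_right scaleR_right_diff_distrib)
      also have "\<dots> < s * snd a + t * snd b"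
      proof (cases "s = 0")
        case False
        then show ?thesis
          using st y(3) z(3) by (intro add_less_le_mono mult_strict_left_mono mult_left_mono) auto
      qed (use st z in auto)
      finally show ?thesis .
    qed
    moreover have "s *\<^sub>R y + t *\<^sub>R z \<in> S"
      using convexD[OF S(1) y(1) z(1)] st by simp
    ultimately show "s *\<^sub>R a + t *\<^sub>R b \<in> A"
      by (auto simp: A_def less_eq_vec_def case_prod_unfold)
  qed
  have "0 \<notin> A"
    using opt by (force simp: A_def zero_prod_def)
  from separating_hyperplane_set_0[OF conv this]
  obtain lk where lk: "lk \<noteq> 0" "\<And>a. a \<in> A \<Longrightarrow> 0 \<le> lk \<bullet> a"
    by blast
  obtain l k where lkdef: "lk = (l, k)" by force
  have nn: "0 \<le> l \<bullet> u + k * r" if "y \<in> S" "G y \<le> u" "p \<bullet> (y - x) < r" for y u r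
    using lk(2)[of "(u, r)"] that by (auto simp: lkdef A_def)
  \<comment> \<open>An affine function bounded below on a half-line has nonnegative slope; upward
    closedness of \<open>A\<close> then yields nonnegative multipliers.\<close>
  have unbounded: "0 \<le> b" if "\<And>s. s \<ge> 0 \<Longrightarrow> 0 \<le> a + s * (b::real)" for a b
  proof (rule ccontr)
    assume "\<not> 0 \<le> b"
    then have "a + (\<bar>a\<bar> + 1) / - b * b < 0" by simp
    moreover have "(\<bar>a\<bar> + 1) / - b \<ge> 0" using \<open>\<not> 0 \<le> b\<close> by (intro divide_nonneg_pos) auto
    ultimately show False using that by fastforce
  qed
  have k: "k \<ge> 0"
  proof (rule unbounded)
    show "0 \<le> (l \<bullet> G x + k) + s * k" if "s \<ge> 0" for s
      using nn[OF S(2) order_refl, of "1 + s"] that by (simp add: algebra_simps)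
  qed
  have l: "l $ j \<ge> 0" for j
  proof (rule unbounded)
    show "0 \<le> (l \<bullet> G x + k) + s * l $ j" if "s \<ge> 0" for s
    proof -
      have "G x \<le> G x + s *\<^sub>R axis j 1"
        using that by (auto simp: less_eq_vec_def axis_def)
      then have "0 \<le> l \<bullet> (G x + s *\<^sub>R axis j 1) + k * 1"
        using S(2) by (intro nn) auto
      then show ?thesis
        by (simp add: inner_add_right inner_axis)
    qed
  qed
  \<comment> \<open>For \<open>k = 0\<close> the value at \<open>y0\<close> would be nonnegative,
    while every constraint there is strictly negative; then also \<open>l = 0\<close>, against a
    nonzero separating vector.\<close>
  have "k \<noteq> 0"
  proof
    assume "k = 0"
    then have "0 \<le> l \<bullet> G y0"
      using nn[OF slater(1) order_refl, of "p \<bullet> (y0 - x) + 1"] by simp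
    moreover have "l \<bullet> G y0 = (\<Sum>j\<in>UNIV. l $ j * G y0 $ j)"
      by (simp add: inner_vec_def)
    moreover have le: "l $ j * G y0 $ j \<le> 0" for j
      using l[of j] slater(2)[of j] by (simp add: mult_nonneg_nonpos)
    ultimately have "(\<Sum>j\<in>UNIV. - (l $ j * G y0 $ j)) = 0"
      using sum_nonpos[of UNIV "\<lambda>j. l $ j * G y0 $ j"] by (simp add: sum_negf)
    then have "l $ j * G y0 $ j = 0" for j
      using le by (subst (asm) sum_nonneg_eq_0_iff) auto
    then have "l = 0"
      using slater(2) by (metis less_irrefl mult_eq_0_iff vec_eq_iff zero_index)
    then show False using \<open>k = 0\<close> lk(1) lkdef by (simp add: zero_prod_def)
  qed
  then have k: "k > 0" using k by simp
  have main: "0 \<le> l \<bullet> G y + k * (p \<bullet> (y - x))" if "y \<in> S" for y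
  proof (rule field_le_epsilon)
    fix e :: real assume "e > 0"
    then show "0 \<le> l \<bullet> G y + k * (p \<bullet> (y - x)) + e"
      using nn[OF that order_refl, of "p \<bullet> (y - x) + e / k"] k by (simp add: algebra_simps)
  qed
  show thesis
  proof (rule that[of "l /\<^sub>R k"])
    show "0 \<le> l /\<^sub>R k" using l k by (simp add: less_eq_vec_def)
    show "0 \<le> p \<bullet> (y - x) + (l /\<^sub>R k) \<bullet> G y" if "y \<in> S" for y
      using main[OF that] k by (simp add: field_simps)
    have "l \<bullet> G x \<ge> 0" using main[OF S(2)] by simp
    moreover have "l \<bullet> G x \<le> 0"
      using l \<open>G x \<le> 0\<close> by (simp add: inner_vec_def less_eq_vec_def sum_nonpos mult_nonneg_nonpos)
    ultimately show "(l /\<^sub>R k) \<bullet> G x = 0" by simp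
  qed
qed

text \<open>The test points \<open>l + axis j 1\<close>, 0 and \<open>2 *\<^sub>R l\<close> extract
  the signs and the complementarity.\<close>

lemma mem_normal_cone_nonneg:
  fixes l :: "real^'m::finite"
  shows "v \<in> normal_cone {l. 0 \<le> l} l \<longleftrightarrow> 0 \<le> l \<and> v \<le> 0 \<and> l \<bullet> v = 0"
proof
  assume v: "v \<in> normal_cone {l. 0 \<le> l} l"
  then have l: "0 \<le> l" and le: "\<And>z. 0 \<le> z \<Longrightarrow> v \<bullet> (z - l) \<le> 0"
    by (auto simp: normal_cone_def)
  have "v $ j \<le> 0" for j
  proof -
    have "0 \<le> l + axis j 1"
      using l by (simp add: less_eq_vec_def axis_def)
    from le[OF this] show ?thesis by (simp add: inner_axis)
  qed
  moreover have "v \<bullet> l = 0"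
    using le[of 0] le[of "2 *\<^sub>R l"] l by (simp add: less_eq_vec_def scaleR_2)
  ultimately show "0 \<le> l \<and> v \<le> 0 \<and> l \<bullet> v = 0"
    using l by (simp add: less_eq_vec_def inner_commute)
next
  assume v: "0 \<le> l \<and> v \<le> 0 \<and> l \<bullet> v = 0"
  have "v \<bullet> z \<le> 0" if "0 \<le> z" for z
    using v that by (auto simp: inner_vec_def less_eq_vec_def intro!: sum_nonpos mult_nonpos_nonneg)
  then show "v \<in> normal_cone {l. 0 \<le> l} l"
    using v by (auto simp: normal_cone_def inner_diff_right inner_commute)
qed

section \<open>The game\<close>

lemma linear_blk: "linear (blk own i)"
  by (rule linearI) (simp_all add: blk_def vec_eq_iff)

lemma blk_mem_block_space: "blk own i x \<in> block_space own i"
  by (simp add: blk_def block_space_def)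

lemma repl_eq: "repl own i y x = blk own i y + (x - blk own i x)"
  by (simp add: repl_def blk_def vec_eq_iff)

lemma repl_self [simp]: "repl own i x x = x" "repl own i (blk own i x) x = x"
  by (simp_all add: repl_def blk_def vec_eq_iff)

lemma repl_blk: "repl own i (blk own i y) x = repl own i y x"
  by (simp add: repl_def blk_def vec_eq_iff)

lemma linear_select: "linear (select own)"
  by (rule linearI) (simp_all add: select_def vec_eq_iff)

lemma select_kron_ones [simp]: "select own (kron_ones x) = x"
  by (simp add: select_def kron_ones_def vec_eq_iff)

lemma inner_adjoint_select:
  "X \<bullet> adjoint (select own) v = select own X \<bullet> v"
  by (rule adjoint_works) (rule linear_select)

lemma coupling_eq_sum: "coupling own g x = (\<Sum>i\<in>UNIV. stacked_g own g x $ i)"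
  by (simp add: coupling_def stacked_g_def)

lemma convex_on_linear_image:
  assumes "convex_on S f" "linear A" "\<And>x. A x \<in> S"
  shows "convex_on UNIV (\<lambda>x. f (A x))"
  using assms by (auto simp: convex_on_def linear_add linear_cmul)

lemma convex_on_finite_sum:
  assumes "finite I" "convex S" "\<And>i. i \<in> I \<Longrightarrow> convex_on S (f i)"
  shows "convex_on S (\<lambda>x. \<Sum>i\<in>I. f i x)"
  using assms by (induction I) (auto intro: convex_on_add simp: convex_on_const)

lemma nonneg_set_eq: "{l::real^'m^'a. 0 \<le> l} = {l. \<forall>i j. 0 \<le> l $ i $ j}"
  by (simp add: less_eq_vec_def)

lemma closed_nonneg: "closed {l::real^'m^'a::finite. 0 \<le> l}"
  unfolding nonneg_set_eq by (intro closed_Collect_all closed_Collect_le continuous_intros)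

lemma convex_nonneg: "convex {l::real^'m^'a::finite. 0 \<le> l}"
  unfolding nonneg_set_eq by (auto intro!: convexI)

locale convex_game =
  fixes own :: "'n::finite \<Rightarrow> 'a::finite"
    and \<Omega> :: "'a \<Rightarrow> (real^'n) set"
    and g :: "'a \<Rightarrow> real^'n \<Rightarrow> real^'m::finite"
    and J :: "'a \<Rightarrow> real^'n \<Rightarrow> real"
    and \<mu> \<theta> :: real
  assumes \<Omega>_closed: "\<And>i. closed (\<Omega> i)"
    and \<Omega>_convex: "\<And>i. convex (\<Omega> i)"
    and g_convex: "\<And>i j. convex_on (block_space own i) (\<lambda>y. g i y $ j)"
    and g_C2: "\<And>i. C2 (\<lambda>x. g i (blk own i x))"
    and slater: "slater own \<Omega> g"
    and J_C1: "\<And>i. C1 (J i)"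
    and J_convex: "\<And>i x. convex_on (block_space own i) (\<lambda>y. J i (repl own i y x))"
    and \<mu>_pos: "\<mu> > 0"
    and strongly_monotone: "strongly_monotone \<mu> (pseudo_gradient own J)"
    and lipschitz: "\<theta>-lipschitz_on UNIV (pseudo_gradient own J)"
begin

abbreviation F :: "real^'n \<Rightarrow> real^'n" where "F \<equiv> pseudo_gradient own J"
abbreviation G :: "real^'n \<Rightarrow> real^'m^'a" where "G \<equiv> stacked_g own g"

text \<open>One derivative field, chosen together with its own continuous differentiability, from
  which local Lipschitz continuity of \<open>JT\<close> is drawn.\<close>

definition Dg :: "'a \<Rightarrow> real^'n \<Rightarrow> ((real^'n) \<Rightarrow>\<^sub>L (real^'m))" where
  "Dg i = (SOME f'. (\<forall>x. ((\<lambda>x. g i (blk own i x)) has_derivative blinfun_apply (f' x)) (at x)) \<and> C1 f')"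

lemma Dg: "((\<lambda>x. g i (blk own i x)) has_derivative blinfun_apply (Dg i x)) (at x)" "C1 (Dg i)"
  using someI_ex[OF g_C2[of i, unfolded C2_def]] unfolding Dg_def by blast+

definition JT :: "real^'n \<Rightarrow> real^'m^'a \<Rightarrow> real^'n" where
  "JT x \<Lambda> = adjoint (frechet_derivative G (at x)) \<Lambda>"

lemma G_has_derivative: "(G has_derivative (\<lambda>h. \<chi> i. Dg i x h)) (at x)"
  unfolding stacked_g_def by (intro has_derivative_vec_lambda Dg)

lemma inner_JT: "h \<bullet> JT x \<Lambda> = (\<Sum>i\<in>UNIV. Dg i x h \<bullet> \<Lambda> $ i)"
proof -
  have "h \<bullet> JT x \<Lambda> = (\<chi> i. Dg i x h) \<bullet> \<Lambda>"
    unfolding JT_def frechet_derivative_at[OF G_has_derivative, symmetric]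
    by (rule adjoint_works) (rule has_derivative_linear[OF G_has_derivative])
  then show ?thesis by (simp add: inner_vec_def[of "\<chi> i. Dg i x h"])
qed

lemma coupling_has_derivative: "(coupling own g has_derivative (\<lambda>h. \<Sum>i\<in>UNIV. Dg i x h)) (at x)"
  unfolding coupling_def by (intro has_derivative_sum Dg)

lemma adjoint_coupling: "adjoint (frechet_derivative (coupling own g) (at x)) l = JT x (kron_ones l)"
proof -
  have "h \<bullet> adjoint (frechet_derivative (coupling own g) (at x)) l = h \<bullet> JT x (kron_ones l)" for h
  proof -
    have "h \<bullet> adjoint (frechet_derivative (coupling own g) (at x)) l = (\<Sum>i\<in>UNIV. Dg i x h) \<bullet> l"
      unfolding frechet_derivative_at[OF coupling_has_derivative, symmetric]
      by (rule adjoint_works) (rule has_derivative_linear[OF coupling_has_derivative])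
    then show ?thesis
      by (simp add: inner_JT kron_ones_def inner_sum_left)
  qed
  then show ?thesis using vector_eq_ldot by blast
qed

lemma inner_kron_ones_G: "kron_ones l \<bullet> G x = l \<bullet> coupling own g x"
  by (simp add: inner_kron_ones coupling_eq_sum)

lemma g_convex_UNIV: "convex_on UNIV (\<lambda>x. g i (blk own i x) $ j)"
  by (rule convex_on_linear_image[OF g_convex linear_blk blk_mem_block_space])

text \<open>Convexity bounds each linearised component by the actual increment, and nonnegative
  multipliers preserve these inequalities when they are summed.\<close>

lemma JT_le:
  assumes "0 \<le> \<Lambda>"
  shows "JT x \<Lambda> \<bullet> (y - x) \<le> \<Lambda> \<bullet> (G y - G x)"
proof -
  have "Dg i x (y - x) $ j \<le> g i (blk own i y) $ j - g i (blk own i x) $ j" for i j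
  proof -
    have "((\<lambda>x. g i (blk own i x) $ j) has_derivative (\<lambda>h. Dg i x h $ j)) (at x)"
      by (rule bounded_linear.has_derivative[OF bounded_linear_vec_nth Dg(1)])
    from convex_gradient_inequality[OF g_convex_UNIV this, of y] show ?thesis by simp
  qed
  then have "Dg i x (y - x) $ j * \<Lambda> $ i $ j \<le> (g i (blk own i y) $ j - g i (blk own i x) $ j) * \<Lambda> $ i $ j" for i j
    using assms by (intro mult_right_mono) (simp_all add: less_eq_vec_def)
  then have "(\<Sum>i\<in>UNIV. Dg i x (y - x) \<bullet> \<Lambda> $ i) \<le> (\<Sum>i\<in>UNIV. (G y - G x) $ i \<bullet> \<Lambda> $ i)"
    by (intro sum_mono) (simp add: inner_vec_def stacked_g_def sum_mono)
  moreover have "(\<Sum>i\<in>UNIV. (G y - G x) $ i \<bullet> \<Lambda> $ i) = \<Lambda> \<bullet> (G y - G x)"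
    by (subst inner_commute, subst inner_vec_def) simp
  ultimately show ?thesis
    using inner_JT[of "y - x" x \<Lambda>] by (simp add: inner_commute)
qed

lemma prod_set_vimage: "prod_set own \<Omega> = (\<Inter>i. blk own i -` \<Omega> i)"
  by (auto simp: prod_set_def)

lemma closed_prod_set: "closed (prod_set own \<Omega>)"
  unfolding prod_set_vimage
  by (intro closed_INT ballI closed_vimage \<Omega>_closed linear_continuous_on linear_linear[THEN iffD2] linear_blk)

lemma convex_prod_set: "convex (prod_set own \<Omega>)"
  unfolding prod_set_vimage by (intro convex_INT convex_linear_vimage linear_blk \<Omega>_convex)

lemma closed_ext_set: "closed (ext_set own \<Omega>)"
proof -
  have "ext_set own \<Omega> = select own -` prod_set own \<Omega>" by (auto simp: ext_set_def)
  then show ?thesis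
    by (simp add: closed_vimage closed_prod_set linear_continuous_on linear_linear linear_select)
qed

lemma convex_ext_set: "convex (ext_set own \<Omega>)"
proof -
  have "ext_set own \<Omega> = select own -` prod_set own \<Omega>" by (auto simp: ext_set_def)
  then show ?thesis
    by (simp add: convex_linear_vimage convex_prod_set linear_select)
qed

lemma coupling_convex: "convex_on UNIV (\<lambda>x. coupling own g x $ j)"
  unfolding coupling_def sum_component
  by (intro convex_on_finite_sum g_convex_UNIV) auto

lemma closed_feasible: "closed (feasible own \<Omega> g)"
proof -
  have "continuous_on UNIV (coupling own g)"
    by (intro continuous_at_imp_continuous_on ballI has_derivative_continuous[OF coupling_has_derivative])
  then have "closed {x. \<forall>j. coupling own g x $ j \<le> 0}"
    by (intro closed_Collect_all closed_Collect_le continuous_intros) auto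
  then show ?thesis
    unfolding feasible_def using closed_prod_set by (intro closed_Int) (simp_all add: less_eq_vec_def)
qed

lemma convex_feasible: "convex (feasible own \<Omega> g)"
proof -
  have "convex {x. coupling own g x \<le> 0}"
  proof (rule convexI)
    fix x y and s t :: real
    assume "x \<in> {x. coupling own g x \<le> 0}" "y \<in> {x. coupling own g x \<le> 0}" "0 \<le> s" "0 \<le> t" "s + t = 1"
    then have le: "0 \<le> s" "0 \<le> t" "s + t = 1" "\<And>j. coupling own g x $ j \<le> 0" "\<And>j. coupling own g y $ j \<le> 0"
      by (simp_all add: less_eq_vec_def)
    have "coupling own g (s *\<^sub>R x + t *\<^sub>R y) $ j \<le> 0" for j
    proof -
      have "coupling own g (s *\<^sub>R x + t *\<^sub>R y) $ j \<le> s * coupling own g x $ j + t * coupling own g y $ j"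
        using coupling_convex[of j] le(1-3) by (simp add: convex_on_def)
      also have "\<dots> \<le> 0"
        using le by (intro add_nonpos_nonpos mult_nonneg_nonpos)
      finally show ?thesis .
    qed
    then show "s *\<^sub>R x + t *\<^sub>R y \<in> {x. coupling own g x \<le> 0}"
      by (simp add: less_eq_vec_def)
  qed
  then show ?thesis
    unfolding feasible_def by (intro convex_Int convex_prod_set)
qed

lemma partial_grad_has_derivative:
  "((\<lambda>y. J i (repl own i y x)) has_derivative (\<lambda>h. partial_grad own J i x \<bullet> h)) (at x)"
proof -
  obtain J' where J': "(J i has_derivative J') (at x)"
    using J_C1[of i] unfolding C1_def by blast
  have "((\<lambda>y. repl own i y x) has_derivative blk own i) (at x)"
    unfolding repl_eq
    by (intro has_derivative_add_const bounded_linear_imp_has_derivative linear_linear[THEN iffD2] linear_blk)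
  then have "((\<lambda>y. J i (repl own i y x)) has_derivative (\<lambda>h. J' (blk own i h))) (at x)"
    using has_derivative_compose[of "\<lambda>y. repl own i y x" "blk own i" x UNIV "J i" J'] J' by simp
  moreover obtain D where "(\<lambda>h. J' (blk own i h)) = (\<lambda>h. D \<bullet> h)"
    using has_derivative_riesz[OF calculation] by blast
  ultimately have D: "((\<lambda>y. J i (repl own i y x)) has_derivative (\<lambda>h. D \<bullet> h)) (at x)"
    by simp
  then show ?thesis
    unfolding partial_grad_def grad_eq[OF D] .
qed

lemma inner_pseudo_gradient_block:
  assumes "h \<in> block_space own i"
  shows "F x \<bullet> h = partial_grad own J i x \<bullet> h"
  unfolding inner_vec_def
  by (rule sum.cong) (use assms in \<open>auto simp: pseudo_gradient_def block_space_def\<close>)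

text \<open>Convexity is given on \<open>block_space own i\<close>; composing with
  \<open>blk\<close> carries it to the whole space without changing the function, as
  \<open>repl\<close> reads only block \<open>i\<close> of \<open>y\<close>.\<close>

lemma J_gradient_inequality:
  "J i x + F x \<bullet> (repl own i y x - x) \<le> J i (repl own i y x)"
proof -
  let ?\<phi> = "\<lambda>y. J i (repl own i y x)"
  have "convex_on UNIV (\<lambda>y. ?\<phi> (blk own i y))"
    by (rule convex_on_linear_image[OF J_convex linear_blk blk_mem_block_space])
  then have conv: "convex_on UNIV ?\<phi>"
    by (simp add: repl_blk)
  let ?z = "repl own i y x"
  have z: "?z - x \<in> block_space own i"
    by (simp add: repl_def block_space_def)
  have "?\<phi> x + partial_grad own J i x \<bullet> (?z - x) \<le> ?\<phi> ?z"
    by (rule convex_gradient_inequality[OF conv partial_grad_has_derivative])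
  moreover have "repl own i ?z x = ?z"
    by (simp add: repl_def vec_eq_iff)
  ultimately show ?thesis
    by (simp add: inner_pseudo_gradient_block[OF z])
qed

lemma kkt_iff:
  "kkt own \<Omega> g J x l \<longleftrightarrow> x \<in> prod_set own \<Omega> \<and>
     (\<forall>y\<in>prod_set own \<Omega>. 0 \<le> (F x + JT x (kron_ones l)) \<bullet> (y - x)) \<and>
     0 \<le> l \<and> coupling own g x \<le> 0 \<and> l \<bullet> coupling own g x = 0"
proof -
  have *: "0 \<in> (\<lambda>v. a + v) ` N \<longleftrightarrow> - a \<in> N" for a :: "real^'i" and N
    by (auto simp: image_iff add_eq_0_iff)
  have "kkt own \<Omega> g J x l \<longleftrightarrow>
      - (F x + JT x (kron_ones l)) \<in> normal_cone (prod_set own \<Omega>) x \<and>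
      coupling own g x \<in> normal_cone {l. 0 \<le> l} l"
    unfolding kkt_def adjoint_coupling * minus_minus ..
  then show ?thesis
    unfolding mem_normal_cone_nonneg
    unfolding normal_cone_def mem_Collect_eq inner_minus_left neg_le_0_iff_le by blast
qed

lemma kkt_feasible: "kkt own \<Omega> g J x l \<Longrightarrow> x \<in> feasible own \<Omega> g"
  by (simp add: kkt_iff feasible_def)

text \<open>Convexity turns the constraint gradient into a difference of constraint values;
  complementarity removes the value at \<open>x\<close>, and feasibility makes the one at
  \<open>y\<close> nonpositive.\<close>

lemma kkt_variational:
  assumes "kkt own \<Omega> g J x l" "y \<in> feasible own \<Omega> g"
  shows "0 \<le> F x \<bullet> (y - x)"
proof -
  have y: "y \<in> prod_set own \<Omega>" "coupling own g y \<le> 0"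
    using assms(2) by (auto simp: feasible_def)
  note k = assms(1)[unfolded kkt_iff]
  have "0 \<le> F x \<bullet> (y - x) + JT x (kron_ones l) \<bullet> (y - x)"
    using k y(1) by (auto simp: inner_add_left)
  also have "JT x (kron_ones l) \<bullet> (y - x) \<le> kron_ones l \<bullet> (G y - G x)"
    using k by (intro JT_le) (simp add: kron_ones_def less_eq_vec_def)
  also have "\<dots> = l \<bullet> coupling own g y"
    using k by (simp add: inner_diff_right inner_kron_ones_G)
  also have "\<dots> \<le> 0"
    using k y(2) by (auto simp: inner_vec_def less_eq_vec_def intro!: sum_nonpos mult_nonneg_nonpos)
  finally show ?thesis by simp
qed

lemma gne_of_kkt:
  assumes "kkt own \<Omega> g J x l"
  shows "gne own \<Omega> g J x"
  unfolding gne_def is_arg_min_def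
proof (intro allI conjI)
  fix i
  show "blk own i x \<in> block_space own i" "repl own i (blk own i x) x \<in> feasible own \<Omega> g"
    using kkt_feasible[OF assms] by (simp_all add: blk_mem_block_space)
  have "J i x \<le> J i (repl own i y x)" if "repl own i y x \<in> feasible own \<Omega> g" for y
    using J_gradient_inequality[of i x y] kkt_variational[OF assms that] by simp
  then show "\<not> (\<exists>y. (y \<in> block_space own i \<and> repl own i y x \<in> feasible own \<Omega> g) \<and>
      J i (repl own i y x) < J i (repl own i (blk own i x) x))"
    by fastforce
qed

text \<open>Each point tests the variational inequality of the other, and strong monotonicity closes
  the gap. The multipliers may still differ.\<close>

lemma kkt_unique:
  assumes "kkt own \<Omega> g J x l" "kkt own \<Omega> g J y l'"
  shows "x = y"
proof -
  have "\<mu> * (norm (x - y))\<^sup>2 \<le> (F x - F y) \<bullet> (x - y)"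
    using strongly_monotone by (simp add: strongly_monotone_def)
  also have "\<dots> \<le> 0"
    using kkt_variational[OF assms(1) kkt_feasible[OF assms(2)]]
      kkt_variational[OF assms(2) kkt_feasible[OF assms(1)]]
    by (simp add: inner_diff_left inner_diff_right)
  finally show ?thesis
    using \<mu>_pos by (simp add: mult_le_0_iff)
qed

text \<open>A solution \<open>x\<close> of the variational inequality on the feasible set minimises
  the linear function with gradient \<open>F x\<close> there, so a Slater multiplier exists for this
  linear program with convex constraints.\<close>

lemma kkt_exists:
  obtains x l where "kkt own \<Omega> g J x l"
proof -
  obtain y0 where y0: "y0 \<in> prod_set own \<Omega>" "\<And>j. coupling own g y0 $ j < 0"
    using slater by (auto simp: slater_def)
  then have "feasible own \<Omega> g \<noteq> {}"
    by (auto simp: feasible_def less_eq_vec_def intro: less_imp_le)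
  then obtain x where x: "x \<in> feasible own \<Omega> g" "\<And>y. y \<in> feasible own \<Omega> g \<Longrightarrow> 0 \<le> F x \<bullet> (y - x)"
    using variational_inequality_solution[OF closed_feasible convex_feasible _ lipschitz strongly_monotone \<mu>_pos]
    by blast
  have xp: "x \<in> prod_set own \<Omega>" "coupling own g x \<le> 0"
    using x(1) by (auto simp: feasible_def)
  have opt: "0 \<le> F x \<bullet> (y - x)" if "y \<in> prod_set own \<Omega>" "coupling own g y \<le> 0" for y
    using that by (intro x(2)) (simp add: feasible_def)
  obtain l where l: "0 \<le> l" "l \<bullet> coupling own g x = 0"
    "\<And>y. y \<in> prod_set own \<Omega> \<Longrightarrow> 0 \<le> F x \<bullet> (y - x) + l \<bullet> coupling own g y"
    using slater_multiplier[OF convex_prod_set xp(1) coupling_convex xp(2) y0 opt] by blast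
  \<comment> \<open>The multiplier makes \<open>x\<close> a minimiser of this Lagrangian over
    \<open>prod_set own \<Omega>\<close>, with value 0; its directional derivatives at
    \<open>x\<close> give the stationarity condition.\<close>
  have der: "((\<lambda>y. F x \<bullet> (y - x) + l \<bullet> coupling own g y) has_derivative
      (\<lambda>h. F x \<bullet> h + l \<bullet> (\<Sum>i\<in>UNIV. Dg i x h))) (at x)"
    by (auto intro!: derivative_eq_intros coupling_has_derivative)
  have "0 \<le> (F x + JT x (kron_ones l)) \<bullet> (y - x)" if y: "y \<in> prod_set own \<Omega>" for y
  proof -
    have "0 \<le> F x \<bullet> (y - x) + l \<bullet> (\<Sum>i\<in>UNIV. Dg i x (y - x))"
      by (rule minimum_directional_derivative_nonneg[OF convex_prod_set xp(1) y _ der]) (simp add: l)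
    also have "l \<bullet> (\<Sum>i\<in>UNIV. Dg i x (y - x)) = (y - x) \<bullet> JT x (kron_ones l)"
      by (simp add: inner_JT kron_ones_def inner_sum_right inner_commute)
    finally show ?thesis by (simp add: inner_add_left inner_commute[of "y - x"])
  qed
  then have "kkt own \<Omega> g J x l"
    unfolding kkt_iff using l xp by blast
  then show thesis by (rule that)
qed

end

section \<open>The closed-loop system\<close>

lemma lob_lipschitz:
  assumes "C-lipschitz_on UNIV f"
  shows "lipschitz_on_bounded f"
proof (rule lipschitz_on_boundedI)
  show "\<exists>K\<ge>0. \<forall>x\<in>cball 0 R. \<forall>y\<in>cball 0 R. norm (f x - f y) \<le> K * norm (x - y)" for R
    using assms by (intro exI[of _ C]) (auto simp: lipschitz_on_def dist_norm)
qed

lemma linear_block_diag: "linear (block_diag \<rho>)"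
  by (rule linearI) (simp_all add: block_diag_def vec_eq_iff scaleR_add_left)

lemma adjoint_block_diag: "adjoint (block_diag \<rho>) y = (\<chi> i. \<rho> $ i \<bullet> y $ i)"
proof -
  have "k \<bullet> adjoint (block_diag \<rho>) y = k \<bullet> (\<chi> i. \<rho> $ i \<bullet> y $ i)" for k
    unfolding adjoint_works[OF linear_block_diag]
    by (simp only: inner_vec_def[of "block_diag \<rho> k"] inner_vec_def[of k]) (simp add: block_diag_def)
  then show ?thesis using vector_eq_ldot by blast
qed

lemma power2_norm_vec: "(norm x)\<^sup>2 = (\<Sum>i\<in>UNIV. (norm (x $ i))\<^sup>2)"
  by (simp add: norm_vec_def L2_set_def sum_nonneg)

lemma norm_select_le: "norm (select own Y) \<le> norm Y"
proof (rule power2_le_imp_le)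
  have "(norm (select own Y))\<^sup>2 = (\<Sum>c\<in>UNIV. (Y $ own c $ c)\<^sup>2)"
    by (simp add: power2_norm_vec select_def)
  also have "\<dots> \<le> (\<Sum>c\<in>UNIV. \<Sum>i\<in>UNIV. (Y $ i $ c)\<^sup>2)"
    by (intro sum_mono member_le_sum) auto
  also have "\<dots> = (\<Sum>i\<in>UNIV. \<Sum>c\<in>UNIV. (Y $ i $ c)\<^sup>2)"
    by (rule sum.swap)
  also have "\<dots> = (norm Y)\<^sup>2"
    by (simp add: power2_norm_vec)
  finally show "(norm (select own Y))\<^sup>2 \<le> (norm Y)\<^sup>2" .
qed simp

lemma ext_pseudo_gradient_eq:
  "ext_pseudo_gradient own J X = select own (\<chi> i. pseudo_gradient own J (X $ i))"
  by (simp add: ext_pseudo_gradient_def select_def pseudo_gradient_def vec_eq_iff)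

lemma norm_vec_le:
  fixes x :: "'w::real_normed_vector^'i::finite" and y :: "'u::real_normed_vector^'i"
  assumes "\<And>i. norm (x $ i) \<le> c * norm (y $ i)" "c \<ge> 0"
  shows "norm x \<le> c * norm y"
  unfolding norm_vec_def L2_set_right_distrib[OF assms(2)]
  by (rule L2_set_mono) (use assms in auto)

locale adaptive_game = convex_game own \<Omega> g J \<mu> \<theta>
  for own :: "'n::finite \<Rightarrow> 'a::finite" and \<Omega> and g :: "'a \<Rightarrow> real^'n \<Rightarrow> real^'m::finite" and J \<mu> \<theta> +
  fixes E :: "('a \<times> 'a) set" and \<gamma> :: "real^'a"
  assumes symE: "sym E" and connected: "\<And>i j. (i, j) \<in> E\<^sup>*" and \<gamma>_pos: "\<And>i. \<gamma> $ i > 0"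
begin

abbreviation L :: "real^'q::finite^'a \<Rightarrow> real^'q^'a" where "L \<equiv> kron_id (laplacian E)"
abbreviation S :: "('n, 'm, 'a) state set" where "S \<equiv> state_set own \<Omega>"
abbreviation CL :: "('n, 'm, 'a) state \<Rightarrow> ('n, 'm, 'a) state" where
  "CL \<equiv> closed_loop own \<Omega> g J E \<gamma>"

lemmas L_self_adjoint = laplacian_self_adjoint[OF symE connected]
lemmas L_nonneg = laplacian_nonneg[OF symE connected]
lemmas L_kron_ones = laplacian_kron_ones[OF symE connected]
lemmas L_mem_perp = laplacian_mem_perp[OF symE connected]
lemmas L_form_zero = laplacian_form_zero[OF symE connected]

definition drift_x :: "real^'n^'a \<Rightarrow> real^'a \<Rightarrow> real^'m^'a \<Rightarrow> real^'n^'a" where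
  "drift_x X k \<Lambda> = - adjoint (select own) (ext_pseudo_gradient own J X + JT (select own X) \<Lambda>)
     - L (kron_id (diag k) (L X))"

definition drift_k :: "real^'n^'a \<Rightarrow> real^'a" where
  "drift_k X = (\<chi> i. \<gamma> $ i * (L X $ i \<bullet> L X $ i))"

definition drift_l :: "real^'n^'a \<Rightarrow> real^'m^'a \<Rightarrow> real^'m^'a \<Rightarrow> real^'m^'a" where
  "drift_l X Z \<Lambda> = G (select own X) - Z - L \<Lambda>"

definition drift :: "('n, 'm, 'a) state \<Rightarrow> ('n, 'm, 'a) state" where
  "drift w = (drift_x (fst w) (fst (snd w)) (snd (snd (snd w))), drift_k (fst w), L (snd (snd (snd w))),
     drift_l (fst w) (fst (snd (snd w))) (snd (snd (snd w))))"

lemma closed_loop_eq: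
  "CL (X, k, Z, \<Lambda>) =
    (proj_tangent (ext_set own \<Omega>) X (drift_x X k \<Lambda>), drift_k X, L \<Lambda>,
     proj_tangent {l. 0 \<le> l} \<Lambda> (drift_l X Z \<Lambda>))"
  by (simp add: closed_loop_def Let_def drift_x_def drift_k_def drift_l_def JT_def adjoint_block_diag
      kron_id_diag)

lemma mem_S: "(X, k, Z, \<Lambda>) \<in> S \<longleftrightarrow> X \<in> ext_set own \<Omega> \<and> Z \<in> consensus_perp \<and> 0 \<le> \<Lambda>"
  by (simp add: state_set_def)

lemma closed_S: "closed S"
  unfolding state_set_def
  by (intro closed_Times closed_ext_set closed_UNIV closed_nonneg closed_subspace subspace_consensus_perp)

lemma convex_S: "convex S"
  unfolding state_set_def
  by (intro convex_Times convex_ext_set convex_UNIV convex_nonneg subspace_imp_convex subspace_consensus_perp)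

text \<open>Projection is trivial in the \<open>k\<close> block, which is unconstrained, and in the
  \<open>z\<close> block, whose velocity already lies in the subspace \<open>consensus_perp\<close>.
  So the closed loop is one projected field on the convex set \<open>S\<close>.\<close>

lemma closed_loop_eq_proj:
  assumes "w \<in> S"
  shows "CL w = proj_tangent S w (drift w)"
proof -
  obtain X k Z \<Lambda> where w: "w = (X, k, Z, \<Lambda>)" by (cases w)
  have m: "X \<in> ext_set own \<Omega>" "Z \<in> consensus_perp" "0 \<le> \<Lambda>"
    using assms by (simp_all add: w mem_S)
  have cP: "convex (consensus_perp :: (real^'m^'a) set)"
    by (rule subspace_imp_convex[OF subspace_consensus_perp])
  let ?N = "{l. 0 \<le> l} :: (real^'m^'a) set"
  note [simp] = proj_tangent_Times[OF convex_ext_set convex_Times[OF convex_UNIV convex_Times[OF cP convex_nonneg]]]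
    proj_tangent_Times[OF convex_UNIV convex_Times[OF cP convex_nonneg]] proj_tangent_Times[OF cP convex_nonneg]
  have "proj_tangent S w (drift w) = (proj_tangent (ext_set own \<Omega>) X (drift_x X k \<Lambda>),
      proj_tangent UNIV k (drift_k X), proj_tangent consensus_perp Z (L \<Lambda>),
      proj_tangent ?N \<Lambda> (drift_l X Z \<Lambda>))"
    unfolding w state_set_def drift_def fst_conv snd_conv
    using m by simp
  then show ?thesis
    by (simp add: w closed_loop_eq proj_tangent_UNIV proj_tangent_subspace[OF subspace_consensus_perp L_mem_perp m(2)])
qed

lemma lob_F: "lipschitz_on_bounded f \<Longrightarrow> lipschitz_on_bounded (\<lambda>x. F (f x))"
  by (rule lob_compose[OF lob_lipschitz[OF lipschitz]])

text \<open>Second derivatives of the constraints enter here: the Jacobian must itself be locally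
  Lipschitz for the closed loop to be so.\<close>

lemma lob_Dg: "lipschitz_on_bounded f \<Longrightarrow> lipschitz_on_bounded (\<lambda>x. blinfun_apply (Dg i (f x)) v)"
  by (rule lob_compose[OF lob_bounded_linear[OF blinfun.bounded_linear_left]], rule lob_compose[OF lob_C1[OF Dg(2)]])

lemma lob_G:
  assumes "lipschitz_on_bounded f"
  shows "lipschitz_on_bounded (\<lambda>x. G (f x))"
proof -
  have "continuous_on UNIV (Dg i)" for i
    using Dg(2)[of i] unfolding C1_def
    by (metis continuous_at_imp_continuous_on has_derivative_continuous)
  then have "C1 (\<lambda>x. g i (blk own i x))" for i
    unfolding C1_def using Dg(1)[of i] by blast
  then show ?thesis
    unfolding stacked_g_def by (intro lob_intros lob_compose[OF lob_C1 assms])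
qed

lemma JT_component: "JT x \<Lambda> $ c = (\<Sum>i\<in>UNIV. Dg i x (axis c 1) \<bullet> \<Lambda> $ i)"
  unfolding inner_JT[symmetric] by (simp add: inner_axis')

lemma lob_JT:
  assumes "lipschitz_on_bounded f" "lipschitz_on_bounded h"
  shows "lipschitz_on_bounded (\<lambda>x. JT (f x) (h x))"
proof -
  have "JT x \<Lambda> = (\<chi> c. \<Sum>i\<in>UNIV. Dg i x (axis c 1) \<bullet> \<Lambda> $ i)" for x \<Lambda>
    by (simp add: vec_eq_iff JT_component)
  then show ?thesis
    by (simp only:) (intro lob_intros lob_Dg assms)
qed

lemmas lob_L = lob_compose[OF lob_linear[OF linear_kron_id]]
lemmas lob_select = lob_compose[OF lob_linear[OF linear_select]]

lemma lob_drift_x: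
  assumes "lipschitz_on_bounded X" "lipschitz_on_bounded k" "lipschitz_on_bounded \<Lambda>"
  shows "lipschitz_on_bounded (\<lambda>w. drift_x (X w) (k w) (\<Lambda> w))"
proof -
  have "lipschitz_on_bounded (\<lambda>w. ext_pseudo_gradient own J (X w))"
    unfolding ext_pseudo_gradient_eq by (intro lob_select lob_vec_lambda lob_F lob_vec_nth assms)
  moreover have "lipschitz_on_bounded (\<lambda>w. JT (select own (X w)) (\<Lambda> w))"
    by (intro lob_JT lob_select assms)
  moreover have "lipschitz_on_bounded (\<lambda>w. kron_id (diag (k w)) (L (X w)))"
  proof -
    have "kron_id (diag (k w)) (L (X w)) = (\<chi> i. k w $ i *\<^sub>R L (X w) $ i)" for w
      by (simp add: vec_eq_iff kron_id_diag)
    then show ?thesis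
      by (simp only:) (intro lob_intros lob_L assms)
  qed
  ultimately show ?thesis
    unfolding drift_x_def
    by (intro lob_diff lob_minus lob_L lob_compose[OF lob_linear[OF adjoint_linear[OF linear_select]]] lob_add)
qed

lemma lob_drift: "lipschitz_on_bounded drift"
  unfolding drift_def drift_k_def drift_l_def
  by (intro lob_intros lob_drift_x lob_L lob_G lob_select)

text \<open>The last clause is stationarity of the projected multiplier equation at consensus:
  \<open>Z\<close> redistributes the coupling constraint so that every agent's share is
  complementary to the common \<open>l\<close>.\<close>

definition equilibrium :: "real^'n \<Rightarrow> real^'m \<Rightarrow> real^'m^'a \<Rightarrow> bool" where
  "equilibrium x l Z \<longleftrightarrow> kkt own \<Omega> g J x l \<and> Z \<in> consensus_perp \<and>
     (\<forall>i. G x $ i - Z $ i \<le> 0 \<and> l \<bullet> (G x $ i - Z $ i) = 0)"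

text \<open>The witness gives each agent the equal share \<open>coupling own g x\<close> divided by
  the number of agents, so signs and complementarity carry over from the KKT conditions.\<close>

lemma equilibrium_exists:
  assumes "kkt own \<Omega> g J x l"
  obtains Z where "equilibrium x l Z"
proof
  let ?N = "real CARD('a)"
  let ?Z = "G x - kron_ones ((1 / ?N) *\<^sub>R coupling own g x)"
  have "?Z \<in> consensus_perp"
    by (simp add: consensus_perp_def kron_ones_def sum_subtractf coupling_eq_sum sum_constant_scaleR del: sum_constant)
  then show "equilibrium x l ?Z"
    using assms by (simp add: equilibrium_def kkt_iff kron_ones_def less_eq_vec_def divide_nonpos_pos)
qed

lemma drift_x_consensus:
  "drift_x (kron_ones x) k \<Lambda> = - adjoint (select own) (F x + JT x \<Lambda>)"
proof -
  have "ext_pseudo_gradient own J (kron_ones x) = F x"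
    unfolding ext_pseudo_gradient_eq by (simp add: kron_ones_def select_def vec_eq_iff)
  then show ?thesis
    by (simp add: drift_x_def L_kron_ones linear_0[OF linear_kron_id])
qed

lemma kron_ones_nonneg: "0 \<le> kron_ones l \<longleftrightarrow> 0 \<le> l"
  by (simp add: kron_ones_def less_eq_vec_def)

lemma kron_ones_mem_ext_set: "kron_ones x \<in> ext_set own \<Omega> \<longleftrightarrow> x \<in> prod_set own \<Omega>"
  by (simp add: ext_set_def)

lemma equilibrium_stationary:
  assumes "equilibrium x l Z"
  shows "CL (kron_ones x, k, Z, kron_ones l) = 0"
proof -
  have kkt: "kkt own \<Omega> g J x l" and c: "\<And>i. G x $ i - Z $ i \<le> 0" "\<And>i. l \<bullet> (G x $ i - Z $ i) = 0"
    using assms by (auto simp: equilibrium_def)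
  have cc: "(G x $ i - Z $ i) \<bullet> l = 0" for i
    using c(2)[of i] by (simp only: inner_commute)
  note k = kkt[unfolded kkt_iff]
  have X: "kron_ones x \<in> ext_set own \<Omega>" using k by (simp add: kron_ones_mem_ext_set)
  have "drift_x (kron_ones x) k (kron_ones l) \<in> normal_cone (ext_set own \<Omega>) (kron_ones x)"
    unfolding normal_cone_def
  proof (intro CollectI conjI ballI X)
    fix Y assume "Y \<in> ext_set own \<Omega>"
    then have "0 \<le> (F x + JT x (kron_ones l)) \<bullet> (select own Y - x)"
      using k by (simp add: ext_set_def)
    then show "drift_x (kron_ones x) k (kron_ones l) \<bullet> (Y - kron_ones x) \<le> 0"
      by (simp add: drift_x_consensus inner_commute[of "adjoint _ _"] inner_adjoint_select
          linear_diff[OF linear_select] inner_commute[of "select own Y - x"])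
  qed
  moreover have "G x - Z \<in> normal_cone {l. 0 \<le> l} (kron_ones l)"
    unfolding normal_cone_def
  proof (intro CollectI conjI ballI)
    show "0 \<le> kron_ones l" using k by (simp add: kron_ones_nonneg)
    fix z :: "real^'m^'a" assume z: "z \<in> {l. 0 \<le> l}"
    have "(G x - Z) \<bullet> (z - kron_ones l) = (\<Sum>i\<in>UNIV. (G x $ i - Z $ i) \<bullet> z $ i)"
      by (subst inner_vec_def, rule sum.cong) (simp_all add: inner_diff_right[of "G x $ _ - Z $ _"] kron_ones_def cc)
    also have "\<dots> \<le> 0"
    proof (rule sum_nonpos)
      fix i
      show "(G x $ i - Z $ i) \<bullet> z $ i \<le> 0"
        using c(1)[of i] z by (auto simp: inner_vec_def less_eq_vec_def intro!: sum_nonpos mult_nonpos_nonneg)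
    qed
    finally show "(G x - Z) \<bullet> (z - kron_ones l) \<le> 0" .
  qed
  moreover have "(0 :: real^'m^'a) \<le> kron_ones l" using k by (simp add: kron_ones_nonneg)
  moreover have "drift_k (kron_ones x) = 0"
    by (simp add: drift_k_def L_kron_ones vec_eq_iff)
  moreover have "drift_l (kron_ones x) Z (kron_ones l) = G x - Z"
    by (simp add: drift_l_def L_kron_ones)
  ultimately show ?thesis
    unfolding closed_loop_eq
    using proj_tangent_eq_0_iff[OF convex_ext_set X] proj_tangent_eq_0_iff[OF convex_nonneg, of "kron_ones l :: real^'m^'a"]
    by (simp add: L_kron_ones zero_prod_def)
qed

text \<open>Write \<open>X\<close> as consensus \<open>y\<close> plus disagreement \<open>Y\<close>.
  Strong monotonicity acts on \<open>y - x\<close>; all remaining terms carry a factor of the size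
  of \<open>Y\<close>, which \<open>L X\<close> controls through the coercivity constant
  \<sigma>.\<close>

lemma restricted_monotonicity:
  obtains \<kappa> c where "c > 0" "\<And>X x. c * (norm (X - kron_ones x))\<^sup>2 \<le>
    (select own X - x) \<bullet> (ext_pseudo_gradient own J X - F x) + \<kappa> * (norm (L X))\<^sup>2"
proof -
  obtain \<sigma> where \<sigma>: "\<sigma> > 0" "\<And>Y :: real^'n^'a. Y \<in> consensus_perp \<Longrightarrow> \<sigma> * (norm Y)\<^sup>2 \<le> Y \<bullet> L Y"
    using laplacian_coercive[OF symE connected] by blast
  have \<theta>: "\<theta> \<ge> 0" using lipschitz by (rule lipschitz_on_nonneg)
  define N where "N = real CARD('a)"
  have N: "N > 0" by (simp add: N_def)
  \<comment> \<open>The summand \<open>2 * \<theta>\<^sup>2 / \<mu>\<close> pays for the mixed terms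
    after Young's inequality, \<theta> for the term quadratic in \<open>Y\<close>, and 1 leaves a
    positive square of \<open>Y\<close>; \<sigma> converts from \<open>Y\<close> to
    \<open>L X\<close>.\<close>
  define \<kappa> where "\<kappa> = (2 * \<theta>\<^sup>2 / \<mu> + \<theta> + 1) / \<sigma>\<^sup>2"
  \<comment> \<open>By orthogonality the squared distance to \<open>kron_ones x\<close> is
    \<open>N * a\<^sup>2 + b\<^sup>2\<close>, against which
    \<open>\<mu> / 2 * a\<^sup>2 + b\<^sup>2\<close> is available.\<close>
  define c where "c = min (\<mu> / (2 * N)) 1"
  have c: "c > 0" "c * N \<le> \<mu> / 2" "c \<le> 1"
  proof -
    have "c * N \<le> \<mu> / (2 * N) * N" using N by (intro mult_right_mono) (auto simp: c_def)
    then show "c * N \<le> \<mu> / 2" using N by simp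
  qed (use \<mu>_pos N in \<open>auto simp: c_def\<close>)
  have "c * (norm (X - kron_ones x))\<^sup>2 \<le>
      (select own X - x) \<bullet> (ext_pseudo_gradient own J X - F x) + \<kappa> * (norm (L X))\<^sup>2" for X x
  proof -
    obtain y Y where X: "X = kron_ones y + Y" and Y: "Y \<in> consensus_perp"
      using consensus_decomposition[OF symE connected, of X] by blast
    define u a b where "u = y - x" and "a = norm u" and "b = norm Y"
    define d where "d = ext_pseudo_gradient own J X - F y"
    have ab: "a \<ge> 0" "b \<ge> 0" by (simp_all add: a_def b_def)
    have FL: "norm (F p - F q) \<le> \<theta> * norm (p - q)" for p q
      using lipschitz by (simp add: lipschitz_on_def dist_norm)
    have "d = select own (\<chi> i. F (X $ i) - F y)"
      by (simp add: d_def ext_pseudo_gradient_eq select_def vec_eq_iff)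
    then have "norm d \<le> norm (\<chi> i. F (X $ i) - F y)"
      by (simp add: norm_select_le)
    also have "\<dots> \<le> \<theta> * norm Y"
    proof (rule norm_vec_le[OF _ \<theta>])
      show "norm ((\<chi> i. F (X $ i) - F y) $ i) \<le> \<theta> * norm (Y $ i)" for i
        using FL[of "X $ i" y] by (simp add: X kron_ones_def)
    qed
    finally have d: "norm d \<le> \<theta> * b" by (simp add: b_def)
    have sY: "norm (select own Y) \<le> b" by (simp add: b_def norm_select_le)
    have sX: "select own X - x = u + select own Y"
      by (simp add: X linear_add[OF linear_select] u_def)
    have 1: "u \<bullet> (F y - F x) \<ge> \<mu> * a\<^sup>2"
      using strongly_monotone by (simp add: strongly_monotone_def u_def a_def inner_commute)
    have 2: "- (u \<bullet> d) \<le> a * (\<theta> * b)"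
      using norm_cauchy_schwarz[of "- u" d] mult_left_mono[OF d ab(1)] by (simp add: a_def)
    have 3: "- (select own Y \<bullet> d) \<le> b * (\<theta> * b)"
      using norm_cauchy_schwarz[of "- select own Y" d] mult_mono[OF sY d ab(2) norm_ge_zero] by simp
    have 4: "- (select own Y \<bullet> (F y - F x)) \<le> b * (\<theta> * a)"
      using norm_cauchy_schwarz[of "- select own Y" "F y - F x"]
        mult_mono[OF sY FL[of y x] ab(2) norm_ge_zero] by (simp add: a_def u_def)
    \<comment> \<open>Young's inequality, weighted to spend exactly half of the strong
      monotonicity.\<close>
    have "0 \<le> (sqrt (\<mu> / 2) * a - \<theta> * sqrt (2 / \<mu>) * b)\<^sup>2" by simp
    also have "\<dots> = \<mu> / 2 * a\<^sup>2 - 2 * (sqrt (\<mu> / 2) * sqrt (2 / \<mu>)) * \<theta> * a * b + 2 * \<theta>\<^sup>2 / \<mu> * b\<^sup>2"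
      using \<mu>_pos by (simp add: power2_diff power_mult_distrib algebra_simps)
    also have "sqrt (\<mu> / 2) * sqrt (2 / \<mu>) = 1"
      using \<mu>_pos by (simp flip: real_sqrt_mult)
    finally have young: "2 * \<theta> * a * b \<le> \<mu> / 2 * a\<^sup>2 + 2 * \<theta>\<^sup>2 / \<mu> * b\<^sup>2" by simp
    have LX: "L X = L Y" by (simp add: X linear_add[OF linear_kron_id] L_kron_ones)
    have "\<sigma> * b \<le> norm (L Y)"
    proof (cases "b = 0")
      case False
      have "\<sigma> * b * b \<le> b * norm (L Y)"
        using \<sigma>(2)[OF Y] norm_cauchy_schwarz[of Y "L Y"] by (simp add: b_def power2_eq_square mult.assoc)
      then show ?thesis using False ab by (simp add: mult.commute)
    qed simp
    then have "(\<sigma> * b)\<^sup>2 \<le> (norm (L X))\<^sup>2"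
      using \<sigma>(1) ab LX by (intro power_mono) auto
    then have "\<kappa> * (\<sigma> * b)\<^sup>2 \<le> \<kappa> * (norm (L X))\<^sup>2"
      using \<theta> \<mu>_pos by (intro mult_left_mono) (auto simp: \<kappa>_def)
    moreover have "\<kappa> * (\<sigma> * b)\<^sup>2 = (2 * \<theta>\<^sup>2 / \<mu> + \<theta> + 1) * b\<^sup>2"
      using \<sigma>(1) by (simp add: \<kappa>_def power_mult_distrib)
    ultimately have \<kappa>: "(2 * \<theta>\<^sup>2 / \<mu> + \<theta> + 1) * b\<^sup>2 \<le> \<kappa> * (norm (L X))\<^sup>2" by simp
    have "(select own X - x) \<bullet> (ext_pseudo_gradient own J X - F x) =
        u \<bullet> d + u \<bullet> (F y - F x) + select own Y \<bullet> d + select own Y \<bullet> (F y - F x)"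
      unfolding sX d_def by (simp add: inner_add_left inner_diff_right)
    also have "\<dots> \<ge> \<mu> * a\<^sup>2 - 2 * \<theta> * a * b - \<theta> * b\<^sup>2"
      using 1 2 3 4 by (simp add: power2_eq_square algebra_simps)
    finally have lower: "\<mu> / 2 * a\<^sup>2 + b\<^sup>2 \<le>
        (select own X - x) \<bullet> (ext_pseudo_gradient own J X - F x) + \<kappa> * (norm (L X))\<^sup>2"
      using young \<kappa> by (simp add: algebra_simps)
    have "X - kron_ones x = kron_ones u + Y"
      by (simp add: X u_def linear_diff[OF linear_kron_ones])
    then have "(norm (X - kron_ones x))\<^sup>2 = (norm (kron_ones u + Y))\<^sup>2" by simp
    also have "\<dots> = N * a\<^sup>2 + b\<^sup>2"
    proof -
      have "kron_ones u \<bullet> Y = 0" using Y by (simp add: inner_kron_ones consensus_perp_def)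
      moreover have "kron_ones u \<bullet> (kron_ones u :: real^'n^'a) = N * a\<^sup>2"
        unfolding inner_kron_ones
        by (simp add: kron_ones_def sum_constant_scaleR a_def N_def power2_norm_eq_inner del: sum_constant)
      ultimately show ?thesis
        by (simp add: power2_norm_eq_inner inner_add_left inner_add_right inner_commute b_def)
    qed
    finally have "c * (norm (X - kron_ones x))\<^sup>2 = (c * N) * a\<^sup>2 + c * b\<^sup>2"
      by (simp add: algebra_simps)
    also have "\<dots> \<le> \<mu> / 2 * a\<^sup>2 + 1 * b\<^sup>2"
      using c by (intro add_mono mult_right_mono) auto
    finally show ?thesis using lower by simp
  qed
  then show thesis using that c(1) by blast
qed

end

section \<open>The Lyapunov function\<close>

lemma has_derivative_quadratic_form:
  fixes A :: "'v::euclidean_space \<Rightarrow> 'v"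
  assumes "linear A" "\<And>x y. x \<bullet> A y = A x \<bullet> y"
  shows "((\<lambda>x. A (x - c) \<bullet> (x - c) / 2) has_derivative (\<lambda>h. A (x - c) \<bullet> h)) (at x)"
proof -
  have A: "bounded_linear A" using assms(1) by (simp add: linear_linear)
  have "((\<lambda>x. A (x - c)) has_derivative A) (at x)"
    by (rule bounded_linear.has_derivative[OF A]) (auto intro!: derivative_eq_intros)
  then have "((\<lambda>x. A (x - c) \<bullet> (x - c) / 2) has_derivative (\<lambda>h. (A (x - c) \<bullet> h + A h \<bullet> (x - c)) / 2)) (at x)"
    by (auto intro!: derivative_eq_intros)
  also have "(\<lambda>h. (A (x - c) \<bullet> h + A h \<bullet> (x - c)) / 2) = (\<lambda>h. A (x - c) \<bullet> h)"
    using assms(2)[of _ "x - c"] by (auto simp: inner_commute)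
  finally show ?thesis .
qed

text \<open>An argument in the manner of Barbalat: a value of \<open>q\<close> of at least
  \<open>e\<close> stays above \<open>e / 2\<close> for time \<open>d\<close>, so \<open>V\<close>
  drops by \<open>e * d / 2\<close>, too much once \<open>V\<close> is within
  \<open>e * d / 8\<close> of its limit. The form of \<open>decr\<close> avoids integrals.\<close>

lemma dissipation_rate_tendsto_0:
  fixes V q :: "real \<Rightarrow> real"
  assumes V: "(V \<longlongrightarrow> v) at_top" and q0: "\<And>t. t \<ge> 0 \<Longrightarrow> q t \<ge> 0" and K: "K \<ge> 0"
    and lip: "\<And>s t. s \<ge> 0 \<Longrightarrow> t \<ge> 0 \<Longrightarrow> \<bar>q t - q s\<bar> \<le> K * \<bar>t - s\<bar>"
    and decr: "\<And>s t d. 0 \<le> s \<Longrightarrow> s \<le> t \<Longrightarrow> (\<And>\<tau>. s \<le> \<tau> \<Longrightarrow> \<tau> \<le> t \<Longrightarrow> d \<le> q \<tau>) \<Longrightarrow> V t \<le> V s + (- d) * (t - s)"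
  shows "(q \<longlongrightarrow> 0) at_top"
proof (rule tendstoI)
  fix e :: real assume "e > 0"
  define d where "d = e / (2 * (K + 1))"
  have d: "d > 0" "K * d \<le> e / 2"
    using \<open>e > 0\<close> K by (simp_all add: d_def field_simps)
  have "\<forall>\<^sub>F t in at_top. dist (V t) v < e * d / 8"
    using V \<open>e > 0\<close> d(1) by (intro tendstoD) auto
  then obtain T where T: "\<And>t. t \<ge> T \<Longrightarrow> \<bar>V t - v\<bar> < e * d / 8"
    by (auto simp: eventually_at_top_linorder dist_real_def)
  have "q t < e" if t: "t \<ge> max T 0" for t
  proof (rule ccontr)
    assume "\<not> q t < e"
    have "e / 2 \<le> q \<tau>" if "t \<le> \<tau>" "\<tau> \<le> t + d" for \<tau>
    proof -
      have "\<bar>q \<tau> - q t\<bar> \<le> K * \<bar>\<tau> - t\<bar>" using lip[of t \<tau>] that t by simp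
      also have "\<dots> \<le> K * d" using that K by (intro mult_left_mono) auto
      finally show ?thesis using d(2) \<open>\<not> q t < e\<close> by linarith
    qed
    then have "V (t + d) \<le> V t + - (e / 2) * (t + d - t)"
      using t d(1) by (intro decr) auto
    then have "V (t + d) \<le> V t - e * d / 2" by simp
    moreover have "e * d > 0" using \<open>e > 0\<close> d(1) by simp
    moreover have "\<bar>V t - v\<bar> < e * d / 8" "\<bar>V (t + d) - v\<bar> < e * d / 8"
      using T[of t] T[of "t + d"] t d(1) by simp_all
    ultimately show False by linarith
  qed
  then show "\<forall>\<^sub>F t in at_top. dist (q t) 0 < e"
    using q0 by (intro eventually_at_top_linorderI[of "max T 0"]) (auto simp: dist_real_def)
qed

context adaptive_game begin

definition pinv :: "real^'m^'a \<Rightarrow> real^'m^'a" where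
  "pinv = (SOME M. linear M \<and> (\<forall>x y. x \<bullet> M y = M x \<bullet> y) \<and> (\<exists>c>0. \<forall>z. c * (norm z)\<^sup>2 \<le> z \<bullet> M z) \<and>
     (\<forall>z l. z \<in> consensus_perp \<longrightarrow> M z \<bullet> L l = z \<bullet> l))"

lemma pinv: "linear pinv" "x \<bullet> pinv y = pinv x \<bullet> y" "x \<noteq> 0 \<Longrightarrow> 0 < x \<bullet> pinv x"
  "x \<in> consensus_perp \<Longrightarrow> pinv x \<bullet> L y = x \<bullet> y"
proof -
  have "\<exists>M :: real^'m^'a \<Rightarrow> real^'m^'a. linear M \<and> (\<forall>x y. x \<bullet> M y = M x \<bullet> y) \<and>
      (\<exists>c>0. \<forall>z. c * (norm z)\<^sup>2 \<le> z \<bullet> M z) \<and> (\<forall>z l. z \<in> consensus_perp \<longrightarrow> M z \<bullet> L l = z \<bullet> l)"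
    using laplacian_pseudoinverse[OF symE connected] by (metis (no_types, lifting))
  from someI_ex[OF this, folded pinv_def] have p: "linear pinv" "\<forall>x y. x \<bullet> pinv y = pinv x \<bullet> y"
    "\<exists>c>0. \<forall>z. c * (norm z)\<^sup>2 \<le> z \<bullet> pinv z" "\<forall>z l. z \<in> consensus_perp \<longrightarrow> pinv z \<bullet> L l = z \<bullet> l"
    by blast+
  then show "linear pinv" "x \<bullet> pinv y = pinv x \<bullet> y" "x \<in> consensus_perp \<Longrightarrow> pinv x \<bullet> L y = x \<bullet> y"
    by blast+
  obtain c where c: "c > 0" "c * (norm x)\<^sup>2 \<le> x \<bullet> pinv x" using p(3) by blast
  assume "x \<noteq> 0"
  then have "c * (norm x)\<^sup>2 > 0" using c(1) by simp
  then show "0 < x \<bullet> pinv x" using c(2) by linarith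
qed

text \<open>The Lyapunov function is half the squared distance to an equilibrium in the inner product given by
  \<open>metric\<close>; weighting \<open>z\<close> with the pseudoinverse of the Laplacian cancels the cross terms of the
  dynamics of \<open>z\<close> and \<open>\<lambda>\<close>. The gain \<open>\<kappa>\<close> at the center may be any sufficiently large number, as every
  \<open>k\<close> is stationary at consensus.\<close>

definition metric :: "('n, 'm, 'a) state \<Rightarrow> ('n, 'm, 'a) state" where
  "metric w = (fst w, (\<chi> i. fst (snd w) $ i / \<gamma> $ i), pinv (fst (snd (snd w))), snd (snd (snd w)))"

definition center :: "real^'n \<Rightarrow> real^'a \<Rightarrow> real^'m \<Rightarrow> real^'m^'a \<Rightarrow> ('n, 'm, 'a) state" where
  "center x k l Z = (kron_ones x, k, Z, kron_ones l)"

definition lyap :: "('n, 'm, 'a) state \<Rightarrow> ('n, 'm, 'a) state \<Rightarrow> real" where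
  "lyap c w = metric (w - c) \<bullet> (w - c) / 2"

lemma linear_metric: "linear metric"
  by (rule linearI)
    (simp_all add: metric_def linear_add[OF pinv(1)] linear_cmul[OF pinv(1)] vec_eq_iff add_divide_distrib)

lemma inner_metric: "metric (X, k, Z, \<Lambda>) \<bullet> (X', k', Z', \<Lambda>') =
    X \<bullet> X' + (\<Sum>i\<in>UNIV. k $ i * k' $ i / \<gamma> $ i) + pinv Z \<bullet> Z' + \<Lambda> \<bullet> \<Lambda>'"
  by (simp add: metric_def inner_vec_def[of "\<chi> i. k $ i / \<gamma> $ i"])

lemma metric_symmetric: "w \<bullet> metric v = metric w \<bullet> v"
proof -
  obtain X k Z \<Lambda> where w: "w = (X, k, Z, \<Lambda>)" by (cases w)
  obtain X' k' Z' \<Lambda>' where v: "v = (X', k', Z', \<Lambda>')" by (cases v)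
  have "pinv Z' \<bullet> Z = pinv Z \<bullet> Z'" using pinv(2)[of Z Z'] by (simp add: inner_commute)
  then show ?thesis
    unfolding inner_commute[of w] unfolding w v inner_metric by (simp add: inner_commute mult.commute)
qed

lemma metric_pos:
  assumes "w \<noteq> 0"
  shows "0 < w \<bullet> metric w"
proof -
  obtain X k Z \<Lambda> where w: "w = (X, k, Z, \<Lambda>)" by (cases w)
  have s: "(\<Sum>i\<in>UNIV. k $ i * k $ i / \<gamma> $ i) \<ge> 0"
    by (intro sum_nonneg divide_nonneg_pos \<gamma>_pos) simp
  have z: "pinv Z \<bullet> Z \<ge> 0"
    using pinv(3)[of Z] pinv(2)[of Z Z] linear_0[OF pinv(1)] by (cases "Z = 0") auto
  have "w \<bullet> metric w = X \<bullet> X + (\<Sum>i\<in>UNIV. k $ i * k $ i / \<gamma> $ i) + pinv Z \<bullet> Z + \<Lambda> \<bullet> \<Lambda>"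
    unfolding metric_symmetric unfolding w inner_metric ..
  moreover have "\<dots> > 0"
  proof (cases "k = 0")
    case True
    then have "X \<noteq> 0 \<or> Z \<noteq> 0 \<or> \<Lambda> \<noteq> 0" using assms by (auto simp: w zero_prod_def)
    then show ?thesis
      using s z pinv(3)[of Z] pinv(2)[of Z Z] inner_ge_zero[of X] inner_ge_zero[of \<Lambda>]
        inner_gt_zero_iff[of X] inner_gt_zero_iff[of \<Lambda>] by (smt (verit))
  next
    case False
    then obtain i where "k $ i \<noteq> 0" by (auto simp: vec_eq_iff)
    then have "0 < k $ i * k $ i" using not_real_square_gt_zero by blast
    then have "0 < k $ i * k $ i / \<gamma> $ i" using \<gamma>_pos[of i] by (rule divide_pos_pos)
    also have "\<dots> \<le> (\<Sum>i\<in>UNIV. k $ i * k $ i / \<gamma> $ i)"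
      by (rule member_le_sum) (auto intro!: divide_nonneg_pos \<gamma>_pos)
    finally show ?thesis using z inner_ge_zero[of X] inner_ge_zero[of \<Lambda>] by linarith
  qed
  ultimately show ?thesis by simp
qed

lemma metric_coercive:
  obtains m where "m > 0" "\<And>w. m * (norm w)\<^sup>2 \<le> metric w \<bullet> w"
  using positive_definite_coercive[OF linear_metric metric_pos] unfolding metric_symmetric by blast

lemma lyap_has_derivative: "(lyap c has_derivative (\<lambda>h. metric (w - c) \<bullet> h)) (at w)"
  unfolding lyap_def by (rule has_derivative_quadratic_form[OF linear_metric metric_symmetric])

lemma lob_lyap: "lipschitz_on_bounded (lyap c)"
  unfolding lyap_def divide_inverse
  by (intro lob_intros lob_compose[OF lob_linear[OF linear_metric]])

context
  fixes \<kappa> c :: real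
  assumes c: "c > 0" and restricted: "\<And>X x. c * (norm (X - kron_ones x))\<^sup>2 \<le>
    (select own X - x) \<bullet> (ext_pseudo_gradient own J X - F x) + \<kappa> * (norm (L X))\<^sup>2"
begin

text \<open>For an equilibrium the three summands are separately nonnegative on \<open>S\<close>:
  estimation error, multiplier disagreement and complementarity defect. When the sum tends to 0, so
  does each.\<close>

definition diss :: "real^'n \<Rightarrow> real^'m^'a \<Rightarrow> ('n, 'm, 'a) state \<Rightarrow> real" where
  "diss x Z w = c * (norm (fst w - kron_ones x))\<^sup>2 + snd (snd (snd w)) \<bullet> L (snd (snd (snd w)))
     - snd (snd (snd w)) \<bullet> (G x - Z)"

lemma diss_bounds:
  assumes "equilibrium x l Z" "w \<in> S"
  shows "diss x Z w \<ge> c * (norm (fst w - kron_ones x))\<^sup>2"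
    "diss x Z w \<ge> snd (snd (snd w)) \<bullet> L (snd (snd (snd w)))"
    "diss x Z w \<ge> - (snd (snd (snd w)) \<bullet> (G x - Z))"
    "snd (snd (snd w)) \<bullet> (G x - Z) \<le> 0"
proof -
  let ?\<Lambda> = "snd (snd (snd w))"
  have "0 \<le> ?\<Lambda>" using assms(2) by (cases w) (simp add: mem_S)
  have "?\<Lambda> \<bullet> (G x - Z) = (\<Sum>i\<in>UNIV. ?\<Lambda> $ i \<bullet> (G x $ i - Z $ i))"
    by (subst inner_vec_def) simp
  also have "\<dots> \<le> 0"
  proof (rule sum_nonpos)
    fix i
    have "G x $ i - Z $ i \<le> 0" using assms(1) by (simp add: equilibrium_def)
    then show "?\<Lambda> $ i \<bullet> (G x $ i - Z $ i) \<le> 0"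
      using \<open>0 \<le> ?\<Lambda>\<close> by (auto simp: inner_vec_def less_eq_vec_def intro!: sum_nonpos mult_nonneg_nonpos)
  qed
  finally have 1: "?\<Lambda> \<bullet> (G x - Z) \<le> 0" .
  have 2: "?\<Lambda> \<bullet> L ?\<Lambda> \<ge> 0" by (rule L_nonneg)
  have 3: "c * (norm (fst w - kron_ones x))\<^sup>2 \<ge> 0" using c by simp
  show "diss x Z w \<ge> c * (norm (fst w - kron_ones x))\<^sup>2" "diss x Z w \<ge> ?\<Lambda> \<bullet> L ?\<Lambda>"
    "diss x Z w \<ge> - (?\<Lambda> \<bullet> (G x - Z))" "?\<Lambda> \<bullet> (G x - Z) \<le> 0"
    unfolding diss_def using 1 2 3 by linarith+
qed

lemma lob_diss: "lipschitz_on_bounded (diss x Z)"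
  unfolding diss_def power2_norm_eq_inner by (intro lob_intros lob_L)

text \<open>The gain terms collapse to \<kappa> times the squared norm of \<open>L X\<close>,
  \<open>pinv\<close> cancels the exchange between \<open>z\<close> and the multipliers, and the KKT
  conditions with convexity of \<open>g\<close> dispose of the constraint terms. Restricted
  monotonicity gives the rest.\<close>

lemma dissipation:
  assumes eq: "equilibrium x l Z" and w: "w \<in> S"
  shows "metric (w - center x (\<chi> i. \<kappa>) l Z) \<bullet> proj_tangent S w (drift w) \<le> - diss x Z w"
proof -
  obtain X k Zw \<Lambda> where wd: "w = (X, k, Zw, \<Lambda>)" by (cases w)
  have m: "X \<in> ext_set own \<Omega>" "Zw \<in> consensus_perp" "0 \<le> \<Lambda>"
    using w by (simp_all add: wd mem_S)
  have e: "kkt own \<Omega> g J x l" "Z \<in> consensus_perp" "\<And>i. l \<bullet> (G x $ i - Z $ i) = 0"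
    using eq by (auto simp: equilibrium_def)
  note kk = e(1)[unfolded kkt_iff]
  let ?X = "kron_ones x :: real^'n^'a" and ?l = "kron_ones l :: real^'m^'a"
  define px where "px = proj_tangent (ext_set own \<Omega>) X (drift_x X k \<Lambda>)"
  define pl where "pl = proj_tangent {l. 0 \<le> l} \<Lambda> (drift_l X Zw \<Lambda>)"
  have vel: "proj_tangent S w (drift w) = (px, drift_k X, L \<Lambda>, pl)"
    unfolding closed_loop_eq_proj[OF w, symmetric] unfolding wd closed_loop_eq px_def pl_def ..
  have lpos: "0 \<le> ?l" using kk by (simp add: kron_ones_nonneg)
  \<comment> \<open>The reference point lies in the convex set, so the normal part removed by the
    projection can only help; \<open>l1\<close> is the same for the multipliers.\<close>
  have x1: "(X - ?X) \<bullet> px \<le> (X - ?X) \<bullet> drift_x X k \<Lambda>"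
  proof -
    have "(drift_x X k \<Lambda> - px) \<bullet> (?X - X) \<le> 0"
      using proj_tangent_normal[OF convex_ext_set m(1), of "drift_x X k \<Lambda>"] kk
      by (simp add: px_def normal_cone_def kron_ones_mem_ext_set)
    then show ?thesis by (simp add: algebra_simps inner_commute)
  qed
  have l1: "(\<Lambda> - ?l) \<bullet> pl \<le> (\<Lambda> - ?l) \<bullet> drift_l X Zw \<Lambda>"
  proof -
    have "(drift_l X Zw \<Lambda> - pl) \<bullet> (?l - \<Lambda>) \<le> 0"
      using proj_tangent_normal[OF convex_nonneg, of \<Lambda> "drift_l X Zw \<Lambda>"] m(3) lpos
      by (simp add: pl_def normal_cone_def)
    then show ?thesis by (simp add: algebra_simps inner_commute)
  qed
  let ?\<rho> = "L X" and ?s = "select own X"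
  have quad: "(X - ?X) \<bullet> L (kron_id (diag k) ?\<rho>) = (\<Sum>i\<in>UNIV. k $ i * (?\<rho> $ i \<bullet> ?\<rho> $ i))"
  proof -
    have "(X - ?X) \<bullet> L (kron_id (diag k) ?\<rho>) = L (X - ?X) \<bullet> kron_id (diag k) ?\<rho>"
      by (rule L_self_adjoint)
    also have "L (X - ?X) = ?\<rho>"
      by (simp add: linear_diff[OF linear_kron_id] L_kron_ones)
    also have "?\<rho> \<bullet> kron_id (diag k) ?\<rho> = (\<Sum>i\<in>UNIV. k $ i * (?\<rho> $ i \<bullet> ?\<rho> $ i))"
      by (subst inner_vec_def) (simp add: kron_id_diag)
    finally show ?thesis .
  qed
  have x2: "(X - ?X) \<bullet> drift_x X k \<Lambda> = - ((?s - x) \<bullet> (ext_pseudo_gradient own J X + JT ?s \<Lambda>))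
      - (\<Sum>i\<in>UNIV. k $ i * (?\<rho> $ i \<bullet> ?\<rho> $ i))"
    unfolding drift_x_def inner_diff_right inner_minus_right inner_adjoint_select quad
    by (simp add: linear_diff[OF linear_select])
  \<comment> \<open>Dividing by \<gamma> leaves weights \<open>k $ i - \<kappa>\<close>; the first
    part cancels the consensus term of \<open>x2\<close>, so only \<kappa> remains.\<close>
  have k1: "(\<Sum>i\<in>UNIV. (k $ i - \<kappa>) * drift_k X $ i / \<gamma> $ i) =
      (\<Sum>i\<in>UNIV. k $ i * (?\<rho> $ i \<bullet> ?\<rho> $ i)) - \<kappa> * (norm ?\<rho>)\<^sup>2"
  proof -
    have "(k $ i - \<kappa>) * drift_k X $ i / \<gamma> $ i = k $ i * (?\<rho> $ i \<bullet> ?\<rho> $ i) - \<kappa> * (?\<rho> $ i \<bullet> ?\<rho> $ i)" for i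
      using \<gamma>_pos[of i] by (simp add: drift_k_def left_diff_distrib diff_divide_distrib)
    moreover have "(norm ?\<rho>)\<^sup>2 = (\<Sum>i\<in>UNIV. ?\<rho> $ i \<bullet> ?\<rho> $ i)"
      unfolding power2_norm_eq_inner by (rule inner_vec_def)
    ultimately show ?thesis by (simp add: sum_subtractf sum_distrib_left)
  qed
  have perp: "Zw - Z \<in> consensus_perp"
    using m(2) e(2) by (rule subspace_diff[OF subspace_consensus_perp])
  \<comment> \<open>The pseudoinverse undoes \<open>L\<close>, and the consensus vector
    \<open>?l\<close> may be inserted because it is orthogonal to \<open>Zw - Z\<close>.\<close>
  have z1: "pinv (Zw - Z) \<bullet> L \<Lambda> = (Zw - Z) \<bullet> (\<Lambda> - ?l)"
    unfolding pinv(4)[OF perp] inner_diff_right[of "Zw - Z" \<Lambda>]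
    using perp inner_kron_ones[of l "Zw - Z"] by (simp add: inner_commute consensus_perp_def)
  have l2: "(\<Lambda> - ?l) \<bullet> drift_l X Zw \<Lambda> + (Zw - Z) \<bullet> (\<Lambda> - ?l) = (\<Lambda> - ?l) \<bullet> (G ?s - Z) - \<Lambda> \<bullet> L \<Lambda>"
  proof -
    have "?l \<bullet> L \<Lambda> = 0" unfolding L_self_adjoint by (simp add: L_kron_ones)
    then show ?thesis by (simp add: drift_l_def algebra_simps inner_commute)
  qed
  have l3: "?l \<bullet> (G x - Z) = 0"
    using e(3) by (subst inner_vec_def) (simp add: kron_ones_def)
  \<comment> \<open>\<open>c1\<close> is stationarity tested at \<open>?s\<close>, while
    \<open>c2\<close> and \<open>c3\<close> are convexity at \<open>x\<close> and at
    \<open>?s\<close>; added up, they cancel all terms in \<open>G ?s\<close>.\<close>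
  have c1: "0 \<le> (?s - x) \<bullet> (F x + JT x ?l)"
    using kk m(1) by (simp add: ext_set_def inner_commute)
  have c2: "(?s - x) \<bullet> JT x ?l \<le> ?l \<bullet> (G ?s - G x)"
    using JT_le[OF lpos, of x ?s] by (simp add: inner_commute)
  have c3: "- ((?s - x) \<bullet> JT ?s \<Lambda>) \<le> \<Lambda> \<bullet> (G x - G ?s)"
  proof -
    have "- ((?s - x) \<bullet> JT ?s \<Lambda>) = JT ?s \<Lambda> \<bullet> (x - ?s)"
      by (simp add: inner_diff_left inner_diff_right inner_commute)
    then show ?thesis using JT_le[OF m(3), of ?s x] by simp
  qed
  have "metric (w - center x (\<chi> i. \<kappa>) l Z) \<bullet> proj_tangent S w (drift w) =
      (X - ?X) \<bullet> px + (\<Sum>i\<in>UNIV. (k $ i - \<kappa>) * drift_k X $ i / \<gamma> $ i) + pinv (Zw - Z) \<bullet> L \<Lambda> + (\<Lambda> - ?l) \<bullet> pl"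
    unfolding vel unfolding wd center_def diff_Pair inner_metric by simp
  also have "\<dots> \<le> - ((?s - x) \<bullet> (ext_pseudo_gradient own J X + JT ?s \<Lambda>)) - \<kappa> * (norm ?\<rho>)\<^sup>2
      + ((\<Lambda> - ?l) \<bullet> (G ?s - Z) - \<Lambda> \<bullet> L \<Lambda>)"
    using x1 x2 k1 z1 l1 l2 by linarith
  also have "\<dots> \<le> - ((?s - x) \<bullet> (ext_pseudo_gradient own J X - F x) + \<kappa> * (norm ?\<rho>)\<^sup>2)
      + \<Lambda> \<bullet> (G x - Z) - \<Lambda> \<bullet> L \<Lambda>"
    using c1 c2 c3 l3 by (simp add: inner_diff_left inner_diff_right inner_add_right)
  also have "\<dots> \<le> - diss x Z w"
    using restricted[of X x] by (simp add: diss_def wd)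
  finally show ?thesis .
qed

end

end

section \<open>Convergence\<close>

lemma mult_divide_cancel_denominator: "b \<noteq> 0 \<Longrightarrow> b * (a / (n * b)) = a / (n :: real)"
  by simp

lemma norm_fst_projection: "norm (fst p) \<le> norm p"
  by (cases p) (simp add: norm_fst_le)

lemma norm_snd_projection: "norm (snd p) \<le> norm p"
  by (cases p) (simp add: norm_snd_le)

context adaptive_game begin

text \<open>Increasing a coordinate stays in the orthant, so the removed normal part has nonpositive
  components: projection never slows the growth of a multiplier.\<close>

lemma projected_component_ge:
  assumes "0 \<le> (\<Lambda> :: real^'m^'a)"
  shows "f $ i $ j \<le> proj_tangent {l. 0 \<le> l} \<Lambda> f $ i $ j"
proof -
  let ?p = "proj_tangent {l. 0 \<le> l} \<Lambda> f"
  have "0 \<le> \<Lambda> + axis i (axis j 1)"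
    using assms by (auto simp: less_eq_vec_def axis_def)
  then have "(f - ?p) \<bullet> (\<Lambda> + axis i (axis j 1) - \<Lambda>) \<le> 0"
    using proj_tangent_normal[OF convex_nonneg, of \<Lambda> f] assms unfolding normal_cone_def by blast
  then show ?thesis by (simp add: inner_axis)
qed

context
  fixes \<kappa> c :: real
  assumes c: "c > 0" and restricted: "\<And>X x. c * (norm (X - kron_ones x))\<^sup>2 \<le>
    (select own X - x) \<bullet> (ext_pseudo_gradient own J X - F x) + \<kappa> * (norm (L X))\<^sup>2"
  fixes w :: "real \<Rightarrow> ('n, 'm, 'a) state" and R K :: real and Q :: "real set"
  assumes w_mem: "\<And>t. t \<ge> 0 \<Longrightarrow> w t \<in> S" and w_bound: "\<And>t. t \<ge> 0 \<Longrightarrow> norm (w t) \<le> R"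
    and K: "K \<ge> 0" and w_lipschitz: "\<And>s t. s \<ge> 0 \<Longrightarrow> t \<ge> 0 \<Longrightarrow> norm (w t - w s) \<le> K * \<bar>t - s\<bar>"
    and Q: "negligible Q"
    and w_deriv: "\<And>t. t \<ge> 0 \<Longrightarrow> t \<notin> Q \<Longrightarrow>
      (w has_vector_derivative CL (w t)) (at t within {0..})"
begin

abbreviation Xc :: "real \<Rightarrow> real^'n^'a" where "Xc t \<equiv> fst (w t)"
abbreviation kc :: "real \<Rightarrow> real^'a" where "kc t \<equiv> fst (snd (w t))"
abbreviation Zc :: "real \<Rightarrow> real^'m^'a" where "Zc t \<equiv> fst (snd (snd (w t)))"
abbreviation \<Lambda>c :: "real \<Rightarrow> real^'m^'a" where "\<Lambda>c t \<equiv> snd (snd (snd (w t)))"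
abbreviation vel :: "real \<Rightarrow> ('n, 'm, 'a) state" where "vel t \<equiv> CL (w t)"

lemma vel_eq: "vel t = (proj_tangent (ext_set own \<Omega>) (Xc t) (drift_x (Xc t) (kc t) (\<Lambda>c t)), drift_k (Xc t),
    L (\<Lambda>c t), proj_tangent {l. 0 \<le> l} (\<Lambda>c t) (drift_l (Xc t) (Zc t) (\<Lambda>c t)))"
  unfolding closed_loop_eq[symmetric] by simp

lemma \<Lambda>c_nonneg: "t \<ge> 0 \<Longrightarrow> 0 \<le> \<Lambda>c t" and Xc_mem: "t \<ge> 0 \<Longrightarrow> Xc t \<in> ext_set own \<Omega>"
  using w_mem[of t] by (cases "w t"; simp add: mem_S)+

text \<open>Stands in for integration: \<open>\<phi> (w t) - m * t\<close> has nonpositive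
  derivative almost everywhere.\<close>

lemma growth_along:
  assumes \<phi>: "lipschitz_on_bounded \<phi>" "\<And>x. (\<phi> has_derivative \<phi>' x) (at x)"
    and ab: "0 \<le> a" "a \<le> b" and le: "\<And>t. a \<le> t \<Longrightarrow> t \<le> b \<Longrightarrow> \<phi>' (w t) (vel t) \<le> m"
  shows "\<phi> (w b) \<le> \<phi> (w a) + m * (b - a)"
proof -
  have w: "abs_continuous_on 0 b w"
  proof (rule abs_continuous_on_lipschitz[OF K])
    show "norm (w t - w s) \<le> K * (t - s)" if "0 \<le> s" "s \<le> t" for s t
      using w_lipschitz[of s t] that by simp
  qed
  have "abs_continuous_on 0 b (\<lambda>t::real. t)"
    by (rule abs_continuous_on_lipschitz[of 1]) auto
  then have "abs_continuous_on 0 b (\<lambda>t. (w t, t))"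
    by (intro abs_continuous_on_Pair w)
  moreover have "lipschitz_on_bounded (\<lambda>p. \<phi> (fst p) - m * snd p)"
    by (intro lob_intros lob_compose[OF \<phi>(1)])
  ultimately have "abs_continuous_on 0 b (\<lambda>t. \<phi> (w t) - m * t)"
    by (auto dest!: abs_continuous_on_compose)
  then have "\<phi> (w b) - m * b \<le> \<phi> (w a) - m * a"
  proof (rule nonincreasing_along[OF _ ab Q])
    fix t assume t: "a \<le> t" "t \<le> b" "t \<notin> Q"
    then have "((\<lambda>t. \<phi> (w t)) has_real_derivative \<phi>' (w t) (vel t)) (at t within {0..})"
      using ab by (intro has_real_derivative_compose_vector[OF \<phi>(2) w_deriv]) auto
    then have "((\<lambda>t. \<phi> (w t) - m * t) has_real_derivative \<phi>' (w t) (vel t) - m) (at t within {0..})"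
      by (auto intro!: derivative_eq_intros)
    then show "\<exists>d\<le>0. ((\<lambda>t. \<phi> (w t) - m * t) has_real_derivative d) (at t within {0..})"
      using le[OF t(1,2)] by (intro exI[of _ "\<phi>' (w t) (vel t) - m"]) simp
  qed
  then show ?thesis by (simp add: algebra_simps)
qed

lemma linear_growth_along:
  assumes "bounded_linear \<phi>" "0 \<le> a" "a \<le> b" "\<And>t. a \<le> t \<Longrightarrow> t \<le> b \<Longrightarrow> \<phi> (vel t) \<le> m"
  shows "\<phi> (w b) \<le> \<phi> (w a) + m * (b - a)"
  by (rule growth_along[OF lob_bounded_linear[OF assms(1)] bounded_linear_imp_has_derivative[OF assms(1)] assms(2-4)])

text \<open>The trajectory is bounded and Lipschitz in time, hence so is \<open>diss\<close> along
  it, as the vanishing of the dissipation rate requires.\<close>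

lemma lyap_tendsto:
  assumes "equilibrium x l Z"
  obtains v where "((\<lambda>t. lyap (center x (\<chi> i. \<kappa>) l Z) (w t)) \<longlongrightarrow> v) at_top"
    and "((\<lambda>t. diss c x Z (w t)) \<longlongrightarrow> 0) at_top"
proof -
  let ?c = "center x (\<chi> i. \<kappa>) l Z"
  have decr: "lyap ?c (w t) \<le> lyap ?c (w s) + (- d) * (t - s)"
    if "0 \<le> s" "s \<le> t" "\<And>\<tau>. s \<le> \<tau> \<Longrightarrow> \<tau> \<le> t \<Longrightarrow> d \<le> diss c x Z (w \<tau>)" for s t d
  proof (rule growth_along[OF lob_lyap lyap_has_derivative that(1,2)])
    fix \<tau> assume \<tau>: "s \<le> \<tau>" "\<tau> \<le> t"
    then have "w \<tau> \<in> S" using that(1) by (intro w_mem) simp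
    then have "metric (w \<tau> - ?c) \<bullet> vel \<tau> \<le> - diss c x Z (w \<tau>)"
      using dissipation[OF c restricted assms] by (simp add: closed_loop_eq_proj)
    then show "metric (w \<tau> - ?c) \<bullet> vel \<tau> \<le> - d"
      using that(3)[OF \<tau>] by simp
  qed
  have nn: "0 \<le> diss c x Z (w t)" if "t \<ge> 0" for t
  proof -
    have "0 \<le> \<Lambda>c t \<bullet> L (\<Lambda>c t)" by (rule L_nonneg)
    then show ?thesis
      using diss_bounds(2)[OF c restricted assms w_mem[OF that]] by linarith
  qed
  obtain v where v: "((\<lambda>t. lyap ?c (w t)) \<longlongrightarrow> v) at_top"
  proof (rule nonincreasing_tendsto_at_top[of 0 "\<lambda>t. lyap ?c (w t)" 0])
    show "lyap ?c (w t) \<le> lyap ?c (w s)" if "0 \<le> s" "s \<le> t" for s t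
      using decr[of s t 0] nn that by simp
    show "0 \<le> lyap ?c (w t)" for t
      using metric_pos[of "w t - ?c"] by (cases "w t - ?c = 0") (auto simp: lyap_def metric_symmetric)
  qed
  obtain M where M: "M \<ge> 0" "\<And>p q. norm p \<le> R \<Longrightarrow> norm q \<le> R \<Longrightarrow>
      norm (diss c x Z p - diss c x Z q) \<le> M * norm (p - q)"
    using lipschitz_on_boundedE[OF lob_diss[OF c restricted]] by blast
  have "((\<lambda>t. diss c x Z (w t)) \<longlongrightarrow> 0) at_top"
  proof (rule dissipation_rate_tendsto_0[OF v nn _ _ decr])
    show "M * K \<ge> 0" using M(1) K by simp
    fix s t :: real assume st: "s \<ge> 0" "t \<ge> 0"
    have "norm (diss c x Z (w t) - diss c x Z (w s)) \<le> M * norm (w t - w s)"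
      using st by (intro M w_bound)
    also have "\<dots> \<le> M * (K * \<bar>t - s\<bar>)"
      using st by (intro mult_left_mono M w_lipschitz)
    finally show "\<bar>diss c x Z (w t) - diss c x Z (w s)\<bar> \<le> M * K * \<bar>t - s\<bar>"
      by (simp add: mult.assoc)
  qed
  then show thesis using that v by blast
qed

lemma consensus_limits:
  assumes eq: "equilibrium x l Z"
  shows "(Xc \<longlongrightarrow> kron_ones x) at_top" "((\<lambda>t. L (\<Lambda>c t)) \<longlongrightarrow> 0) at_top"
    "((\<lambda>t. \<Lambda>c t \<bullet> (G x - Z)) \<longlongrightarrow> 0) at_top"
proof -
  obtain v where D: "((\<lambda>t. diss c x Z (w t)) \<longlongrightarrow> 0) at_top"
    using lyap_tendsto[OF eq] by blast
  note b = diss_bounds[OF c restricted eq w_mem]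
  have ev: "\<forall>\<^sub>F t in at_top. P t" if "\<And>t. t \<ge> 0 \<Longrightarrow> P t" for P :: "real \<Rightarrow> bool"
    using that by (intro eventually_at_top_linorderI[of 0])
  have X2: "((\<lambda>t. (norm (Xc t - kron_ones x))\<^sup>2) \<longlongrightarrow> 0) at_top"
  proof (rule Lim_null_comparison)
    show "\<forall>\<^sub>F t in at_top. norm ((norm (Xc t - kron_ones x))\<^sup>2) \<le> diss c x Z (w t) / c"
      using b(1) c by (intro ev) (simp add: field_simps)
    show "((\<lambda>t. diss c x Z (w t) / c) \<longlongrightarrow> 0) at_top"
      using tendsto_divide[OF D tendsto_const, of c] c by simp
  qed
  then have "((\<lambda>t. norm (Xc t - kron_ones x)) \<longlongrightarrow> 0) at_top"
    using tendsto_real_sqrt[OF X2] by simp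
  then show "(Xc \<longlongrightarrow> kron_ones x) at_top"
    using LIM_zero_cancel tendsto_norm_zero_iff by blast
  obtain \<sigma> where \<sigma>: "\<sigma> > 0" "\<And>Y :: real^'m^'a. Y \<in> consensus_perp \<Longrightarrow> \<sigma> * (norm Y)\<^sup>2 \<le> Y \<bullet> L Y"
    using laplacian_coercive[OF symE connected] by blast
  obtain B where B: "B > 0" "\<And>Y :: real^'m^'a. norm (L Y) \<le> norm Y * B"
    using bounded_linear.pos_bounded[OF linear_linear[THEN iffD2, OF linear_kron_id]] by blast
  \<comment> \<open>Neither side sees the consensus part of \<open>Y\<close>; on the remaining part
    coercivity bounds the norm by the quadratic form.\<close>
  have L2: "(norm (L Y))\<^sup>2 \<le> B\<^sup>2 / \<sigma> * (Y \<bullet> L Y)" for Y :: "real^'m^'a"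
  proof -
    obtain m Y' where Y: "Y = kron_ones m + Y'" "Y' \<in> consensus_perp"
      using consensus_decomposition[OF symE connected, of Y] by blast
    have LY: "L Y = L Y'" by (simp add: Y linear_add[OF linear_kron_id] L_kron_ones)
    have "Y \<bullet> L Y = Y' \<bullet> L Y'"
      unfolding LY by (simp add: Y inner_add_left L_self_adjoint[of "kron_ones m"] L_kron_ones)
    then have "\<sigma> * (norm Y')\<^sup>2 \<le> Y \<bullet> L Y" using \<sigma>(2)[OF Y(2)] by simp
    then have "(norm Y')\<^sup>2 \<le> (Y \<bullet> L Y) / \<sigma>" using \<sigma>(1) by (simp add: field_simps)
    moreover have "(norm (L Y))\<^sup>2 \<le> (norm Y' * B)\<^sup>2"
      unfolding LY using B(2) by (intro power_mono) auto
    ultimately have "(norm (L Y))\<^sup>2 \<le> B\<^sup>2 * ((Y \<bullet> L Y) / \<sigma>)"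
      using mult_left_mono[of "(norm Y')\<^sup>2" "(Y \<bullet> L Y) / \<sigma>" "B\<^sup>2"] by (simp add: power_mult_distrib mult.commute)
    then show ?thesis by simp
  qed
  have "((\<lambda>t. (norm (L (\<Lambda>c t)))\<^sup>2) \<longlongrightarrow> 0) at_top"
  proof (rule Lim_null_comparison)
    have "(norm (L (\<Lambda>c t)))\<^sup>2 \<le> B\<^sup>2 / \<sigma> * diss c x Z (w t)" if "t \<ge> 0" for t
      by (rule order_trans[OF L2]) (use b(2)[OF that] \<sigma>(1) in \<open>intro mult_left_mono, auto\<close>)
    then show "\<forall>\<^sub>F t in at_top. norm ((norm (L (\<Lambda>c t)))\<^sup>2) \<le> B\<^sup>2 / \<sigma> * diss c x Z (w t)"
      by (intro ev) simp
    show "((\<lambda>t. B\<^sup>2 / \<sigma> * diss c x Z (w t)) \<longlongrightarrow> 0) at_top"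
      using tendsto_mult[OF tendsto_const D, of "B\<^sup>2 / \<sigma>"] by simp
  qed
  from tendsto_real_sqrt[OF this] show "((\<lambda>t. L (\<Lambda>c t)) \<longlongrightarrow> 0) at_top"
    by (simp add: tendsto_norm_zero_iff)
  show "((\<lambda>t. \<Lambda>c t \<bullet> (G x - Z)) \<longlongrightarrow> 0) at_top"
  proof (rule Lim_null_comparison[OF _ D])
    show "\<forall>\<^sub>F t in at_top. norm (\<Lambda>c t \<bullet> (G x - Z)) \<le> diss c x Z (w t)"
      using b(3,4) by (intro ev) auto
  qed
qed

section \<open>Limit points of the trajectory\<close>

context
  fixes x :: "real^'n" and l :: "real^'m" and Z Z' \<Lambda>' :: "real^'m^'a" and X :: "real^'n^'a" and k :: "real^'a"
    and T :: "nat \<Rightarrow> real"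
  assumes eq: "equilibrium x l Z" and T: "filterlim T at_top sequentially" "\<And>n. T n \<ge> 0"
    and lim: "(\<lambda>n. w (T n)) \<longlonglongrightarrow> (X, k, Z', \<Lambda>')"
begin

lemma limit_components: "(\<lambda>n. Xc (T n)) \<longlonglongrightarrow> X" "(\<lambda>n. kc (T n)) \<longlonglongrightarrow> k"
  "(\<lambda>n. Zc (T n)) \<longlonglongrightarrow> Z'" "(\<lambda>n. \<Lambda>c (T n)) \<longlonglongrightarrow> \<Lambda>'"
  using tendsto_fst[OF lim] tendsto_fst[OF tendsto_snd[OF lim]] tendsto_fst[OF tendsto_snd[OF tendsto_snd[OF lim]]]
    tendsto_snd[OF tendsto_snd[OF tendsto_snd[OF lim]]] by simp_all

lemma limit_mem: "(X, k, Z', \<Lambda>') \<in> S"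
  by (rule closed_sequentially[OF closed_S w_mem[OF T(2)] lim])

lemma limit_consensus_x: "X = kron_ones x"
  using LIMSEQ_unique[OF limit_components(1) filterlim_compose[OF consensus_limits(1)[OF eq] T(1)]] .

text \<open>A vanishing Laplacian means consensus of the multipliers; \<open>Z\<close> is orthogonal
  to consensus vectors, so the limiting complementarity concerns the aggregate constraint.\<close>

lemma limit_consensus_l:
  obtains l' where "\<Lambda>' = kron_ones l'" "l' \<bullet> coupling own g x = 0"
proof -
  have "(\<lambda>n. L (\<Lambda>c (T n))) \<longlonglongrightarrow> L \<Lambda>'"
    by (rule bounded_linear.tendsto[OF linear_linear[THEN iffD2, OF linear_kron_id] limit_components(4)])
  then have "L \<Lambda>' = 0"
    using LIMSEQ_unique filterlim_compose[OF consensus_limits(2)[OF eq] T(1)] by blast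
  then have "\<Lambda>' = kron_ones (\<Lambda>' $ undefined)"
    by (intro L_form_zero) simp
  then obtain l' where l': "\<Lambda>' = kron_ones l'" by blast
  have "(\<lambda>n. \<Lambda>c (T n) \<bullet> (G x - Z)) \<longlonglongrightarrow> \<Lambda>' \<bullet> (G x - Z)"
    by (intro tendsto_intros limit_components)
  then have "\<Lambda>' \<bullet> (G x - Z) = 0"
    using LIMSEQ_unique filterlim_compose[OF consensus_limits(3)[OF eq] T(1)] by blast
  moreover have "kron_ones l' \<bullet> Z = 0"
    using eq by (simp add: inner_kron_ones equilibrium_def consensus_perp_def)
  ultimately have "l' \<bullet> coupling own g x = 0"
    by (simp add: l' inner_diff_right inner_kron_ones_G)
  then show thesis using that l' by blast
qed

text \<open>If a component of \<open>g\<^sub>i(x\<^sub>i) - z\<^sub>i\<close> were positive in the limit, the corresponding multiplier would grow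
  linearly on arbitrarily long time intervals, because \<open>z\<close> is asymptotically slow.\<close>

lemma limit_slack_nonpos: "G x $ i $ j \<le> Z' $ i $ j"
proof (rule ccontr)
  assume "\<not> G x $ i $ j \<le> Z' $ i $ j"
  define d where "d = G x $ i $ j - Z' $ i $ j"
  have d: "d > 0" using \<open>\<not> _\<close> by (simp add: d_def)
  have R: "R \<ge> 0" using w_bound[of 0] norm_ge_zero order_trans by blast
  \<comment> \<open>Growth at rate \<open>d / 2\<close> over this time amounts to
    \<open>R + 1\<close>, more than the bound \<open>R\<close> on a nonnegative multiplier
    permits.\<close>
  define \<tau> where "\<tau> = 2 * (R + 1) / d"
  have \<tau>: "\<tau> > 0" "d / 2 * \<tau> = R + 1" using d R by (simp_all add: \<tau>_def)
  \<comment> \<open>Small enough that \<open>z\<close> moves by at most \<open>d / 8\<close> during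
    time \<tau>, and that the Laplacian term of the multiplier equation stays below
    \<open>d / 8\<close>.\<close>
  define \<epsilon> where "\<epsilon> = d / (8 * (\<tau> + 1))"
  have \<epsilon>: "\<epsilon> > 0" "\<epsilon> * \<tau> \<le> d / 8" "\<epsilon> \<le> d / 8"
  proof -
    have *: "(\<tau> + 1) * \<epsilon> = d / 8"
      unfolding \<epsilon>_def using \<tau>(1) by (intro mult_divide_cancel_denominator) simp
    show 1: "\<epsilon> > 0" using d \<tau>(1) by (simp add: \<epsilon>_def)
    have "\<epsilon> * \<tau> > 0" using 1 \<tau>(1) by simp
    moreover have "\<epsilon> * \<tau> + \<epsilon> = d / 8"
      unfolding *[symmetric] by (simp add: distrib_right)
    ultimately show "\<epsilon> * \<tau> \<le> d / 8" "\<epsilon> \<le> d / 8" using 1 by linarith+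
  qed
  have "((\<lambda>t. select own (Xc t)) \<longlongrightarrow> select own (kron_ones x)) at_top"
    by (rule bounded_linear.tendsto[OF linear_linear[THEN iffD2, OF linear_select] consensus_limits(1)[OF eq]])
  then have sel: "((\<lambda>t. select own (Xc t)) \<longlongrightarrow> x) at_top" by simp
  have "((\<lambda>t. G (select own (Xc t)) $ i $ j) \<longlongrightarrow> G x $ i $ j) at_top"
    by (intro tendsto_vec_nth isCont_tendsto_compose[OF has_derivative_continuous[OF G_has_derivative] sel])
  then have "\<forall>\<^sub>F t in at_top. dist (G (select own (Xc t)) $ i $ j) (G x $ i $ j) < d / 8"
    using d by (intro tendstoD) auto
  moreover have "((\<lambda>t. L (\<Lambda>c t) $ i $ j) \<longlongrightarrow> 0 $ i $ j) at_top"
    by (intro tendsto_vec_nth consensus_limits(2)[OF eq])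
  then have "\<forall>\<^sub>F t in at_top. dist (L (\<Lambda>c t) $ i $ j) (0 $ i $ j) < \<epsilon>"
    using \<epsilon>(1) by (intro tendstoD) auto
  ultimately have "\<forall>\<^sub>F t in at_top. dist (G (select own (Xc t)) $ i $ j) (G x $ i $ j) < d / 8 \<and>
      dist (L (\<Lambda>c t) $ i $ j) (0 $ i $ j) < \<epsilon>"
    by (rule eventually_conj)
  then obtain t0 where t0: "\<And>t. t \<ge> t0 \<Longrightarrow> \<bar>G (select own (Xc t)) $ i $ j - G x $ i $ j\<bar> < d / 8"
    "\<And>t. t \<ge> t0 \<Longrightarrow> \<bar>L (\<Lambda>c t) $ i $ j\<bar> < \<epsilon>"
    by (auto simp: eventually_at_top_linorder dist_real_def)
  have "(\<lambda>n. Zc (T n) $ i $ j) \<longlonglongrightarrow> Z' $ i $ j"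
    by (intro tendsto_vec_nth limit_components)
  then have "\<forall>\<^sub>F n in sequentially. dist (Zc (T n) $ i $ j) (Z' $ i $ j) < d / 8"
    using d by (intro tendstoD) auto
  moreover have "\<forall>\<^sub>F n in sequentially. t0 \<le> T n"
    using T(1) by (simp add: filterlim_at_top)
  ultimately have "\<forall>\<^sub>F n in sequentially. dist (Zc (T n) $ i $ j) (Z' $ i $ j) < d / 8 \<and> t0 \<le> T n"
    by (rule eventually_conj)
  then obtain n where n: "\<bar>Zc (T n) $ i $ j - Z' $ i $ j\<bar> < d / 8" "t0 \<le> T n"
    by (auto simp: eventually_sequentially dist_real_def)
  define a where "a = T n"
  have a: "a \<ge> 0" "a \<ge> t0" using T(2) n(2) by (simp_all add: a_def)
  have bl: "bounded_linear (\<lambda>w :: ('n, 'm, 'a) state. fst (snd (snd w)) $ i $ j)"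
    "bounded_linear (\<lambda>w :: ('n, 'm, 'a) state. - (snd (snd (snd w)) $ i $ j))"
    unfolding linear_linear by (rule linearI; simp)+
  have Zle: "Zc t $ i $ j \<le> Zc a $ i $ j + \<epsilon> * (t - a)" if "a \<le> t" for t
  proof (rule linear_growth_along[OF bl(1) a(1) that])
    fix s assume "a \<le> s"
    then show "fst (snd (snd (vel s))) $ i $ j \<le> \<epsilon>"
      using t0(2)[of s] a(2) unfolding vel_eq by simp
  qed
  have "- (\<Lambda>c (a + \<tau>) $ i $ j) \<le> - (\<Lambda>c a $ i $ j) + - (d / 2) * (a + \<tau> - a)"
  proof (rule linear_growth_along[OF bl(2) a(1)])
    fix t assume t: "a \<le> t" "t \<le> a + \<tau>"
    have "\<epsilon> * (t - a) \<le> \<epsilon> * \<tau>" using t \<epsilon>(1) by (intro mult_left_mono) auto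
    then have "Zc t $ i $ j \<le> Z' $ i $ j + d / 8 + d / 8"
      using Zle[OF t(1)] n(1) \<epsilon>(2) unfolding a_def by linarith
    moreover have "\<bar>G (select own (Xc t)) $ i $ j - G x $ i $ j\<bar> < d / 8" "\<bar>L (\<Lambda>c t) $ i $ j\<bar> < \<epsilon>"
      using t0[of t] t(1) a(2) by simp_all
    moreover have "drift_l (Xc t) (Zc t) (\<Lambda>c t) $ i $ j = G (select own (Xc t)) $ i $ j - Zc t $ i $ j - L (\<Lambda>c t) $ i $ j"
      by (simp add: drift_l_def)
    \<comment> \<open>Of the slack \<open>d\<close>, one eighth is lost to \<open>G\<close>, two to
      \<open>z\<close> and one to the Laplacian.\<close>
    ultimately have "d / 2 \<le> drift_l (Xc t) (Zc t) (\<Lambda>c t) $ i $ j"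
      using \<epsilon>(3) d_def by linarith
    also have "\<dots> \<le> proj_tangent {l. 0 \<le> l} (\<Lambda>c t) (drift_l (Xc t) (Zc t) (\<Lambda>c t)) $ i $ j"
      using a(1) t(1) by (intro projected_component_ge \<Lambda>c_nonneg) simp
    finally show "- (snd (snd (snd (vel t))) $ i $ j) \<le> - (d / 2)"
      unfolding vel_eq by simp
  qed (use \<tau>(1) in simp)
  moreover have "0 \<le> \<Lambda>c a $ i $ j"
    using \<Lambda>c_nonneg[OF a(1)] by (simp add: less_eq_vec_def)
  moreover have "\<Lambda>c (a + \<tau>) $ i $ j \<le> R"
  proof -
    have "\<Lambda>c (a + \<tau>) $ i $ j \<le> norm (\<Lambda>c (a + \<tau>) $ i)"
      using component_le_norm_cart[of "\<Lambda>c (a + \<tau>) $ i" j] by simp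
    also have "\<dots> \<le> norm (\<Lambda>c (a + \<tau>))" by (rule Finite_Cartesian_Product.norm_nth_le)
    also have "\<dots> \<le> norm (w (a + \<tau>))"
      by (rule order_trans[OF norm_snd_projection order_trans[OF norm_snd_projection norm_snd_projection]])
    also have "\<dots> \<le> R" using a(1) \<tau>(1) by (intro w_bound) simp
    finally show ?thesis .
  qed
  ultimately show False using \<tau>(2) by simp
qed

text \<open>If the inequality failed at \<open>y\<close>, the distance of the estimates to
  \<open>kron_ones y\<close> would drop by a fixed amount during a fixed time after every late
  \<open>T n\<close>; but the estimates at both times tend to \<open>kron_ones x\<close>.\<close>

lemma limit_variational:
  assumes "y \<in> prod_set own \<Omega>"
  shows "0 \<le> (F x + JT x \<Lambda>') \<bullet> (y - x)"
proof (rule ccontr)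
  let ?Y = "kron_ones y :: real^'n^'a" and ?W = "(X, k, Z', \<Lambda>')"
  \<comment> \<open>On \<open>S\<close> this bounds the derivative of half the squared distance to
    \<open>?Y\<close> and, unlike the projected velocity, it is continuous. At the limit point it
    equals the supposedly negative expression.\<close>
  define H where "H = (\<lambda>w :: ('n, 'm, 'a) state. (fst w - ?Y) \<bullet> drift_x (fst w) (fst (snd w)) (snd (snd (snd w))))"
  assume neg: "\<not> 0 \<le> (F x + JT x \<Lambda>') \<bullet> (y - x)"
  have "H ?W = - (select own (kron_ones x - ?Y) \<bullet> (F x + JT x \<Lambda>'))"
    by (simp add: H_def limit_consensus_x drift_x_consensus inner_adjoint_select)
  also have "\<dots> = (F x + JT x \<Lambda>') \<bullet> (y - x)"
    by (simp add: linear_diff[OF linear_select] inner_diff_left inner_diff_right inner_commute)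
  finally have HW: "H ?W < 0" using neg by simp
  have "lipschitz_on_bounded H"
    unfolding H_def by (intro lob_intros lob_drift_x)
  then obtain M where M: "M \<ge> 0" "\<And>p q. norm p \<le> R \<Longrightarrow> norm q \<le> R \<Longrightarrow> norm (H p - H q) \<le> M * norm (p - q)"
    using lipschitz_on_boundedE by blast
  have WR: "norm ?W \<le> R"
    by (rule LIMSEQ_le_const2[OF tendsto_norm[OF lim]]) (use w_bound T(2) in blast)
  \<comment> \<open>Within this distance of the limit point \<open>H\<close> is still at most half
    its limiting value.\<close>
  define \<delta> where "\<delta> = - H ?W / (2 * (M + 1))"
  have \<delta>: "\<delta> > 0" "M * \<delta> \<le> - H ?W / 2"
  proof -
    show 1: "\<delta> > 0" unfolding \<delta>_def using HW M(1) by (intro divide_pos_pos) auto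
    have "(M + 1) * \<delta> = - H ?W / 2"
      unfolding \<delta>_def using M(1) by (intro mult_divide_cancel_denominator) simp
    then show "M * \<delta> \<le> - H ?W / 2" using 1 by (simp add: distrib_right)
  qed
  \<comment> \<open>A trajectory starting within half of \<delta> stays within \<delta> for this
    time, by its speed bound \<open>K\<close>.\<close>
  define \<tau> where "\<tau> = \<delta> / (2 * (K + 1))"
  have \<tau>: "\<tau> > 0" "K * \<tau> \<le> \<delta> / 2"
  proof -
    show 1: "\<tau> > 0" unfolding \<tau>_def using \<delta>(1) K by (intro divide_pos_pos) auto
    have "(K + 1) * \<tau> = \<delta> / 2"
      unfolding \<tau>_def using K by (intro mult_divide_cancel_denominator) simp
    then show "K * \<tau> \<le> \<delta> / 2" using 1 by (simp add: distrib_right)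
  qed
  define \<phi> where "\<phi> = (\<lambda>w :: ('n, 'm, 'a) state. (fst w - ?Y) \<bullet> (fst w - ?Y) / 2)"
  have step: "\<phi> (w (T n + \<tau>)) \<le> \<phi> (w (T n)) + H ?W / 2 * \<tau>" if n: "dist (w (T n)) ?W < \<delta> / 2" for n
  proof -
    have "\<phi> (w (T n + \<tau>)) \<le> \<phi> (w (T n)) + H ?W / 2 * (T n + \<tau> - T n)"
    proof (rule growth_along)
      show "lipschitz_on_bounded \<phi>"
        unfolding \<phi>_def divide_inverse by (intro lob_intros)
      show "(\<phi> has_derivative (\<lambda>h. (fst w - ?Y) \<bullet> fst h)) (at w)" for w
        unfolding \<phi>_def by (auto intro!: derivative_eq_intros simp: inner_commute)
      fix t assume t: "T n \<le> t" "t \<le> T n + \<tau>"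
      then have t0: "t \<ge> 0" using T(2)[of n] by simp
      have "norm (w t - ?W) \<le> norm (w t - w (T n)) + norm (w (T n) - ?W)"
        unfolding dist_norm[symmetric] by (rule dist_triangle)
      also have "\<dots> \<le> K * \<bar>t - T n\<bar> + \<delta> / 2"
        using w_lipschitz[OF T(2) t0] n by (intro add_mono) (auto simp: dist_norm)
      also have "\<dots> \<le> K * \<tau> + \<delta> / 2"
        using t K by (intro add_right_mono mult_left_mono) auto
      also have "\<dots> \<le> \<delta>" using \<tau>(2) by simp
      finally have "M * norm (w t - ?W) \<le> M * \<delta>" by (rule mult_left_mono[OF _ M(1)])
      then have H: "H (w t) \<le> H ?W / 2"
        using M(2)[OF w_bound[OF t0] WR] \<delta>(2) by simp
      have "(drift_x (Xc t) (kc t) (\<Lambda>c t) - fst (vel t)) \<bullet> (?Y - Xc t) \<le> 0"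
        using proj_tangent_normal[OF convex_ext_set Xc_mem[OF t0], of "drift_x (Xc t) (kc t) (\<Lambda>c t)"] assms
        unfolding vel_eq by (simp add: normal_cone_def kron_ones_mem_ext_set)
      then have "(Xc t - ?Y) \<bullet> fst (vel t) \<le> H (w t)"
        by (simp add: H_def inner_diff_left inner_diff_right inner_commute)
      then show "(Xc t - ?Y) \<bullet> fst (vel t) \<le> H ?W / 2" using H by simp
    qed (use T(2) \<tau>(1) in auto)
    then show ?thesis by simp
  qed
  have lim2: "(\<lambda>n. Xc (T n + \<tau>)) \<longlonglongrightarrow> kron_ones x"
  proof (rule filterlim_compose[OF consensus_limits(1)[OF eq]])
    show "filterlim (\<lambda>n. T n + \<tau>) at_top sequentially"
      by (rule filterlim_at_top_mono[OF T(1)]) (use \<tau>(1) in simp)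
  qed
  have "(kron_ones x - ?Y) \<bullet> (kron_ones x - ?Y) / 2 \<le> (kron_ones x - ?Y) \<bullet> (kron_ones x - ?Y) / 2 + H ?W / 2 * \<tau>"
  proof (rule tendsto_le[OF sequentially_bot])
    show "(\<lambda>n. \<phi> (w (T n)) + H ?W / 2 * \<tau>) \<longlonglongrightarrow> (kron_ones x - ?Y) \<bullet> (kron_ones x - ?Y) / 2 + H ?W / 2 * \<tau>"
      unfolding \<phi>_def using limit_components(1) unfolding limit_consensus_x by (intro tendsto_intros) auto
    show "(\<lambda>n. \<phi> (w (T n + \<tau>))) \<longlonglongrightarrow> (kron_ones x - ?Y) \<bullet> (kron_ones x - ?Y) / 2"
      unfolding \<phi>_def using lim2 by (intro tendsto_intros) auto
    have "\<forall>\<^sub>F n in sequentially. dist (w (T n)) ?W < \<delta> / 2"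
      using lim \<delta>(1) by (intro tendstoD) auto
    then show "\<forall>\<^sub>F n in sequentially. \<phi> (w (T n + \<tau>)) \<le> \<phi> (w (T n)) + H ?W / 2 * \<tau>"
      by eventually_elim (rule step)
  qed
  moreover have "H ?W / 2 * \<tau> < 0" using HW \<tau>(1) by (intro mult_neg_pos) auto
  ultimately show False by linarith
qed

text \<open>Aggregate complementarity splits over the agents because a vanishing sum of nonpositive
  terms has only vanishing terms.\<close>

lemma limit_equilibrium:
  obtains l' where "\<Lambda>' = kron_ones l'" "equilibrium x l' Z'"
proof -
  obtain l' where l': "\<Lambda>' = kron_ones l'" "l' \<bullet> coupling own g x = 0"
    by (rule limit_consensus_l)
  have kk: "x \<in> prod_set own \<Omega>" "coupling own g x \<le> 0"
    using eq by (auto simp: equilibrium_def kkt_iff)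
  have m: "Z' \<in> consensus_perp" "0 \<le> l'"
    using limit_mem by (simp_all add: mem_S l'(1) kron_ones_nonneg)
  have "kkt own \<Omega> g J x l'"
    unfolding kkt_iff using kk l'(2) m(2) limit_variational by (simp add: l'(1))
  have c: "G x $ i - Z' $ i \<le> 0" for i
    using limit_slack_nonpos[of i] by (simp add: less_eq_vec_def)
  have nonpos: "l' \<bullet> (G x $ i - Z' $ i) \<le> 0" for i
    using c[of i] m(2) by (auto simp: inner_vec_def less_eq_vec_def intro!: sum_nonpos mult_nonneg_nonpos)
  have "(\<Sum>i\<in>UNIV. - (l' \<bullet> (G x $ i - Z' $ i))) = - (kron_ones l' \<bullet> (G x - Z'))"
    by (simp add: inner_kron_ones inner_sum_right sum_negf)
  also have "\<dots> = 0"
    using m(1) inner_kron_ones[of l' Z'] by (simp add: inner_diff_right inner_kron_ones_G l'(2) consensus_perp_def)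
  finally have "- (l' \<bullet> (G x $ i - Z' $ i)) = 0" for i
    using nonpos by (subst (asm) sum_nonneg_eq_0_iff) auto
  then have "equilibrium x l' Z'"
    unfolding equilibrium_def using \<open>kkt own \<Omega> g J x l'\<close> m(1) c by simp
  then show thesis using that l'(1) by blast
qed

end

text \<open>The Lyapunov centre has gain \<kappa>, not the limiting gain, so its limiting value need
  not be 0. The gains converge by monotonicity; subtracting their share leaves a Lyapunov value with
  the moving centre \<open>center x (kc t) l Z\<close>, which tends to 0.\<close>

lemma trajectory_converges:
  "\<exists>x l k Z. equilibrium x l Z \<and> (w \<longlongrightarrow> center x k l Z) at_top"
proof -
  obtain x l0 where "kkt own \<Omega> g J x l0" using kkt_exists by blast
  then obtain Z0 where eq0: "equilibrium x l0 Z0" using equilibrium_exists by blast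
  have "bounded (range (\<lambda>n. w (real n)))"
    unfolding bounded_iff by (rule exI[of _ R]) (use w_bound in auto)
  then obtain W r where r: "strict_mono (r :: nat \<Rightarrow> nat)" and W: "((\<lambda>n. w (real n)) \<circ> r) \<longlonglongrightarrow> W"
    using bounded_imp_convergent_subsequence by blast
  obtain X k Z \<Lambda> where Wd: "W = (X, k, Z, \<Lambda>)" by (cases W)
  define T where "T = (\<lambda>n. real (r n))"
  have T: "filterlim T at_top sequentially" "\<And>n. T n \<ge> 0"
    unfolding T_def by (auto intro: filterlim_compose[OF filterlim_real_sequentially filterlim_subseq[OF r]])
  have lim: "(\<lambda>n. w (T n)) \<longlonglongrightarrow> (X, k, Z, \<Lambda>)"
    using W by (simp add: T_def o_def Wd)
  obtain l where l: "\<Lambda> = kron_ones l" "equilibrium x l Z"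
    using limit_equilibrium[OF eq0 T lim] by blast
  have X: "X = kron_ones x" by (rule limit_consensus_x[OF eq0 T lim])
  \<comment> \<open>Each gain is nondecreasing and bounded along the trajectory, hence converges;
    the subsequence identifies the limit.\<close>
  have k: "((\<lambda>t. kc t $ i) \<longlongrightarrow> k $ i) at_top" for i
  proof -
    have bl: "bounded_linear (\<lambda>w :: ('n, 'm, 'a) state. - (fst (snd w) $ i))"
      unfolding linear_linear by (rule linearI; simp)
    obtain u where u: "((\<lambda>t. - (kc t $ i)) \<longlongrightarrow> u) at_top"
    proof (rule nonincreasing_tendsto_at_top[of 0 "\<lambda>t. - (kc t $ i)" "- R"])
      fix s t :: real assume st: "0 \<le> s" "s \<le> t"
      have "- (kc t $ i) \<le> - (kc s $ i) + 0 * (t - s)"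
      proof (rule linear_growth_along[OF bl st])
        show "- (fst (snd (vel \<tau>)) $ i) \<le> 0" for \<tau>
          unfolding vel_eq using \<gamma>_pos[of i] by (simp add: drift_k_def)
      qed
      then show "- (kc t $ i) \<le> - (kc s $ i)" by simp
    next
      fix t :: real assume t: "0 \<le> t"
      have "\<bar>kc t $ i\<bar> \<le> norm (kc t)" by (rule component_le_norm_cart)
      also have "\<dots> \<le> norm (w t)"
        by (rule order_trans[OF norm_fst_projection norm_snd_projection])
      also have "\<dots> \<le> R" by (rule w_bound[OF t])
      finally show "- R \<le> - (kc t $ i)" by simp
    qed
    have "(\<lambda>n. - (kc (T n) $ i)) \<longlonglongrightarrow> - (k $ i)"
      by (intro tendsto_intros limit_components[OF eq0 T lim])
    then have "u = - (k $ i)"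
      using LIMSEQ_unique[OF filterlim_compose[OF u T(1)]] by blast
    then show ?thesis using tendsto_minus[OF u] by simp
  qed
  then have kv: "(kc \<longlongrightarrow> k) at_top" by (rule vec_tendstoI)
  define cen where "cen = center x (\<chi> i. \<kappa>) l Z"
  obtain v where v: "((\<lambda>t. lyap cen (w t)) \<longlongrightarrow> v) at_top"
    using lyap_tendsto[OF l(2)] unfolding cen_def by blast
  have "(\<lambda>n. lyap cen (w (T n))) \<longlonglongrightarrow> lyap cen W"
    using isCont_tendsto_compose[OF has_derivative_continuous[OF lyap_has_derivative] lim] by (simp add: Wd)
  then have vW: "v = lyap cen W"
    using LIMSEQ_unique[OF filterlim_compose[OF v T(1)]] by blast
  \<comment> \<open>The gain part of \<open>lyap cen\<close>. At the limit point \<open>W\<close> it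
    is the whole value, since the other blocks coincide with the centre.\<close>
  let ?q = "\<lambda>k :: real^'a. (\<Sum>i\<in>UNIV. (k $ i - \<kappa>) * (k $ i - \<kappa>) / \<gamma> $ i) / 2"
  have split: "lyap cen (X', k', Z'', \<Lambda>'') = lyap (center x k' l Z) (X', k', Z'', \<Lambda>'') + ?q k'" for X' k' Z'' \<Lambda>''
    unfolding lyap_def cen_def center_def diff_Pair inner_metric by (simp add: field_simps)
  have "v = ?q k"
  proof -
    have "lyap (center x k l Z) W = 0"
      by (simp add: lyap_def Wd center_def X l(1))
    then show ?thesis
      unfolding vW Wd using split[of X k Z \<Lambda>] by (simp add: Wd)
  qed
  moreover have "((\<lambda>t. ?q (kc t)) \<longlongrightarrow> ?q k) at_top"
    by (intro tendsto_intros k) (use \<gamma>_pos in \<open>simp_all add: less_imp_neq[symmetric]\<close>)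
  ultimately have "((\<lambda>t. lyap cen (w t) - ?q (kc t)) \<longlongrightarrow> 0) at_top"
    using tendsto_diff[OF v] by fastforce
  moreover have "lyap cen (w t) - ?q (kc t) = lyap (center x (kc t) l Z) (w t)" for t
    using split[of "Xc t" "kc t" "Zc t" "\<Lambda>c t"] by simp
  ultimately have q0: "((\<lambda>t. lyap (center x (kc t) l Z) (w t)) \<longlongrightarrow> 0) at_top" by simp
  obtain m where m: "m > 0" "\<And>w. m * (norm w)\<^sup>2 \<le> metric w \<bullet> w"
    using metric_coercive by blast
  have "((\<lambda>t. (norm (w t - center x (kc t) l Z))\<^sup>2) \<longlongrightarrow> 0) at_top"
  proof (rule Lim_null_comparison)
    have "(norm (w t - center x (kc t) l Z))\<^sup>2 \<le> 2 / m * lyap (center x (kc t) l Z) (w t)" for t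
      using m(2)[of "w t - center x (kc t) l Z"] m(1) by (simp add: lyap_def field_simps)
    then show "\<forall>\<^sub>F t in at_top. norm ((norm (w t - center x (kc t) l Z))\<^sup>2) \<le> 2 / m * lyap (center x (kc t) l Z) (w t)"
      by simp
    show "((\<lambda>t. 2 / m * lyap (center x (kc t) l Z) (w t)) \<longlongrightarrow> 0) at_top"
      using tendsto_mult[OF tendsto_const q0, of "2 / m"] by simp
  qed
  from tendsto_real_sqrt[OF this] have "((\<lambda>t. w t - center x (kc t) l Z) \<longlongrightarrow> 0) at_top"
    by (simp add: tendsto_norm_zero_iff)
  moreover have "((\<lambda>t. center x (kc t) l Z) \<longlongrightarrow> center x k l Z) at_top"
    unfolding center_def by (intro tendsto_intros kv)
  ultimately have "(w \<longlongrightarrow> center x k l Z) at_top"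
    using tendsto_add by fastforce
  with l(2) show ?thesis by (intro exI conjI)
qed

end

end

section \<open>Existence, uniqueness and convergence\<close>

context adaptive_game begin

text \<open>Uniqueness compares projected velocities on \<open>S\<close>, so an arbitrary solution
  must first be shown to stay there. The argument cannot use \<open>closed_loop_eq_proj\<close>,
  which presupposes membership.\<close>

lemma caratheodory_solution_invariant:
  assumes "caratheodory_solution (CL) w0 w" "w0 \<in> S" "t \<ge> 0"
  shows "w t \<in> S"
proof -
  obtain N where N: "negligible N" "w 0 = w0" "\<And>T. T \<ge> 0 \<Longrightarrow> abs_continuous_on 0 T w"
    and der: "\<And>t. t \<ge> 0 \<Longrightarrow> t \<notin> N \<Longrightarrow> (w has_vector_derivative CL (w t)) (at t within {0..})"
    using caratheodory_solutionE[OF assms(1)] by blast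
  have vel: "CL (w t) =
    (proj_tangent (ext_set own \<Omega>) (fst (w t)) (drift_x (fst (w t)) (fst (snd (w t))) (snd (snd (snd (w t))))),
     drift_k (fst (w t)), L (snd (snd (snd (w t)))),
     proj_tangent {l. 0 \<le> l} (snd (snd (snd (w t)))) (drift_l (fst (w t)) (fst (snd (snd (w t)))) (snd (snd (snd (w t))))))" for t
    unfolding closed_loop_eq[symmetric] by simp
  have init: "fst (w 0) \<in> ext_set own \<Omega>" "fst (snd (snd (w 0))) \<in> consensus_perp" "0 \<le> snd (snd (snd (w 0)))"
    using assms(2) N(2) by (cases w0; simp add: mem_S)+
  \<comment> \<open>Each constraint concerns one block of the state, and that block of the velocity
    is tangent whether or not the state lies in \<open>S\<close>.\<close>
  have part: "\<phi> (w t) \<in> A" if \<phi>: "bounded_linear \<phi>" and A: "closed A" "convex A"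
    and init: "\<phi> (w 0) \<in> A" and tan: "\<And>t. \<phi> (CL (w t)) \<in> tangent_cone A (\<phi> (w t))"
    for \<phi> :: "('n, 'm, 'a) state \<Rightarrow> 'z::euclidean_space" and A
  proof (rule tangent_velocity_invariant[OF A _ _ N(1)])
    show "A \<noteq> {}" using init by blast
    show "abs_continuous_on 0 T (\<lambda>t. \<phi> (w t))" if "T \<ge> 0" for T
      by (rule abs_continuous_on_compose[OF lob_bounded_linear[OF \<phi>] N(3)[OF that]])
    show "((\<lambda>t. \<phi> (w t)) has_vector_derivative \<phi> (CL (w t))) (at t within {0..})"
      if "t \<ge> 0" "t \<notin> N" for t
      by (rule bounded_linear.has_vector_derivative[OF \<phi> der[OF that]])
  qed (use assms(3) init tan in auto)
  have "fst (w t) \<in> ext_set own \<Omega>"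
  proof (rule part[OF bounded_linear_fst closed_ext_set convex_ext_set init(1)])
    show "fst (CL (w t)) \<in> tangent_cone (ext_set own \<Omega>) (fst (w t))" for t
      unfolding vel fst_conv
      by (rule proj_tangent_mem_tangent_cone[OF closed_ext_set convex_ext_set]) (use init(1) in blast)
  qed
  moreover have "fst (snd (snd (w t))) \<in> consensus_perp"
  proof (rule part[of "\<lambda>w. fst (snd (snd w))"])
    show "fst (snd (snd (CL (w t)))) \<in> tangent_cone consensus_perp (fst (snd (snd (w t))))" for t
      unfolding vel fst_conv snd_conv
      by (rule subspace_mem_tangent_cone[OF subspace_consensus_perp L_mem_perp])
  qed (auto intro!: bounded_linear_intros closed_subspace subspace_imp_convex subspace_consensus_perp init)
  moreover have "snd (snd (snd (w t))) \<in> {l. 0 \<le> l}"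
  proof (rule part[of "\<lambda>w. snd (snd (snd w))"])
    show "snd (snd (snd (CL (w t)))) \<in> tangent_cone {l. 0 \<le> l} (snd (snd (snd (w t))))" for t
      unfolding vel fst_conv snd_conv
      by (rule proj_tangent_mem_tangent_cone[OF closed_nonneg convex_nonneg]) (use init(3) in blast)
  qed (use init(3) closed_nonneg convex_nonneg in \<open>auto intro!: bounded_linear_intros\<close>)
  ultimately show ?thesis
    by (cases "w t") (simp add: mem_S)
qed

lemma caratheodory_solution_unique:
  assumes w: "caratheodory_solution (CL) w0 w"
    and w': "caratheodory_solution (CL) w0 w'" and "w0 \<in> S" "t \<ge> 0"
  shows "w' t = w t"
proof -
  obtain N where N: "negligible N" "w 0 = w0" "\<And>T. T \<ge> 0 \<Longrightarrow> abs_continuous_on 0 T w"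
    and der: "\<And>t. t \<ge> 0 \<Longrightarrow> t \<notin> N \<Longrightarrow> (w has_vector_derivative CL (w t)) (at t within {0..})"
    using caratheodory_solutionE[OF w] by blast
  obtain N' where N': "negligible N'" "w' 0 = w0" "\<And>T. T \<ge> 0 \<Longrightarrow> abs_continuous_on 0 T w'"
    and der': "\<And>t. t \<ge> 0 \<Longrightarrow> t \<notin> N' \<Longrightarrow> (w' has_vector_derivative CL (w' t)) (at t within {0..})"
    using caratheodory_solutionE[OF w'] by blast
  have "negligible (N \<union> N')" using N(1) N'(1) by (rule negligible_Un)
  show ?thesis
  proof (rule projected_dynamics_unique[OF closed_S convex_S _ lob_drift \<open>negligible (N \<union> N')\<close> N'(3) N(3)])
    show "S \<noteq> {}" using assms(3) by blast
    show "w' 0 = w 0" by (simp add: N N')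
    show inS': "w' t \<in> S" if "t \<ge> 0" for t using caratheodory_solution_invariant[OF w' assms(3) that] .
    show inS: "w t \<in> S" if "t \<ge> 0" for t using caratheodory_solution_invariant[OF w assms(3) that] .
    show "(w' has_vector_derivative proj_tangent S (w' t) (drift (w' t))) (at t within {0..})" if "t \<ge> 0" "t \<notin> N \<union> N'" for t
      using der'[of t] that by (simp add: closed_loop_eq_proj inS')
    show "(w has_vector_derivative proj_tangent S (w t) (drift (w t))) (at t within {0..})" if "t \<ge> 0" "t \<notin> N \<union> N'" for t
      using der[of t] that by (simp add: closed_loop_eq_proj inS)
  qed (use assms(4) in auto)
qed

lemma solution_exists_unique_converges:
  assumes "w0 \<in> S"
  shows "\<exists>w. caratheodory_solution CL w0 w \<and>
    (\<forall>w'. caratheodory_solution CL w0 w' \<longrightarrow> (\<forall>t\<ge>0. w' t = w t)) \<and>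
    (\<forall>t\<ge>0. w t \<in> S) \<and>
    (\<exists>X k Z \<Lambda> x l. CL (X, k, Z, \<Lambda>) = 0 \<and> (w \<longlongrightarrow> (X, k, Z, \<Lambda>)) at_top \<and>
       X = kron_ones x \<and> \<Lambda> = kron_ones l \<and> kkt own \<Omega> g J x l \<and>
       v_gne own \<Omega> g J x \<and> (\<forall>y. v_gne own \<Omega> g J y \<longrightarrow> y = x))"
    (is "\<exists>w. _ \<and> _ \<and> _ \<and> ?limit w")
proof (rule restricted_monotonicity)
  fix \<kappa> c :: real assume c: "c > 0" and restricted: "\<And>X x. c * (norm (X - kron_ones x))\<^sup>2 \<le>
    (select own X - x) \<bullet> (ext_pseudo_gradient own J X - F x) + \<kappa> * (norm (L X))\<^sup>2"
  obtain x0 l0 where "kkt own \<Omega> g J x0 l0" using kkt_exists by blast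
  then obtain Z0 where eq0: "equilibrium x0 l0 Z0" using equilibrium_exists by blast
  define cen where "cen = center x0 (\<chi> i. \<kappa>) l0 Z0"
  obtain m where m: "m > 0" "\<And>w. m * (norm w)\<^sup>2 \<le> metric w \<bullet> w"
    using metric_coercive by blast
  \<comment> \<open>Radius of a ball containing the Lyapunov sublevel set of \<open>w0\<close>:
    \<open>m\<close> is the coercivity constant of \<open>metric\<close>, and the 2 compensates the
    half in \<open>lyap\<close>.\<close>
  define R where "R = sqrt (2 / m * lyap cen w0) + norm cen"
  have decr: "metric (w - cen) \<bullet> proj_tangent S w (drift w) \<le> 0" if "w \<in> S" for w
  proof -
    have "0 \<le> snd (snd (snd w)) \<bullet> L (snd (snd (snd w)))" by (rule L_nonneg)
    then show ?thesis
      using dissipation[OF c restricted eq0 that] diss_bounds(2)[OF c restricted eq0 that]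
      unfolding cen_def by linarith
  qed
  have R: "norm w \<le> R" if "lyap cen w \<le> lyap cen w0" for w
  proof -
    have "(norm (w - cen))\<^sup>2 \<le> 2 / m * lyap cen w"
      using m(2)[of "w - cen"] m(1) by (simp add: lyap_def field_simps)
    also have "\<dots> \<le> 2 / m * lyap cen w0"
      using that m(1) by (intro mult_left_mono) auto
    finally have "norm (w - cen) \<le> sqrt (2 / m * lyap cen w0)"
      by (rule real_le_rsqrt)
    then show ?thesis
      using norm_triangle_ineq[of "w - cen" cen] by (simp add: R_def)
  qed
  obtain w Q K where w: "w 0 = w0" "\<And>t. t \<ge> 0 \<Longrightarrow> w t \<in> S" "\<And>t. t \<ge> 0 \<Longrightarrow> norm (w t) \<le> R"
    "K \<ge> 0" "\<And>s t. s \<ge> 0 \<Longrightarrow> t \<ge> 0 \<Longrightarrow> norm (w t - w s) \<le> K * \<bar>t - s\<bar>" "countable Q"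
    "\<And>t. t \<ge> 0 \<Longrightarrow> t \<notin> Q \<Longrightarrow> (w has_vector_derivative proj_tangent S (w t) (drift (w t))) (at t within {0..})"
    using projected_dynamics_global[OF closed_S convex_S assms lob_drift lob_lyap lyap_has_derivative decr R] by blast
  have Q: "negligible Q" using w(6) by (rule countable_imp_negligible)
  have der: "(w has_vector_derivative CL (w t)) (at t within {0..})" if "t \<ge> 0" "t \<notin> Q" for t
    using w(7)[OF that] by (simp add: closed_loop_eq_proj w(2) that)
  have sol: "caratheodory_solution (CL) w0 w"
    unfolding caratheodory_solution_def
  proof (intro conjI allI impI)
    show "w 0 = w0" by (rule w(1))
    show "abs_continuous_on 0 T w" if "T \<ge> 0" for T
    proof (rule abs_continuous_on_lipschitz[OF w(4)])
      show "norm (w t - w s) \<le> K * (t - s)" if "0 \<le> s" "s \<le> t" for s t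
        using w(5)[of s t] that by simp
    qed
    show "AE t in lebesgue. 0 \<le> t \<longrightarrow> (w has_vector_derivative CL (w t)) (at t within {0..})"
      by (rule AE_I'[of Q]) (use Q der in \<open>auto simp: negligible_iff_null_sets\<close>)
  qed
  show ?thesis
  proof (intro exI[of _ w] conjI allI impI)
    show "w' t = w t" if "caratheodory_solution (CL) w0 w'" "0 \<le> t" for w' t
      by (rule caratheodory_solution_unique[OF sol that(1) assms that(2)])
    have "\<exists>x l k Z. equilibrium x l Z \<and> (w \<longlongrightarrow> center x k l Z) at_top"
      by (rule trajectory_converges[where \<kappa> = \<kappa> and R = R and K = K and Q = Q, OF c restricted w(2,3,4,5) Q der])
    then obtain x l k Z where lim: "equilibrium x l Z" "(w \<longlongrightarrow> center x k l Z) at_top" by blast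
    have kkt: "kkt own \<Omega> g J x l" using lim(1) by (simp add: equilibrium_def)
    have v: "v_gne own \<Omega> g J x" using kkt gne_of_kkt[OF kkt] by (auto simp: v_gne_def)
    have uniq: "\<forall>y. v_gne own \<Omega> g J y \<longrightarrow> y = x"
      using kkt_unique[OF _ kkt] by (auto simp: v_gne_def)
    show "?limit w"
      by (rule exI[of _ "kron_ones x"], rule exI[of _ k], rule exI[of _ Z], rule exI[of _ "kron_ones l"],
          rule exI[of _ x], rule exI[of _ l], intro conjI refl kkt v uniq
          equilibrium_stationary[OF lim(1)] lim(2)[unfolded center_def])
  qed (simp_all add: sol w(2))
qed

end

theorem theorem1:
  fixes own :: "'n::finite \<Rightarrow> 'a::finite"
    and \<Omega> :: "'a \<Rightarrow> (real^'n) set"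
    and g :: "'a \<Rightarrow> real^'n \<Rightarrow> real^'m::finite"
    and J :: "'a \<Rightarrow> real^'n \<Rightarrow> real"
    and E :: "('a \<times> 'a) set"
    and \<gamma> :: "real^'a"
    and \<mu> \<theta>\<^sub>0 :: real
  assumes "\<And>i. \<Omega> i \<subseteq> block_space own i" "\<And>i. closed (\<Omega> i)" "\<And>i. convex (\<Omega> i)"
    and "\<And>i j. convex_on (block_space own i) (\<lambda>y. g i y $ j)"
    and "\<And>i. C2 (\<lambda>x. g i (blk own i x))"
    and "slater own \<Omega> g"
    and "\<And>i. C1 (J i)"
    and "\<And>i x. convex_on (block_space own i) (\<lambda>y. J i (repl own i y x))"
    and "\<mu> > 0" "strongly_monotone \<mu> (pseudo_gradient own J)"
    and "\<theta>\<^sub>0 > 0" "\<theta>\<^sub>0-lipschitz_on UNIV (pseudo_gradient own J)"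
    and "sym E" "\<And>i j. (i, j) \<in> E\<^sup>*"
    and "\<And>i. \<gamma> $ i > 0"
  shows "\<forall>w\<^sub>0 \<in> state_set own \<Omega>.
    \<exists>w. caratheodory_solution (closed_loop own \<Omega> g J E \<gamma>) w\<^sub>0 w \<and>
        (\<forall>w'. caratheodory_solution (closed_loop own \<Omega> g J E \<gamma>) w\<^sub>0 w' \<longrightarrow> (\<forall>t\<ge>0. w' t = w t)) \<and>
        (\<forall>t\<ge>0. w t \<in> state_set own \<Omega>) \<and>
        (\<exists>X k Z \<Lambda> x l.
           closed_loop own \<Omega> g J E \<gamma> (X, k, Z, \<Lambda>) = 0 \<and>
           (w \<longlongrightarrow> (X, k, Z, \<Lambda>)) at_top \<and>
           X = kron_ones x \<and> \<Lambda> = kron_ones l \<and>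
           kkt own \<Omega> g J x l \<and>
           v_gne own \<Omega> g J x \<and> (\<forall>y. v_gne own \<Omega> g J y \<longrightarrow> y = x))"
proof -
  interpret adaptive_game own \<Omega> g J \<mu> \<theta>\<^sub>0 E \<gamma>
    using assms(2-10,12-15) by unfold_locales
  show ?thesis
    by (intro ballI solution_exists_unique_converges)
qed

end
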